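(* Let $\Sigma\in\mathrm{FormalSmoothSet}$ be any object. Then the functor $$(\eta_\Sigma)^\ast:\mathrm{FormalSmoothSet}_{/\Im\Sigma}\longrightarrow\mathrm{EM}(J^\infty_\Sigma)\simeq\mathrm{PDE}_{/\Sigma}(\mathrm{FormalSmoothSet}),$$ from the slice over $\Im\Sigma$ to the Eilenberg–Moore category of coalgebras over the jet comonad, which equips the pullback $(\eta_\Sigma)^\ast E$ of $[E\to\Im\Sigma]$ with the coalgebra structure $$(\eta_\Sigma)^\ast E\xrightarrow{\;(\eta_\Sigma)^\ast(u_E)\;}(\eta_\Sigma)^\ast(\eta_\Sigma)_\ast(\eta_\Sigma)^\ast E=J^\infty_\Sigma\big((\eta_\Sigma)^\ast E\big),$$ where $u:\mathrm{id}\to(\eta_\Sigma)_\ast(\eta_\Sigma)^\ast$ is the unit of the adjunction $(\eta_\Sigma)^\ast\dashv(\eta_\Sigma)_\ast$, is an equivalence of categories.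
   Context: **Formal smooth sets.** $\mathrm{CartSp}$: Cartesian spaces $\mathbb{R}^n$ and smooth maps, with good open covers. $\mathrm{FormalCartSp}\hookrightarrow\mathrm{CAlg}_{\mathbb{R}}^{\mathrm{op}}$: full subcategory on objects $\mathbb{R}^n\times\mathbb{D}$ dual to $C^\infty(\mathbb{R}^n)\otimes_{\mathbb{R}}(\mathbb{R}\oplus V)$, $V$ a finite-dimensional nilpotent ideal; covering families $\{U_i\times\mathbb{D}\xrightarrow{\phi_i\times\mathrm{id}}\mathbb{R}^n\times\mathbb{D}\}$ with $\{\phi_i:U_i\to\mathbb{R}^n\}$ a good open cover. $\mathbf{H}=\mathrm{FormalSmoothSet}:=\mathrm{Sh}(\mathrm{FormalCartSp})$, $\mathrm{SmoothSet}:=\mathrm{Sh}(\mathrm{CartSp})$. The inclusion $i:\mathrm{CartSp}\hookrightarrow\mathrm{FormalCartSp}$ induces adjoints $i_!\dashv i^\ast\dashv i_\ast\dashv i^!$ between $\mathrm{SmoothSet}$ and $\mathrm{FormalSmoothSet}$. $\Im:=i_\ast i^\ast$ with unit $\eta:\mathrm{id}\to\Im$; explicitly $(\Im X)(\mathbb{R}^n\times\mathbb{D})=X(\mathbb{R}^n)$. **Disk bundles and jets.** For $f:X\to Y$ in $\mathbf{H}$ there is the base change triple $f_!\dashv f^\ast\dashv f_\ast$ between slices ($f^\ast$ is pullback, $f_!$ postcomposition). Set $T^\infty_\Sigma:=(\eta_\Sigma)^\ast(\eta_\Sigma)_!$ (a monad, unit $\eta^T$) and $J^\infty_\Sigma:=(\eta_\Sigma)^\ast(\eta_\Sigma)_\ast$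 (a comonad, counit $\epsilon$, coproduct $\Delta$) on $\mathbf{H}_{/\Sigma}$; $T^\infty_\Sigma\dashv J^\infty_\Sigma$. For $\sigma:T^\infty_\Sigma X\to Y$ write $\widetilde\sigma:X\to J^\infty_\Sigma Y$ for its adjunct. **Coalgebras.** $\mathrm{EM}(J)$ has objects $(\mathcal{E},\rho:\mathcal{E}\to J\mathcal{E})$ with $\epsilon_{\mathcal{E}}\circ\rho=\mathrm{id}$ and $J\rho\circ\rho=\Delta_{\mathcal{E}}\circ\rho$; morphisms are maps $\phi$ with $\rho'\circ\phi=J\phi\circ\rho$. **Generalized PDEs.** A generalized PDE over $\Sigma$ is a monomorphism $e_Y:\mathcal{E}\hookrightarrow J^\infty_\Sigma Y$ in $\mathbf{H}_{/\Sigma}$. For $E\in\mathbf{H}_{/\Sigma}$, an $E$-parametrized family of formal solutions of it is a morphism $s_E:T^\infty_\Sigma E\to\mathcal{E}$ such that $\sigma_E:=e_Y\circ s_E$ satisfies $\Delta_Y\circ\sigma_E\circ\eta^T_E=\widetilde{\sigma_E}:E\to J^\infty_\Sigma J^\infty_\Sigma Y$. The prolongation $\mathcal{E}^\infty\hookrightarrow J^\infty_\Sigma Y$ is the pullback of $J^\infty_\Sigma e_Y:J^\infty_\Sigma\mathcal{E}\to J^\infty_\Sigma J^\infty_\Sigma Y$ along $\Delta_Y$, with other projection $\rho^\infty_{\mathcal{E}}:\mathcal{E}^\infty\to J^\infty_\Sigma\mathcal{E}$; the PDE is formally integrable if $e^\infty_{\mathcal{E}}:=\epsilon_{\mathcal{E}}\circ\rho^\infty_{\mathcal{E}}:\mathcal{E}^\infty\to\mathcal{E}$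 is an isomorphism. $\mathrm{PDE}_{/\Sigma}(\mathbf{H})$ has as objects the formally integrable generalized PDEs and as morphisms the $\mathbf{H}_{/\Sigma}$-morphisms $\phi:\mathcal{E}\to\mathcal{E}'$ such that composition with $\phi$ sends parametrized families of formal solutions to parametrized families of formal solutions. The equivalence $\mathrm{EM}(J^\infty_\Sigma)\simeq\mathrm{PDE}_{/\Sigma}(\mathbf{H})$ sends a coalgebra $\rho:\mathcal{E}\to J^\infty_\Sigma\mathcal{E}$ to the PDE $\rho:\mathcal{E}\hookrightarrow J^\infty_\Sigma\mathcal{E}$ and is the identity on underlying morphisms. *)

theory Defs
  imports "HOL-Analysis.Analysis" "HOL-Algebra.Module"
begin

section \<open>Categories\<close>

text \<open>
  Hom-sets need not be disjoint, so the arrow part of a functor and of a category of functors is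
  indexed by domain and codomain. Composition is not: in every category below the arrows are built
  from partial maps whose domain of definition is exactly their source, and those compose without
  further information.
\<close>

record ('o, 'm) cat =
  Obj :: "'o set"
  Hom :: "'o \<Rightarrow> 'o \<Rightarrow> 'm set"
  Ide :: "'o \<Rightarrow> 'm"
  Cmp :: "'m \<Rightarrow> 'm \<Rightarrow> 'm"

abbreviation cmp_in :: "'m \<Rightarrow> ('o, 'm) cat \<Rightarrow> 'm \<Rightarrow> 'm"  (\<open>(_ \<cdot>\<^bsub>_\<^esub> _)\<close> [76, 0, 75] 75)
  where "g \<cdot>\<^bsub>C\<^esub> f \<equiv> Cmp C g f"

definition category :: "('o, 'm) cat \<Rightarrow> bool" where
  "category C \<longleftrightarrow>
     (\<forall>a \<in> Obj C. Ide C a \<in> Hom C a a) \<and>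
     (\<forall>a \<in> Obj C. \<forall>b \<in> Obj C. \<forall>c \<in> Obj C. \<forall>f \<in> Hom C a b. \<forall>g \<in> Hom C b c.
        g \<cdot>\<^bsub>C\<^esub> f \<in> Hom C a c) \<and>
     (\<forall>a \<in> Obj C. \<forall>b \<in> Obj C. \<forall>f \<in> Hom C a b. f \<cdot>\<^bsub>C\<^esub> Ide C a = f \<and> Ide C b \<cdot>\<^bsub>C\<^esub> f = f) \<and>
     (\<forall>a \<in> Obj C. \<forall>b \<in> Obj C. \<forall>c \<in> Obj C. \<forall>d \<in> Obj C.
        \<forall>f \<in> Hom C a b. \<forall>g \<in> Hom C b c. \<forall>h \<in> Hom C c d.
        h \<cdot>\<^bsub>C\<^esub> (g \<cdot>\<^bsub>C\<^esub> f) = (h \<cdot>\<^bsub>C\<^esub> g) \<cdot>\<^bsub>C\<^esub> f)"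

definition op_cat :: "('o, 'm) cat \<Rightarrow> ('o, 'm) cat" where
  "op_cat C = \<lparr>Obj = Obj C, Hom = (\<lambda>a b. Hom C b a), Ide = Ide C, Cmp = (\<lambda>g f. f \<cdot>\<^bsub>C\<^esub> g)\<rparr>"

record ('o, 'm, 'p, 'k) functr =
  fo :: "'o \<Rightarrow> 'p"
  fm :: "'o \<Rightarrow> 'o \<Rightarrow> 'm \<Rightarrow> 'k"

definition is_functor :: "('o, 'm) cat \<Rightarrow> ('p, 'k) cat \<Rightarrow> ('o, 'm, 'p, 'k) functr \<Rightarrow> bool" where
  "is_functor C D F \<longleftrightarrow>
     category C \<and> category D \<and>
     (\<forall>a \<in> Obj C. fo F a \<in> Obj D) \<and>
     (\<forall>a \<in> Obj C. \<forall>b \<in> Obj C. \<forall>f \<in> Hom C a b. fm F a b f \<in> Hom D (fo F a) (fo F b)) \<and>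
     (\<forall>a \<in> Obj C. fm F a a (Ide C a) = Ide D (fo F a)) \<and>
     (\<forall>a \<in> Obj C. \<forall>b \<in> Obj C. \<forall>c \<in> Obj C. \<forall>f \<in> Hom C a b. \<forall>g \<in> Hom C b c.
        fm F a c (g \<cdot>\<^bsub>C\<^esub> f) = fm F b c g \<cdot>\<^bsub>D\<^esub> fm F a b f)"

definition id_functor :: "('o, 'm, 'o, 'm) functr" where
  "id_functor = \<lparr>fo = (\<lambda>a. a), fm = (\<lambda>a b f. f)\<rparr>"

definition functor_comp ::
  "('p, 'k, 'q, 'l) functr \<Rightarrow> ('o, 'm, 'p, 'k) functr \<Rightarrow> ('o, 'm, 'q, 'l) functr" where
  "functor_comp G F = \<lparr>fo = (\<lambda>a. fo G (fo F a)), fm = (\<lambda>a b f. fm G (fo F a) (fo F b) (fm F a b f))\<rparr>"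

definition nat_trans ::
  "('o, 'm) cat \<Rightarrow> ('p, 'k) cat \<Rightarrow> ('o, 'm, 'p, 'k) functr \<Rightarrow> ('o, 'm, 'p, 'k) functr
     \<Rightarrow> ('o \<Rightarrow> 'k) \<Rightarrow> bool" where
  "nat_trans C D F G \<alpha> \<longleftrightarrow>
     (\<forall>a \<in> Obj C. \<alpha> a \<in> Hom D (fo F a) (fo G a)) \<and>
     (\<forall>a \<in> Obj C. \<forall>b \<in> Obj C. \<forall>f \<in> Hom C a b.
        \<alpha> b \<cdot>\<^bsub>D\<^esub> fm F a b f = fm G a b f \<cdot>\<^bsub>D\<^esub> \<alpha> a)"

definition is_iso :: "('o, 'm) cat \<Rightarrow> 'o \<Rightarrow> 'o \<Rightarrow> 'm \<Rightarrow> bool" where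
  "is_iso C a b f \<longleftrightarrow>
     f \<in> Hom C a b \<and> (\<exists>g \<in> Hom C b a. g \<cdot>\<^bsub>C\<^esub> f = Ide C a \<and> f \<cdot>\<^bsub>C\<^esub> g = Ide C b)"

definition is_mono :: "('o, 'm) cat \<Rightarrow> 'o \<Rightarrow> 'o \<Rightarrow> 'm \<Rightarrow> bool" where
  "is_mono C a b f \<longleftrightarrow>
     f \<in> Hom C a b \<and>
     (\<forall>z \<in> Obj C. \<forall>g \<in> Hom C z a. \<forall>h \<in> Hom C z a. f \<cdot>\<^bsub>C\<^esub> g = f \<cdot>\<^bsub>C\<^esub> h \<longrightarrow> g = h)"

definition nat_iso ::
  "('o, 'm) cat \<Rightarrow> ('p, 'k) cat \<Rightarrow> ('o, 'm, 'p, 'k) functr \<Rightarrow> ('o, 'm, 'p, 'k) functr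
     \<Rightarrow> ('o \<Rightarrow> 'k) \<Rightarrow> bool" where
  "nat_iso C D F G \<alpha> \<longleftrightarrow>
     nat_trans C D F G \<alpha> \<and> (\<forall>a \<in> Obj C. is_iso D (fo F a) (fo G a) (\<alpha> a))"

definition is_equivalence :: "('o, 'm) cat \<Rightarrow> ('p, 'k) cat \<Rightarrow> ('o, 'm, 'p, 'k) functr \<Rightarrow> bool" where
  "is_equivalence C D F \<longleftrightarrow>
     is_functor C D F \<and>
     (\<exists>G \<alpha> \<beta>. is_functor D C G \<and>
        nat_iso C C id_functor (functor_comp G F) \<alpha> \<and> nat_iso D D (functor_comp F G) id_functor \<beta>)"

text \<open>\<open>F\<close> is left adjoint to \<open>G\<close>, with unit \<open>u\<close> and counit \<open>e\<close>.\<close>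

definition adjunction ::
  "('o, 'm) cat \<Rightarrow> ('p, 'k) cat \<Rightarrow> ('o, 'm, 'p, 'k) functr \<Rightarrow> ('p, 'k, 'o, 'm) functr
     \<Rightarrow> ('o \<Rightarrow> 'm) \<Rightarrow> ('p \<Rightarrow> 'k) \<Rightarrow> bool" where
  "adjunction C D F G u e \<longleftrightarrow>
     is_functor C D F \<and> is_functor D C G \<and>
     nat_trans C C id_functor (functor_comp G F) u \<and> nat_trans D D (functor_comp F G) id_functor e \<and>
     (\<forall>a \<in> Obj C. e (fo F a) \<cdot>\<^bsub>D\<^esub> fm F a (fo G (fo F a)) (u a) = Ide D (fo F a)) \<and>
     (\<forall>b \<in> Obj D. fm G (fo F (fo G b)) b (e b) \<cdot>\<^bsub>C\<^esub> u (fo G b) = Ide C (fo G b))"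

text \<open>The square with sides \<open>i : p \<rightarrow> a\<close>, \<open>f : a \<rightarrow> c\<close>, \<open>j : p \<rightarrow> b\<close>, \<open>g : b \<rightarrow> c\<close> is a pullback.\<close>

definition is_pullback ::
  "('o, 'm) cat \<Rightarrow> 'o \<Rightarrow> 'o \<Rightarrow> 'o \<Rightarrow> 'o \<Rightarrow> 'm \<Rightarrow> 'm \<Rightarrow> 'm \<Rightarrow> 'm \<Rightarrow> bool" where
  "is_pullback C p a b c i f j g \<longleftrightarrow>
     p \<in> Obj C \<and> i \<in> Hom C p a \<and> f \<in> Hom C a c \<and> j \<in> Hom C p b \<and> g \<in> Hom C b c \<and>
     f \<cdot>\<^bsub>C\<^esub> i = g \<cdot>\<^bsub>C\<^esub> j \<and>
     (\<forall>z \<in> Obj C. \<forall>k \<in> Hom C z a. \<forall>l \<in> Hom C z b. f \<cdot>\<^bsub>C\<^esub> k = g \<cdot>\<^bsub>C\<^esub> l \<longrightarrow>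
        (\<exists>!h. h \<in> Hom C z p \<and> i \<cdot>\<^bsub>C\<^esub> h = k \<and> j \<cdot>\<^bsub>C\<^esub> h = l))"

definition slice :: "('o, 'm) cat \<Rightarrow> 'o \<Rightarrow> ('o \<times> 'm, 'm) cat" where
  "slice C b =
     \<lparr>Obj = {(E, p). E \<in> Obj C \<and> p \<in> Hom C E b},
      Hom = (\<lambda>(E, p) (E', p'). {f \<in> Hom C E E'. p' \<cdot>\<^bsub>C\<^esub> f = p}),
      Ide = (\<lambda>(E, p). Ide C E),
      Cmp = Cmp C\<rparr>"

text \<open>Coalgebras of the comonad \<open>J\<close> with counit \<open>e\<close> and coproduct \<open>d\<close>.\<close>

definition em_cat ::
  "('o, 'm) cat \<Rightarrow> ('o, 'm, 'o, 'm) functr \<Rightarrow> ('o \<Rightarrow> 'm) \<Rightarrow> ('o \<Rightarrow> 'm) \<Rightarrow> ('o \<times> 'm, 'm) cat" where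
  "em_cat C J e d =
     \<lparr>Obj = {(E, \<rho>). E \<in> Obj C \<and> \<rho> \<in> Hom C E (fo J E) \<and> e E \<cdot>\<^bsub>C\<^esub> \<rho> = Ide C E \<and>
                      fm J E (fo J E) \<rho> \<cdot>\<^bsub>C\<^esub> \<rho> = d E \<cdot>\<^bsub>C\<^esub> \<rho>},
      Hom = (\<lambda>(E, \<rho>) (E', \<rho>'). {f \<in> Hom C E E'. \<rho>' \<cdot>\<^bsub>C\<^esub> f = fm J E E' f \<cdot>\<^bsub>C\<^esub> \<rho>}),
      Ide = (\<lambda>(E, \<rho>). Ide C E),
      Cmp = Cmp C\<rparr>"


section \<open>Generalized PDEs\<close>

text \<open>
  Parameters: an endofunctor \<open>T\<close> with unit \<open>n\<close>, a comonad \<open>J\<close> with counit \<open>e\<close> and coproduct \<open>d\<close>,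
  and the function \<open>adj E Y\<close> sending an arrow \<open>T E \<rightarrow> Y\<close> to its adjunct \<open>E \<rightarrow> J Y\<close>.
  A generalized PDE \<open>m : \<E> \<rightarrow> J Y\<close> is the triple \<open>(Y, \<E>, m)\<close>.
\<close>

definition generalized_pde ::
  "('o, 'm) cat \<Rightarrow> ('o, 'm, 'o, 'm) functr \<Rightarrow> 'o \<times> 'o \<times> 'm \<Rightarrow> bool" where
  "generalized_pde C J = (\<lambda>(Y, \<E>, m). Y \<in> Obj C \<and> \<E> \<in> Obj C \<and> is_mono C \<E> (fo J Y) m)"

definition formal_solution_family ::
  "('o, 'm) cat \<Rightarrow> ('o, 'm, 'o, 'm) functr \<Rightarrow> ('o \<Rightarrow> 'm) \<Rightarrow> ('o, 'm, 'o, 'm) functr \<Rightarrow> ('o \<Rightarrow> 'm)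
     \<Rightarrow> ('o \<Rightarrow> 'o \<Rightarrow> 'm \<Rightarrow> 'm) \<Rightarrow> 'o \<times> 'o \<times> 'm \<Rightarrow> 'o \<Rightarrow> 'm \<Rightarrow> bool" where
  "formal_solution_family C T n J d adj = (\<lambda>(Y, \<E>, m) E s.
     E \<in> Obj C \<and> s \<in> Hom C (fo T E) \<E> \<and>
     d Y \<cdot>\<^bsub>C\<^esub> ((m \<cdot>\<^bsub>C\<^esub> s) \<cdot>\<^bsub>C\<^esub> n E) = adj E (fo J Y) (m \<cdot>\<^bsub>C\<^esub> s))"

text \<open>The pullback \<open>P\<close> is the prolongation of the PDE.\<close>

definition formally_integrable ::
  "('o, 'm) cat \<Rightarrow> ('o, 'm, 'o, 'm) functr \<Rightarrow> ('o \<Rightarrow> 'm) \<Rightarrow> ('o \<Rightarrow> 'm) \<Rightarrow> 'o \<times> 'o \<times> 'm \<Rightarrow> bool" where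
  "formally_integrable C J e d = (\<lambda>(Y, \<E>, m).
     \<exists>P i \<rho>. is_pullback C P (fo J Y) (fo J \<E>) (fo J (fo J Y)) i (d Y) \<rho> (fm J \<E> (fo J Y) m) \<and>
             is_iso C P \<E> (e \<E> \<cdot>\<^bsub>C\<^esub> \<rho>))"

definition pde_cat ::
  "('o, 'm) cat \<Rightarrow> ('o, 'm, 'o, 'm) functr \<Rightarrow> ('o \<Rightarrow> 'm) \<Rightarrow> ('o, 'm, 'o, 'm) functr \<Rightarrow> ('o \<Rightarrow> 'm)
     \<Rightarrow> ('o \<Rightarrow> 'm) \<Rightarrow> ('o \<Rightarrow> 'o \<Rightarrow> 'm \<Rightarrow> 'm) \<Rightarrow> ('o \<times> 'o \<times> 'm, 'm) cat" where
  "pde_cat C T n J e d adj =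
     \<lparr>Obj = {A. generalized_pde C J A \<and> formally_integrable C J e d A},
      Hom = (\<lambda>(Y, \<E>, m) (Y', \<E>', m'). {f \<in> Hom C \<E> \<E>'. \<forall>E s.
               formal_solution_family C T n J d adj (Y, \<E>, m) E s \<longrightarrow>
               formal_solution_family C T n J d adj (Y', \<E>', m') E (f \<cdot>\<^bsub>C\<^esub> s)}),
      Ide = (\<lambda>(Y, \<E>, m). Ide C \<E>),
      Cmp = Cmp C\<rparr>"

text \<open>A coalgebra \<open>\<rho> : \<E> \<rightarrow> J \<E>\<close> regarded as a PDE.\<close>

definition em_to_pde :: "('o \<times> 'm, 'm, 'o \<times> 'o \<times> 'm, 'm) functr" where
  "em_to_pde = \<lparr>fo = (\<lambda>(\<E>, \<rho>). (\<E>, \<E>, \<rho>)), fm = (\<lambda>A B f. f)\<rparr>"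


section \<open>Sheaves of sets\<close>

text \<open>
  A universe of small sets. Only closure under subsets and binary products is asked for, which is
  what the formation of pullbacks uses; both a Grothendieck universe and the collection of all
  sets of elements of an infinite type qualify.
\<close>

class set_universe =
  fixes small :: "'a set \<Rightarrow> bool"
    and upair :: "'a \<times> 'a \<Rightarrow> 'a"
  assumes inj_upair: "inj upair"
    and small_subset: "small A \<Longrightarrow> B \<subseteq> A \<Longrightarrow> small B"
    and small_times: "small A \<Longrightarrow> small B \<Longrightarrow> small (upair ` (A \<times> B))"

definition unpair :: "'a::set_universe \<Rightarrow> 'a \<times> 'a" where
  "unpair = inv_into UNIV upair"

definition Sets :: "('u::set_universe set, 'u \<rightharpoonup> 'u) cat" where
  "Sets = \<lparr>Obj = {A. small A},
           Hom = (\<lambda>A B. {f. dom f = A \<and> ran f \<subseteq> B}),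
           Ide = (\<lambda>A. Some |` A),
           Cmp = (\<lambda>g f. g \<circ>\<^sub>m f)\<rparr>"

type_synonym ('o, 'm, 'u) psh = "('o, 'm, 'u set, 'u \<rightharpoonup> 'u) functr"
type_synonym ('o, 'u) psh_map = "'o \<Rightarrow> 'u \<rightharpoonup> 'u"

text \<open>
  \<open>K c\<close> is the set of covering families of \<open>c\<close>; a member \<open>(d, f)\<close> of a family is an arrow
  \<open>f : d \<rightarrow> c\<close>. A matching family has to agree on all commuting squares \<open>f \<circ> g = f' \<circ> g'\<close>, as the
  site is not required to have pullbacks. For \<open>f : d \<rightarrow> c\<close> the restriction \<open>X c \<rightarrow> X d\<close> is
  \<open>fm X c d f\<close>.
\<close>

definition matching_family ::
  "('o, 'm) cat \<Rightarrow> ('o, 'm, 'u) psh \<Rightarrow> 'o \<Rightarrow> ('o \<times> 'm) set \<Rightarrow> ('o \<times> 'm \<Rightarrow> 'u) \<Rightarrow> bool" where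
  "matching_family S X c R x \<longleftrightarrow>
     (\<forall>(d, f) \<in> R. x (d, f) \<in> fo X d) \<and>
     (\<forall>(d, f) \<in> R. \<forall>(d', f') \<in> R. \<forall>a \<in> Obj S. \<forall>g \<in> Hom S a d. \<forall>g' \<in> Hom S a d'.
        f \<cdot>\<^bsub>S\<^esub> g = f' \<cdot>\<^bsub>S\<^esub> g' \<longrightarrow> fm X d a g (x (d, f)) = fm X d' a g' (x (d', f')))"

definition is_sheaf ::
  "('o, 'm) cat \<Rightarrow> ('o \<Rightarrow> ('o \<times> 'm) set set) \<Rightarrow> ('o, 'm, 'u::set_universe) psh \<Rightarrow> bool" where
  "is_sheaf S K X \<longleftrightarrow>
     is_functor (op_cat S) Sets X \<and>
     (\<forall>c \<in> Obj S. \<forall>R \<in> K c. \<forall>x. matching_family S X c R x \<longrightarrow>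
        (\<exists>!s. s \<in> fo X c \<and> (\<forall>(d, f) \<in> R. fm X c d f s = Some (x (d, f)))))"

text \<open>Components of a map of sheaves outside the objects of the site are normalised to be empty.\<close>

definition Sheaves ::
  "('o, 'm) cat \<Rightarrow> ('o \<Rightarrow> ('o \<times> 'm) set set)
     \<Rightarrow> (('o, 'm, 'u::set_universe) psh, ('o, 'u) psh_map) cat" where
  "Sheaves S K =
     \<lparr>Obj = {X. is_sheaf S K X},
      Hom = (\<lambda>X Y. {\<alpha>. nat_trans (op_cat S) Sets X Y \<alpha> \<and> (\<forall>c. c \<notin> Obj S \<longrightarrow> \<alpha> c = Map.empty)}),
      Ide = (\<lambda>X c. if c \<in> Obj S then Some |` fo X c else Map.empty),
      Cmp = (\<lambda>\<beta> \<alpha> c. \<beta> c \<circ>\<^sub>m \<alpha> c)\<rparr>"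


subsection \<open>Base change\<close>

text \<open>
  For \<open>f : X \<rightarrow> Y\<close> and \<open>p : E \<rightarrow> Y\<close>, \<open>fib_set f p c\<close> consists of the pairs
  \<open>(s, x)\<close> in \<open>E c \<times> X c\<close> with \<open>p s = f x\<close>. Recall that the domain of \<open>p c\<close> is \<open>E c\<close>.
\<close>

definition fib_set :: "('o, 'u) psh_map \<Rightarrow> ('o, 'u::set_universe) psh_map \<Rightarrow> 'o \<Rightarrow> 'u set" where
  "fib_set f p c = {upair (s, x) | s x y. p c s = Some y \<and> f c x = Some y}"

definition pair_map ::
  "'u::set_universe set \<Rightarrow> ('u \<rightharpoonup> 'u) \<Rightarrow> ('u \<rightharpoonup> 'u) \<Rightarrow> ('u \<rightharpoonup> 'u)" where
  "pair_map A g h = (\<lambda>z. if z \<in> A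
     then Some (upair (the (g (fst (unpair z))), the (h (snd (unpair z))))) else None)"

definition fib_prod ::
  "('o, 'm, 'u) psh \<Rightarrow> ('o, 'u) psh_map \<Rightarrow> ('o, 'm, 'u) psh \<Rightarrow> ('o, 'u) psh_map
     \<Rightarrow> ('o, 'm, 'u::set_universe) psh" where
  "fib_prod X f E p =
     \<lparr>fo = fib_set f p, fm = (\<lambda>c d g. pair_map (fib_set f p c) (fm E c d g) (fm X c d g))\<rparr>"

definition fib_proj :: "('o, 'u) psh_map \<Rightarrow> ('o, 'u::set_universe) psh_map \<Rightarrow> ('o, 'u) psh_map" where
  "fib_proj f p = (\<lambda>c z. if z \<in> fib_set f p c then Some (snd (unpair z)) else None)"

text \<open>For \<open>f : X \<rightarrow> Y\<close>: the pullback functor \<open>f\<^sup>*\<close> and its left adjoint \<open>f\<^sub>!\<close>.\<close>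

definition base_pull ::
  "('o, 'm, 'u) psh \<Rightarrow> ('o, 'u) psh_map \<Rightarrow>
     (('o, 'm, 'u) psh \<times> ('o, 'u) psh_map, ('o, 'u) psh_map,
      ('o, 'm, 'u::set_universe) psh \<times> ('o, 'u) psh_map, ('o, 'u) psh_map) functr" where
  "base_pull X f =
     \<lparr>fo = (\<lambda>(E, p). (fib_prod X f E p, fib_proj f p)),
      fm = (\<lambda>(E, p) (E', p') \<phi> c. pair_map (fib_set f p c) (\<phi> c) Some)\<rparr>"

definition base_post ::
  "('o, 'u) psh_map \<Rightarrow>
     (('o, 'm, 'u) psh \<times> ('o, 'u) psh_map, ('o, 'u) psh_map,
      ('o, 'm, 'u) psh \<times> ('o, 'u) psh_map, ('o, 'u) psh_map) functr" where
  "base_post f = \<lparr>fo = (\<lambda>(E, p). (E, \<lambda>c. f c \<circ>\<^sub>m p c)), fm = (\<lambda>A B \<phi>. \<phi>)\<rparr>"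

text \<open>The unit \<open>E \<rightarrow> f\<^sup>* f\<^sub>! E\<close>, \<open>s \<mapsto> (s, p s)\<close>.\<close>

definition base_unit ::
  "('o, 'm, 'u) psh \<times> ('o, 'u) psh_map \<Rightarrow> ('o, 'u::set_universe) psh_map" where
  "base_unit = (\<lambda>(E, p) c s. map_option (\<lambda>x. upair (s, x)) (p c s))"


section \<open>Smooth functions and good open covers\<close>

definition Rn :: "nat \<Rightarrow> (nat \<Rightarrow> real) set" where
  "Rn n = {x. \<forall>i \<ge> n. x i = 0}"

definition part :: "nat \<Rightarrow> ((nat \<Rightarrow> real) \<Rightarrow> real) \<Rightarrow> (nat \<Rightarrow> real) \<Rightarrow> real" where
  "part i f x = deriv (\<lambda>t. f (x(i := t))) (x i)"

text \<open>
  All iterated partial derivatives exist and are continuous; \<open>U\<close> is meant to be open in \<open>Rn n\<close>.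
\<close>

definition smooth_on :: "nat \<Rightarrow> (nat \<Rightarrow> real) set \<Rightarrow> ((nat \<Rightarrow> real) \<Rightarrow> real) \<Rightarrow> bool" where
  "smooth_on n U f \<longleftrightarrow> (\<forall>js. set js \<subseteq> {..<n} \<longrightarrow>
     continuous_on U (foldr part js f) \<and>
     (\<forall>i < n. \<forall>x \<in> U. (\<lambda>t. foldr part js f (x(i := t))) field_differentiable (at (x i))))"

definition diffeo_onto ::
  "nat \<Rightarrow> (nat \<Rightarrow> real) set \<Rightarrow> (nat \<Rightarrow> real) set \<Rightarrow> ((nat \<Rightarrow> real) \<Rightarrow> nat \<Rightarrow> real) \<Rightarrow> bool" where
  "diffeo_onto n U V \<phi> \<longleftrightarrow>
     bij_betw \<phi> U V \<and>
     (\<forall>i < n. smooth_on n U (\<lambda>x. \<phi> x i)) \<and> (\<forall>i < n. smooth_on n V (\<lambda>y. inv_into U \<phi> y i))"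

text \<open>
  A good open cover of \<open>Rn n\<close>, given by its open embeddings \<open>Rn n \<rightarrow> Rn n\<close>: all nonempty finite
  intersections of the images are diffeomorphic to \<open>Rn n\<close>.
\<close>

definition good_open_cover :: "nat \<Rightarrow> ((nat \<Rightarrow> real) \<Rightarrow> nat \<Rightarrow> real) set \<Rightarrow> bool" where
  "good_open_cover n \<Phi> \<longleftrightarrow>
     (\<forall>\<phi> \<in> \<Phi>. openin (top_of_set (Rn n)) (\<phi> ` Rn n) \<and> diffeo_onto n (Rn n) (\<phi> ` Rn n) \<phi>) \<and>
     (\<Union>\<phi> \<in> \<Phi>. \<phi> ` Rn n) = Rn n \<and>
     (\<forall>F \<subseteq> \<Phi>. finite F \<and> F \<noteq> {} \<and> (\<Inter>\<phi> \<in> F. \<phi> ` Rn n) \<noteq> {} \<longrightarrow>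
        (\<exists>\<psi>. diffeo_onto n (Rn n) (\<Inter>\<phi> \<in> F. \<phi> ` Rn n) \<psi>))"


section \<open>Formal Cartesian spaces\<close>

text \<open>
  The data \<open>(k, c)\<close> describe a \<open>k\<close>-dimensional algebra \<open>V\<close> with basis \<open>e\<^sub>1, \<dots>, e\<^sub>k\<close> and structure
  constants \<open>c\<close>, i.e. \<open>e\<^sub>i e\<^sub>j\<close> is the sum of the \<open>c i j l e\<^sub>l\<close>. An element of \<open>\<real> \<oplus> V\<close> is its
  coordinate vector, with the coefficient of the unit at index 0.
\<close>

type_synonym thickening = "nat \<times> (nat \<Rightarrow> nat \<Rightarrow> nat \<Rightarrow> real)"

definition weil :: "thickening \<Rightarrow> (real, nat \<Rightarrow> real) module" where
  "weil = (\<lambda>(k, c).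
     \<lparr>carrier = {v. \<forall>l > k. v l = 0},
      mult = (\<lambda>v w l. if l = 0 then v 0 * w 0
                      else if l \<le> k then v 0 * w l + v l * w 0
                                         + (\<Sum>i = 1..k. \<Sum>j = 1..k. c i j l * v i * w j)
                      else 0),
      one = (\<lambda>l. if l = 0 then 1 else 0),
      zero = (\<lambda>l. 0),
      add = (\<lambda>v w l. v l + w l),
      smult = (\<lambda>r v l. r * v l)\<rparr>)"

definition infinitesimal :: "thickening \<Rightarrow> bool" where
  "infinitesimal D \<longleftrightarrow>
     cring (weil D) \<and>
     (\<exists>N. \<forall>vs. length vs = N \<and> set vs \<subseteq> {v \<in> carrier (weil D). v 0 = 0} \<longrightarrow>
        foldr (mult (weil D)) vs (one (weil D)) = zero (weil D))"

definition point :: thickening where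
  "point = (0, \<lambda>i j l. 0)"

text \<open>
  The algebra \<open>C\<^sup>\<infinity>(\<real>\<^sup>n) \<otimes> (\<real> \<oplus> V)\<close>: tensoring with a finite-dimensional algebra amounts to taking
  smooth functions with values in it, with pointwise operations.
\<close>

type_synonym elt = "(nat \<Rightarrow> real) \<Rightarrow> nat \<Rightarrow> real"

definition fun_alg :: "nat \<times> thickening \<Rightarrow> (real, elt) module" where
  "fun_alg = (\<lambda>(n, D).
     \<lparr>carrier = {f \<in> Rn n \<rightarrow>\<^sub>E carrier (weil D). \<forall>l. smooth_on n (Rn n) (\<lambda>x. f x l)},
      mult = (\<lambda>f g. \<lambda>x \<in> Rn n. f x \<otimes>\<^bsub>weil D\<^esub> g x),
      one = (\<lambda>x \<in> Rn n. \<one>\<^bsub>weil D\<^esub>),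
      zero = (\<lambda>x \<in> Rn n. \<zero>\<^bsub>weil D\<^esub>),
      add = (\<lambda>f g. \<lambda>x \<in> Rn n. f x \<oplus>\<^bsub>weil D\<^esub> g x),
      smult = (\<lambda>r f. \<lambda>x \<in> Rn n. r \<odot>\<^bsub>weil D\<^esub> f x)\<rparr>)"

definition alg_hom :: "(real, 'a) module \<Rightarrow> (real, 'b) module \<Rightarrow> ('a \<rightharpoonup> 'b) set" where
  "alg_hom A B = {h. dom h = carrier A \<and> (\<lambda>a. the (h a)) \<in> ring_hom A B \<and>
     (\<forall>r. \<forall>a \<in> carrier A. the (h (r \<odot>\<^bsub>A\<^esub> a)) = r \<odot>\<^bsub>B\<^esub> the (h a))}"

text \<open>
  The object \<open>(n, D)\<close> stands for the space dual to \<open>fun_alg (n, D)\<close>, so an arrow \<open>a \<rightarrow> b\<close> is a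
  homomorphism \<open>fun_alg b \<rightarrow> fun_alg a\<close>. The Cartesian space \<open>\<real>\<^sup>n\<close> is \<open>(n, point)\<close>.
\<close>

type_synonym fcs = "nat \<times> thickening"
type_synonym fcs_map = "elt \<rightharpoonup> elt"

definition FormalCartSp :: "(fcs, fcs_map) cat" where
  "FormalCartSp =
     \<lparr>Obj = {(n, D). infinitesimal D},
      Hom = (\<lambda>a b. alg_hom (fun_alg b) (fun_alg a)),
      Ide = (\<lambda>a. Some |` carrier (fun_alg a)),
      Cmp = (\<lambda>g f. f \<circ>\<^sub>m g)\<rparr>"

text \<open>For \<open>\<phi> : \<real>\<^sup>n \<rightarrow> \<real>\<^sup>n\<close>, the arrow \<open>\<phi> \<times> id\<close> on \<open>(n, D)\<close>.\<close>

definition times_id :: "fcs \<Rightarrow> ((nat \<Rightarrow> real) \<Rightarrow> nat \<Rightarrow> real) \<Rightarrow> fcs_map" where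
  "times_id a \<phi> = (\<lambda>f. if f \<in> carrier (fun_alg a) then Some (\<lambda>x \<in> Rn (fst a). f (\<phi> x)) else None)"

definition formal_covers :: "fcs \<Rightarrow> (fcs \<times> fcs_map) set set" where
  "formal_covers a = {(\<lambda>\<phi>. (a, times_id a \<phi>)) ` \<Phi> | \<Phi>. good_open_cover (fst a) \<Phi>}"

type_synonym 'u fpsh = "(fcs, fcs_map, 'u) psh"
type_synonym 'u fpsh_map = "(fcs, 'u) psh_map"

definition FormalSmoothSet :: "('u::set_universe fpsh, 'u fpsh_map) cat" where
  "FormalSmoothSet = Sheaves FormalCartSp formal_covers"


section \<open>The infinitesimal shape modality\<close>

definition red :: "fcs \<Rightarrow> fcs" where
  "red a = (fst a, point)"

text \<open>
  \<open>red_incl a : red a \<rightarrow> a\<close> is dual to the quotient by \<open>V\<close>, and \<open>red_proj a : a \<rightarrow> red a\<close> is dual to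
  the inclusion of \<open>C\<^sup>\<infinity>(\<real>\<^sup>n)\<close>. Since homomorphisms preserve nilpotents, every arrow
  \<open>f : a \<rightarrow> b\<close> restricts along \<open>red_incl\<close> to the arrow \<open>red_map a b f : red a \<rightarrow> red b\<close>.
\<close>

definition red_incl :: "fcs \<Rightarrow> fcs_map" where
  "red_incl a = (\<lambda>f. if f \<in> carrier (fun_alg a)
     then Some (\<lambda>x \<in> Rn (fst a). \<lambda>l. if l = 0 then f x 0 else 0) else None)"

definition red_proj :: "fcs \<Rightarrow> fcs_map" where
  "red_proj a = Some |` carrier (fun_alg (red a))"

definition red_map :: "fcs \<Rightarrow> fcs \<Rightarrow> fcs_map \<Rightarrow> fcs_map" where
  "red_map a b f = red_proj b \<cdot>\<^bsub>FormalCartSp\<^esub> (f \<cdot>\<^bsub>FormalCartSp\<^esub> red_incl a)"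

text \<open>
  \<open>(\<Im>X)(\<real>\<^sup>n \<times> D) = X(\<real>\<^sup>n)\<close>. An arrow \<open>b \<rightarrow> a\<close> of the site acts by the restriction of \<open>X\<close> along its
  reduction; the unit restricts along \<open>red_incl\<close>.
\<close>

definition Im_shape :: "'u fpsh \<Rightarrow> 'u fpsh"  (\<open>\<Im>\<close>) where
  "\<Im> X = \<lparr>fo = (\<lambda>a. fo X (red a)), fm = (\<lambda>a b f. fm X (red a) (red b) (red_map b a f))\<rparr>"

definition Im_unit :: "'u fpsh \<Rightarrow> 'u fpsh_map"  (\<open>\<eta>\<close>) where
  "\<eta> X = (\<lambda>a. if a \<in> Obj FormalCartSp then fm X a (red a) (red_incl a) else Map.empty)"


section \<open>Infinitesimal disk bundles and jets\<close>

text \<open>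
  The right adjoint \<open>(\<eta>\<^sub>\<Sigma>)\<^sub>*\<close> of \<open>(\<eta>\<^sub>\<Sigma>)\<^sup>*\<close> is determined only up to isomorphism. It enters as a
  parameter \<open>R\<close>, together with the unit \<open>u\<close> and the counit \<open>e\<close> of the adjunction.
\<close>

type_synonym 'u fbundle = "'u fpsh \<times> 'u fpsh_map"
type_synonym 'u bundle_functr = "('u fbundle, 'u fpsh_map, 'u fbundle, 'u fpsh_map) functr"

definition eta_pull :: "'u::set_universe fpsh \<Rightarrow> 'u bundle_functr" where
  "eta_pull \<Sigma> = base_pull \<Sigma> (\<eta> \<Sigma>)"

definition eta_post :: "'u::set_universe fpsh \<Rightarrow> 'u bundle_functr" where
  "eta_post \<Sigma> = base_post (\<eta> \<Sigma>)"

definition disk :: "'u::set_universe fpsh \<Rightarrow> 'u bundle_functr" where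
  "disk \<Sigma> = functor_comp (eta_pull \<Sigma>) (eta_post \<Sigma>)"

definition jet :: "'u::set_universe fpsh \<Rightarrow> 'u bundle_functr \<Rightarrow> 'u bundle_functr" where
  "jet \<Sigma> R = functor_comp (eta_pull \<Sigma>) R"

definition jet_coproduct ::
  "'u::set_universe fpsh \<Rightarrow> 'u bundle_functr \<Rightarrow> ('u fbundle \<Rightarrow> 'u fpsh_map)
     \<Rightarrow> 'u fbundle \<Rightarrow> 'u fpsh_map" where
  "jet_coproduct \<Sigma> R u Y = fm (eta_pull \<Sigma>) (fo R Y) (fo R (fo (jet \<Sigma> R) Y)) (u (fo R Y))"

text \<open>
  The adjunct \<open>E \<rightarrow> J Y\<close> of \<open>\<sigma> : T E \<rightarrow> Y\<close>: transpose first to \<open>(\<eta>\<^sub>\<Sigma>)\<^sub>! E \<rightarrow> (\<eta>\<^sub>\<Sigma>)\<^sub>* Y\<close>, then along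
  the adjunction of \<open>(\<eta>\<^sub>\<Sigma>)\<^sub>!\<close> and \<open>(\<eta>\<^sub>\<Sigma>)\<^sup>*\<close>.
\<close>

definition jet_adjunct ::
  "'u::set_universe fpsh \<Rightarrow> 'u bundle_functr \<Rightarrow> ('u fbundle \<Rightarrow> 'u fpsh_map)
     \<Rightarrow> 'u fbundle \<Rightarrow> 'u fbundle \<Rightarrow> 'u fpsh_map \<Rightarrow> 'u fpsh_map" where
  "jet_adjunct \<Sigma> R u E Y \<sigma> =
     fm (eta_pull \<Sigma>) (fo (eta_post \<Sigma>) E) (fo R Y)
        (fm R (fo (disk \<Sigma>) E) Y \<sigma> \<cdot>\<^bsub>FormalSmoothSet\<^esub> u (fo (eta_post \<Sigma>) E))
     \<cdot>\<^bsub>FormalSmoothSet\<^esub> base_unit E"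

definition EM_jet ::
  "'u::set_universe fpsh \<Rightarrow> 'u bundle_functr \<Rightarrow> ('u fbundle \<Rightarrow> 'u fpsh_map)
     \<Rightarrow> ('u fbundle \<Rightarrow> 'u fpsh_map) \<Rightarrow> ('u fbundle \<times> 'u fpsh_map, 'u fpsh_map) cat" where
  "EM_jet \<Sigma> R u e = em_cat (slice FormalSmoothSet \<Sigma>) (jet \<Sigma> R) e (jet_coproduct \<Sigma> R u)"

definition PDE ::
  "'u::set_universe fpsh \<Rightarrow> 'u bundle_functr \<Rightarrow> ('u fbundle \<Rightarrow> 'u fpsh_map)
     \<Rightarrow> ('u fbundle \<Rightarrow> 'u fpsh_map)
     \<Rightarrow> ('u fbundle \<times> 'u fbundle \<times> 'u fpsh_map, 'u fpsh_map) cat" where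
  "PDE \<Sigma> R u e =
     pde_cat (slice FormalSmoothSet \<Sigma>) (disk \<Sigma>) base_unit (jet \<Sigma> R) e (jet_coproduct \<Sigma> R u)
       (jet_adjunct \<Sigma> R u)"

text \<open>\<open>(\<eta>\<^sub>\<Sigma>)\<^sup>*\<close> equipped with the coalgebra structures \<open>(\<eta>\<^sub>\<Sigma>)\<^sup>* u\<close>.\<close>

definition eta_pull_EM ::
  "'u::set_universe fpsh \<Rightarrow> 'u bundle_functr \<Rightarrow> ('u fbundle \<Rightarrow> 'u fpsh_map)
     \<Rightarrow> ('u fbundle, 'u fpsh_map, 'u fbundle \<times> 'u fpsh_map, 'u fpsh_map) functr" where
  "eta_pull_EM \<Sigma> R u =
     \<lparr>fo = (\<lambda>E. (fo (eta_pull \<Sigma>) E, fm (eta_pull \<Sigma>) E (fo R (fo (eta_pull \<Sigma>) E)) (u E))),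
      fm = fm (eta_pull \<Sigma>)\<rparr>"

end

theory Submission
  imports Defs
begin

text \<open>
  Write \<open>P\<close>, \<open>F\<close>, \<open>R\<close> for \<open>(\<eta>\<^sub>\<Sigma>)\<^sub>!\<close>, \<open>(\<eta>\<^sub>\<Sigma>)\<^sup>*\<close>, \<open>(\<eta>\<^sub>\<Sigma>)\<^sub>*\<close>, so that \<open>T = F P\<close> and \<open>J = F R\<close>.

  The equivalence with coalgebras is Beck's comonadicity theorem for \<open>F\<close>. The map \<open>\<eta>\<^sub>\<Sigma>\<close> is
  surjective on every object of the site, because the inclusion of the reduction of a formal
  Cartesian space has a retraction (\<open>Im_unit_surj\<close>); hence pulling back along it reflects
  isomorphisms (\<open>base_pull_reflects_isos\<close>). Slices of sheaves have equalizers
  (\<open>slice_Sheaves_has_equalizers\<close>), and \<open>F\<close> preserves them because it is right adjoint to \<open>P\<close>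
  (\<open>base_change_adjunction\<close>, \<open>right_adjoint_preserves_equalizers\<close>). A coalgebra \<open>\<rho> : E \<rightarrow> F R E\<close> is an
  equalizer in the slice over \<open>\<Sigma>\<close> of the image under \<open>F\<close> of a pair \<open>R E \<rightarrow> R F R E\<close>
  (\<open>coalgebra_equalizer\<close>), so the equalizer of that pair is an object over \<open>\<Im>\<Sigma>\<close> which \<open>F\<close> sends to
  the coalgebra. In the same way every object over \<open>\<Im>\<Sigma>\<close> is recovered from its image
  (\<open>unit_equalizer\<close>), which gives full faithfulness.

  For PDEs, a coalgebra is its own prolongation (\<open>coalgebra_formally_integrable\<close>). Conversely a
  formally integrable PDE \<open>m : E \<rightarrow> J Y\<close> makes \<open>E\<close> a coalgebra (\<open>pde_resolves\<close>). As \<open>J\<close> preserves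
  monomorphisms, being a composite of right adjoints, the solutions of \<open>m\<close> depend on the structure
  map \<open>\<rho>\<close> of this coalgebra only: they are the \<open>s : T X \<rightarrow> E\<close> whose adjunct is \<open>\<rho>\<close> composed with the
  restriction of \<open>s\<close> along the unit \<open>X \<rightarrow> T X\<close> (\<open>solves_iff\<close>). So \<open>m\<close> is isomorphic to \<open>\<rho>\<close> as
  a PDE, and coalgebra maps preserve solutions. A map out of \<open>F a\<close> which preserves solutions preserves the canonical one
  \<open>T F a \<rightarrow> F a\<close>, and this already makes it a coalgebra map
  (\<open>preserves_solutions_coalgebra_map\<close>).

  The site enters through two facts. Naturality of \<open>\<eta>\<close>, on which \<open>P\<close> depends, holds because
  homomorphisms into real-valued functions kill nilpotents (\<open>alg_hom_reduce\<close>). An equalizer of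
  sheaves is a sheaf because the members of a cover are arrows of the site; for this, smooth
  functions have to be closed under composition, and as smoothness is defined by iterated partial
  derivatives, the chain rule has to be obtained from the continuity of the partial derivatives
  (\<open>partial_chain_rule\<close>).
\<close>


section \<open>Arrows, functors and equivalences\<close>

text \<open>
  The record prescribes hom-sets for arbitrary pairs, so an arrow is recorded together with the
  fact that its ends are objects.
\<close>

definition arrow :: "('o, 'm) cat \<Rightarrow> 'm \<Rightarrow> 'o \<Rightarrow> 'o \<Rightarrow> bool" where
  "arrow C f a b \<longleftrightarrow> a \<in> Obj C \<and> b \<in> Obj C \<and> f \<in> Hom C a b"

lemma arrow_Ide: "category C \<Longrightarrow> a \<in> Obj C \<Longrightarrow> arrow C (Ide C a) a a"
  by (simp add: category_def arrow_def)

lemma arrow_Cmp: "category C \<Longrightarrow> arrow C f a b \<Longrightarrow> arrow C g b c \<Longrightarrow> arrow C (g \<cdot>\<^bsub>C\<^esub> f) a c"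
  unfolding category_def arrow_def by blast

lemma Cmp_Ide: "category C \<Longrightarrow> arrow C f a b \<Longrightarrow> f \<cdot>\<^bsub>C\<^esub> Ide C a = f"
  unfolding category_def arrow_def by blast

lemma Ide_Cmp: "category C \<Longrightarrow> arrow C f a b \<Longrightarrow> Ide C b \<cdot>\<^bsub>C\<^esub> f = f"
  unfolding category_def arrow_def by blast

lemma Cmp_assoc:
  assumes "category C" and "arrow C f a b" and "arrow C g b c" and "arrow C h c d"
  shows "h \<cdot>\<^bsub>C\<^esub> (g \<cdot>\<^bsub>C\<^esub> f) = (h \<cdot>\<^bsub>C\<^esub> g) \<cdot>\<^bsub>C\<^esub> f"
  using assms unfolding category_def arrow_def by blast

lemma functor_Obj: "is_functor C D F \<Longrightarrow> a \<in> Obj C \<Longrightarrow> fo F a \<in> Obj D"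
  by (simp add: is_functor_def)

lemma functor_arrow: "is_functor C D F \<Longrightarrow> arrow C f a b \<Longrightarrow> arrow D (fm F a b f) (fo F a) (fo F b)"
  by (simp add: is_functor_def arrow_def)

lemma functor_Ide: "is_functor C D F \<Longrightarrow> a \<in> Obj C \<Longrightarrow> fm F a a (Ide C a) = Ide D (fo F a)"
  by (simp add: is_functor_def)

lemma functor_Cmp:
  assumes "is_functor C D F" and "arrow C f a b" and "arrow C g b c"
  shows "fm F a c (g \<cdot>\<^bsub>C\<^esub> f) = fm F b c g \<cdot>\<^bsub>D\<^esub> fm F a b f"
  using assms unfolding is_functor_def arrow_def by blast

lemma is_functorI:
  assumes "category C" and "category D" and "\<And>a. a \<in> Obj C \<Longrightarrow> fo F a \<in> Obj D"
    and "\<And>f a b. arrow C f a b \<Longrightarrow> fm F a b f \<in> Hom D (fo F a) (fo F b)"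
    and "\<And>a. a \<in> Obj C \<Longrightarrow> fm F a a (Ide C a) = Ide D (fo F a)"
    and "\<And>f g a b c. arrow C f a b \<Longrightarrow> arrow C g b c \<Longrightarrow>
           fm F a c (g \<cdot>\<^bsub>C\<^esub> f) = fm F b c g \<cdot>\<^bsub>D\<^esub> fm F a b f"
  shows "is_functor C D F"
  using assms unfolding is_functor_def arrow_def by simp

lemma fo_functor_comp [simp]: "fo (functor_comp G F) a = fo G (fo F a)"
  and fm_functor_comp [simp]: "fm (functor_comp G F) a b f = fm G (fo F a) (fo F b) (fm F a b f)"
  by (simp_all add: functor_comp_def)

lemma fo_id_functor [simp]: "fo id_functor a = a"
  and fm_id_functor [simp]: "fm id_functor a b f = f"
  by (simp_all add: id_functor_def)

lemma is_functor_comp: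
  assumes "is_functor C D F" and "is_functor D E G"
  shows "is_functor C E (functor_comp G F)"
  using assms unfolding is_functor_def by simp

lemma is_isoI:
  assumes "arrow C f a b" and "arrow C g b a" and "g \<cdot>\<^bsub>C\<^esub> f = Ide C a" and "f \<cdot>\<^bsub>C\<^esub> g = Ide C b"
  shows "is_iso C a b f"
  using assms by (auto simp: is_iso_def arrow_def)

lemma is_isoE:
  assumes "is_iso C a b f" and "a \<in> Obj C" and "b \<in> Obj C"
  obtains g where "arrow C f a b" and "arrow C g b a" and "g \<cdot>\<^bsub>C\<^esub> f = Ide C a"
    and "f \<cdot>\<^bsub>C\<^esub> g = Ide C b"
  using assms by (auto simp: is_iso_def arrow_def)

definition fully_faithful :: "('o, 'm) cat \<Rightarrow> ('p, 'k) cat \<Rightarrow> ('o, 'm, 'p, 'k) functr \<Rightarrow> bool" where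
  "fully_faithful C D F \<longleftrightarrow>
     (\<forall>a \<in> Obj C. \<forall>b \<in> Obj C. bij_betw (fm F a b) (Hom C a b) (Hom D (fo F a) (fo F b)))"

definition essentially_surjective ::
  "('o, 'm) cat \<Rightarrow> ('p, 'k) cat \<Rightarrow> ('o, 'm, 'p, 'k) functr \<Rightarrow> bool" where
  "essentially_surjective C D F \<longleftrightarrow> (\<forall>b \<in> Obj D. \<exists>a \<in> Obj C. \<exists>f. is_iso D (fo F a) b f)"

lemma fully_faithfulI:
  assumes F: "is_functor C D F"
    and faithful: "\<And>a b f g. arrow C f a b \<Longrightarrow> arrow C g a b \<Longrightarrow> fm F a b f = fm F a b g \<Longrightarrow> f = g"
    and full: "\<And>a b g. a \<in> Obj C \<Longrightarrow> b \<in> Obj C \<Longrightarrow> g \<in> Hom D (fo F a) (fo F b) \<Longrightarrow>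
                 \<exists>f \<in> Hom C a b. fm F a b f = g"
  shows "fully_faithful C D F"
  unfolding fully_faithful_def bij_betw_def
proof (intro ballI conjI)
  fix a b assume ab: "a \<in> Obj C" "b \<in> Obj C"
  show "inj_on (fm F a b) (Hom C a b)"
    using faithful ab by (auto simp: inj_on_def arrow_def)
  show "fm F a b ` Hom C a b = Hom D (fo F a) (fo F b)"
  proof
    show "fm F a b ` Hom C a b \<subseteq> Hom D (fo F a) (fo F b)"
      using F ab by (auto simp: is_functor_def)
    show "Hom D (fo F a) (fo F b) \<subseteq> fm F a b ` Hom C a b"
      using full[OF ab] by (auto simp: image_iff)
  qed
qed

text \<open>
  The inverse sends \<open>b\<close> to a chosen object \<open>G b\<close> with an isomorphism \<open>\<theta> b : F (G b) \<rightarrow> b\<close>, and an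
  arrow to the unique preimage under \<open>F\<close> of its conjugate by these isomorphisms.
\<close>

lemma equivalence_if_fully_faithful_essentially_surjective:
  assumes F: "is_functor C D F" and ff: "fully_faithful C D F"
    and es: "essentially_surjective C D F"
  shows "is_equivalence C D F"
proof -
  have C: "category C" and D: "category D"
    using F by (auto simp: is_functor_def)
  have "\<exists>a \<theta> \<theta>'. a \<in> Obj C \<and> arrow D \<theta> (fo F a) b \<and> arrow D \<theta>' b (fo F a)
          \<and> \<theta>' \<cdot>\<^bsub>D\<^esub> \<theta> = Ide D (fo F a) \<and> \<theta> \<cdot>\<^bsub>D\<^esub> \<theta>' = Ide D b" if b: "b \<in> Obj D" for b
    using es b unfolding essentially_surjective_def
    by (metis is_isoE functor_Obj[OF F])
  then obtain g \<theta> \<theta>' where ch: "\<And>b. b \<in> Obj D \<Longrightarrow> g b \<in> Obj C \<and> arrow D (\<theta> b) (fo F (g b)) b \<and>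
      arrow D (\<theta>' b) b (fo F (g b)) \<and> \<theta>' b \<cdot>\<^bsub>D\<^esub> \<theta> b = Ide D (fo F (g b)) \<and> \<theta> b \<cdot>\<^bsub>D\<^esub> \<theta>' b = Ide D b"
    by metis
  note g = ch[THEN conjunct1] and th = ch[THEN conjunct2, THEN conjunct1]
    and th' = ch[THEN conjunct2, THEN conjunct2, THEN conjunct1]
    and th'th = ch[THEN conjunct2, THEN conjunct2, THEN conjunct2, THEN conjunct1]
    and thth' = ch[THEN conjunct2, THEN conjunct2, THEN conjunct2, THEN conjunct2]
  define lift where "lift = (\<lambda>a b h. inv_into (Hom C a b) (fm F a b) h)"
  have lift_arrow: "arrow C (lift a b h) a b" and F_lift: "fm F a b (lift a b h) = h"
    if "arrow D h (fo F a) (fo F b)" "a \<in> Obj C" "b \<in> Obj C" for a b h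
  proof -
    have h: "h \<in> fm F a b ` Hom C a b"
      using that ff by (auto simp: fully_faithful_def bij_betw_def arrow_def)
    show "arrow C (lift a b h) a b" "fm F a b (lift a b h) = h"
      using inv_into_into[OF h] f_inv_into_f[OF h] that by (auto simp: lift_def arrow_def)
  qed
  have faithful: "k = l" if "arrow C k a b" "arrow C l a b" "fm F a b k = fm F a b l" for a b k l
    using that ff by (auto simp: fully_faithful_def bij_betw_def arrow_def inj_on_def)
  define G where "G = \<lparr>fo = g, fm = (\<lambda>a b h. lift (g a) (g b) (\<theta>' b \<cdot>\<^bsub>D\<^esub> (h \<cdot>\<^bsub>D\<^esub> \<theta> a)))\<rparr>"
  have fo_G [simp]: "fo G b = g b" for b
    by (simp add: G_def)
  have conj: "arrow D (\<theta>' b \<cdot>\<^bsub>D\<^esub> (h \<cdot>\<^bsub>D\<^esub> \<theta> a)) (fo F (g a)) (fo F (g b))" if "arrow D h a b" for a b h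
    using that th th' arrow_Cmp[OF D] by (meson arrow_def)
  have G_arrow: "arrow C (fm G a b h) (g a) (g b)"
    and FG: "fm F (g a) (g b) (fm G a b h) = \<theta>' b \<cdot>\<^bsub>D\<^esub> (h \<cdot>\<^bsub>D\<^esub> \<theta> a)" if "arrow D h a b" for a b h
  proof -
    have "g a \<in> Obj C" "g b \<in> Obj C"
      using g that by (auto simp: arrow_def)
    then show "arrow C (fm G a b h) (g a) (g b)" "fm F (g a) (g b) (fm G a b h) = \<theta>' b \<cdot>\<^bsub>D\<^esub> (h \<cdot>\<^bsub>D\<^esub> \<theta> a)"
      using lift_arrow F_lift conj[OF that] by (simp_all add: G_def)
  qed
  have thFG: "\<theta> b \<cdot>\<^bsub>D\<^esub> fm F (g a) (g b) (fm G a b h) = h \<cdot>\<^bsub>D\<^esub> \<theta> a" if h: "arrow D h a b" for a b h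
  proof -
    have ab: "a \<in> Obj D" "b \<in> Obj D"
      using h by (auto simp: arrow_def)
    have "\<theta> b \<cdot>\<^bsub>D\<^esub> (\<theta>' b \<cdot>\<^bsub>D\<^esub> (h \<cdot>\<^bsub>D\<^esub> \<theta> a)) = (\<theta> b \<cdot>\<^bsub>D\<^esub> \<theta>' b) \<cdot>\<^bsub>D\<^esub> (h \<cdot>\<^bsub>D\<^esub> \<theta> a)"
      using Cmp_assoc[OF D _ th'[OF ab(2)] th[OF ab(2)]] arrow_Cmp[OF D th[OF ab(1)] h] by blast
    then show ?thesis
      using FG[OF h] thth'[OF ab(2)] Ide_Cmp[OF D arrow_Cmp[OF D th[OF ab(1)] h]] by simp
  qed
  have G: "is_functor D C G"
  proof (rule is_functorI[OF D C])
    show "fo G a \<in> Obj C" if "a \<in> Obj D" for a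
      using g that by simp
    show "fm G a b f \<in> Hom C (fo G a) (fo G b)" if "arrow D f a b" for f a b
      using G_arrow[OF that] by (simp add: arrow_def)
    show "fm G a a (Ide D a) = Ide C (fo G a)" if a: "a \<in> Obj D" for a
    proof (rule faithful)
      show "arrow C (fm G a a (Ide D a)) (g a) (g a)" "arrow C (Ide C (fo G a)) (g a) (g a)"
        using G_arrow[OF arrow_Ide[OF D a]] arrow_Ide[OF C g[OF a]] by simp_all
      show "fm F (g a) (g a) (fm G a a (Ide D a)) = fm F (g a) (g a) (Ide C (fo G a))"
        using FG[OF arrow_Ide[OF D a]] Ide_Cmp[OF D th[OF a]] th'th[OF a] functor_Ide[OF F g[OF a]]
        by simp
    qed
    show "fm G a c (k \<cdot>\<^bsub>D\<^esub> h) = fm G b c k \<cdot>\<^bsub>C\<^esub> fm G a b h" if h: "arrow D h a b" and k: "arrow D k b c"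
      for h k a b c
    proof (rule faithful)
      have abc: "a \<in> Obj D" "b \<in> Obj D" "c \<in> Obj D"
        using h k by (auto simp: arrow_def)
      note kh = arrow_Cmp[OF D h k]
      show "arrow C (fm G a c (k \<cdot>\<^bsub>D\<^esub> h)) (g a) (g c)"
        "arrow C (fm G b c k \<cdot>\<^bsub>C\<^esub> fm G a b h) (g a) (g c)"
        using G_arrow[OF kh] arrow_Cmp[OF C G_arrow[OF h] G_arrow[OF k]] by simp_all
      have "fm F (g a) (g c) (fm G b c k \<cdot>\<^bsub>C\<^esub> fm G a b h)
          = fm F (g b) (g c) (fm G b c k) \<cdot>\<^bsub>D\<^esub> fm F (g a) (g b) (fm G a b h)"
        by (rule functor_Cmp[OF F G_arrow[OF h] G_arrow[OF k]])
      also have "\<dots> = (\<theta>' c \<cdot>\<^bsub>D\<^esub> (k \<cdot>\<^bsub>D\<^esub> \<theta> b)) \<cdot>\<^bsub>D\<^esub> fm F (g a) (g b) (fm G a b h)"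
        using FG[OF k] by simp
      also have "\<dots> = \<theta>' c \<cdot>\<^bsub>D\<^esub> (k \<cdot>\<^bsub>D\<^esub> (\<theta> b \<cdot>\<^bsub>D\<^esub> fm F (g a) (g b) (fm G a b h)))"
        using Cmp_assoc[OF D _ arrow_Cmp[OF D th k] th'] Cmp_assoc[OF D _ th k]
          functor_arrow[OF F G_arrow[OF h]] abc by simp
      also have "\<dots> = \<theta>' c \<cdot>\<^bsub>D\<^esub> ((k \<cdot>\<^bsub>D\<^esub> h) \<cdot>\<^bsub>D\<^esub> \<theta> a)"
        using thFG[OF h] Cmp_assoc[OF D th h k] abc by simp
      finally show "fm F (g a) (g c) (fm G a c (k \<cdot>\<^bsub>D\<^esub> h))
          = fm F (g a) (g c) (fm G b c k \<cdot>\<^bsub>C\<^esub> fm G a b h)"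
        using FG[OF kh] by simp
    qed
  qed
  define \<alpha> where "\<alpha> = (\<lambda>a. lift a (g (fo F a)) (\<theta>' (fo F a)))"
  have al: "arrow C (\<alpha> a) a (g (fo F a))" and F_al: "fm F a (g (fo F a)) (\<alpha> a) = \<theta>' (fo F a)"
    if a: "a \<in> Obj C" for a
    using lift_arrow[OF th'] F_lift[OF th'] g functor_Obj[OF F a] a by (simp_all add: \<alpha>_def)
  have "nat_iso C C id_functor (functor_comp G F) \<alpha>"
    unfolding nat_iso_def nat_trans_def
  proof (intro conjI ballI)
    fix a assume a: "a \<in> Obj C"
    show "\<alpha> a \<in> Hom C (fo id_functor a) (fo (functor_comp G F) a)"
      using al[OF a] by (simp add: arrow_def)
    define \<alpha>' where "\<alpha>' = lift (g (fo F a)) a (\<theta> (fo F a))"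
    note Fa = functor_Obj[OF F a]
    have al': "arrow C \<alpha>' (g (fo F a)) a" and F_al': "fm F (g (fo F a)) a \<alpha>' = \<theta> (fo F a)"
      using lift_arrow[OF th] F_lift[OF th] g Fa a by (simp_all add: \<alpha>'_def)
    have "is_iso C a (g (fo F a)) (\<alpha> a)"
    proof (rule is_isoI[OF al[OF a] al'])
      show "\<alpha>' \<cdot>\<^bsub>C\<^esub> \<alpha> a = Ide C a"
        by (rule faithful[OF arrow_Cmp[OF C al[OF a] al'] arrow_Ide[OF C a]])
          (use functor_Cmp[OF F al[OF a] al'] F_al[OF a] F_al' thth'[OF Fa] functor_Ide[OF F a] in simp)
      show "\<alpha> a \<cdot>\<^bsub>C\<^esub> \<alpha>' = Ide C (g (fo F a))"
        by (rule faithful[OF arrow_Cmp[OF C al' al[OF a]] arrow_Ide[OF C g[OF Fa]]])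
          (use functor_Cmp[OF F al' al[OF a]] F_al[OF a] F_al' th'th[OF Fa] functor_Ide[OF F g[OF Fa]]
            in simp)
    qed
    then show "is_iso C (fo id_functor a) (fo (functor_comp G F) a) (\<alpha> a)"
      by simp
  next
    fix a b f assume "a \<in> Obj C" "b \<in> Obj C" "f \<in> Hom C a b"
    then have f: "arrow C f a b" and a: "a \<in> Obj C" and b: "b \<in> Obj C"
      by (simp_all add: arrow_def)
    note Fa = functor_Obj[OF F a] and Fb = functor_Obj[OF F b] and Ff = functor_arrow[OF F f]
    have "\<alpha> b \<cdot>\<^bsub>C\<^esub> f = fm G (fo F a) (fo F b) (fm F a b f) \<cdot>\<^bsub>C\<^esub> \<alpha> a"
    proof (rule faithful[OF arrow_Cmp[OF C f al[OF b]] arrow_Cmp[OF C al[OF a] G_arrow[OF Ff]]])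
      have "fm F a (g (fo F b)) (fm G (fo F a) (fo F b) (fm F a b f) \<cdot>\<^bsub>C\<^esub> \<alpha> a)
          = (\<theta>' (fo F b) \<cdot>\<^bsub>D\<^esub> (fm F a b f \<cdot>\<^bsub>D\<^esub> \<theta> (fo F a))) \<cdot>\<^bsub>D\<^esub> \<theta>' (fo F a)"
        using functor_Cmp[OF F al[OF a] G_arrow[OF Ff]] F_al[OF a] FG[OF Ff] by simp
      also have "\<dots> = \<theta>' (fo F b) \<cdot>\<^bsub>D\<^esub> (fm F a b f \<cdot>\<^bsub>D\<^esub> (\<theta> (fo F a) \<cdot>\<^bsub>D\<^esub> \<theta>' (fo F a)))"
        using Cmp_assoc[OF D th'[OF Fa] arrow_Cmp[OF D th[OF Fa] Ff] th'[OF Fb]]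
          Cmp_assoc[OF D th'[OF Fa] th[OF Fa] Ff] by simp
      also have "\<dots> = \<theta>' (fo F b) \<cdot>\<^bsub>D\<^esub> fm F a b f"
        using thth'[OF Fa] Cmp_Ide[OF D Ff] by simp
      finally show "fm F a (g (fo F b)) (\<alpha> b \<cdot>\<^bsub>C\<^esub> f)
          = fm F a (g (fo F b)) (fm G (fo F a) (fo F b) (fm F a b f) \<cdot>\<^bsub>C\<^esub> \<alpha> a)"
        using functor_Cmp[OF F f al[OF b]] F_al[OF b] by simp
    qed
    then show "\<alpha> b \<cdot>\<^bsub>C\<^esub> fm id_functor a b f = fm (functor_comp G F) a b f \<cdot>\<^bsub>C\<^esub> \<alpha> a"
      by simp
  qed
  moreover have "nat_iso D D (functor_comp F G) id_functor \<theta>"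
    unfolding nat_iso_def nat_trans_def
  proof (intro conjI ballI)
    fix b assume b: "b \<in> Obj D"
    show "\<theta> b \<in> Hom D (fo (functor_comp F G) b) (fo id_functor b)"
      using th[OF b] by (simp add: arrow_def)
    show "is_iso D (fo (functor_comp F G) b) (fo id_functor b) (\<theta> b)"
      using is_isoI[OF th th' th'th thth'] b by simp
  next
    fix a b h assume "a \<in> Obj D" "b \<in> Obj D" "h \<in> Hom D a b"
    then show "\<theta> b \<cdot>\<^bsub>D\<^esub> fm (functor_comp F G) a b h = fm id_functor a b h \<cdot>\<^bsub>D\<^esub> \<theta> a"
      using thFG[of h a b] by (simp add: arrow_def)
  qed
  ultimately show ?thesis
    using F G unfolding is_equivalence_def by blast
qed


section \<open>Equalizers\<close>

definition is_equalizer :: "('o, 'm) cat \<Rightarrow> 'o \<Rightarrow> 'o \<Rightarrow> 'o \<Rightarrow> 'm \<Rightarrow> 'm \<Rightarrow> 'm \<Rightarrow> bool" where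
  "is_equalizer C l a b i f g \<longleftrightarrow>
     arrow C i l a \<and> f \<cdot>\<^bsub>C\<^esub> i = g \<cdot>\<^bsub>C\<^esub> i \<and>
     (\<forall>z k. arrow C k z a \<and> f \<cdot>\<^bsub>C\<^esub> k = g \<cdot>\<^bsub>C\<^esub> k \<longrightarrow> (\<exists>!h. arrow C h z l \<and> i \<cdot>\<^bsub>C\<^esub> h = k))"

definition has_equalizers :: "('o, 'm) cat \<Rightarrow> bool" where
  "has_equalizers C \<longleftrightarrow>
     (\<forall>a b f g. arrow C f a b \<and> arrow C g a b \<longrightarrow> (\<exists>l i. is_equalizer C l a b i f g))"

definition reflects_isos :: "('o, 'm) cat \<Rightarrow> ('p, 'k) cat \<Rightarrow> ('o, 'm, 'p, 'k) functr \<Rightarrow> bool" where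
  "reflects_isos C D F \<longleftrightarrow>
     (\<forall>a b f. arrow C f a b \<and> is_iso D (fo F a) (fo F b) (fm F a b f) \<longrightarrow> is_iso C a b f)"

lemma is_equalizer_arrow: "is_equalizer C l a b i f g \<Longrightarrow> arrow C i l a"
  by (simp add: is_equalizer_def)

lemma is_equalizer_commutes: "is_equalizer C l a b i f g \<Longrightarrow> f \<cdot>\<^bsub>C\<^esub> i = g \<cdot>\<^bsub>C\<^esub> i"
  by (simp add: is_equalizer_def)

lemma equalizer_factor:
  assumes "is_equalizer C l a b i f g" and "arrow C k z a" and "f \<cdot>\<^bsub>C\<^esub> k = g \<cdot>\<^bsub>C\<^esub> k"
  obtains h where "arrow C h z l" and "i \<cdot>\<^bsub>C\<^esub> h = k"
  using assms unfolding is_equalizer_def by blast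

lemma equalizer_cancel:
  assumes C: "category C" and fg: "arrow C f a b" "arrow C g a b" and eq: "is_equalizer C l a b i f g"
    and h: "arrow C h z l" and h': "arrow C h' z l" and "i \<cdot>\<^bsub>C\<^esub> h = i \<cdot>\<^bsub>C\<^esub> h'"
  shows "h = h'"
proof -
  note i = is_equalizer_arrow[OF eq]
  have "f \<cdot>\<^bsub>C\<^esub> (i \<cdot>\<^bsub>C\<^esub> h) = g \<cdot>\<^bsub>C\<^esub> (i \<cdot>\<^bsub>C\<^esub> h)"
    using Cmp_assoc[OF C h i fg(1)] Cmp_assoc[OF C h i fg(2)] is_equalizer_commutes[OF eq] by simp
  then show ?thesis
    using eq arrow_Cmp[OF C h i] h h' assms(7) unfolding is_equalizer_def by metis
qed

lemma equalizer_comparison_iso: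
  assumes C: "category C" and fg: "arrow C f a b" "arrow C g a b"
    and eq: "is_equalizer C l a b i f g" and eq': "is_equalizer C l' a b i' f g"
    and k: "arrow C k l l'" and ik: "i' \<cdot>\<^bsub>C\<^esub> k = i"
  shows "is_iso C l l' k"
proof -
  note i = is_equalizer_arrow[OF eq] and i' = is_equalizer_arrow[OF eq']
  obtain k' where k': "arrow C k' l' l" and ik': "i \<cdot>\<^bsub>C\<^esub> k' = i'"
    using equalizer_factor[OF eq i' is_equalizer_commutes[OF eq']] by blast
  have "l \<in> Obj C" "l' \<in> Obj C"
    using k by (auto simp: arrow_def)
  note ide = arrow_Ide[OF C this(1)] arrow_Ide[OF C this(2)]
  show ?thesis
  proof (rule is_isoI[OF k k'])
    show "k' \<cdot>\<^bsub>C\<^esub> k = Ide C l"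
      by (rule equalizer_cancel[OF C fg eq arrow_Cmp[OF C k k'] ide(1)])
        (use Cmp_assoc[OF C k k' i] ik ik' Cmp_Ide[OF C i] in simp)
    show "k \<cdot>\<^bsub>C\<^esub> k' = Ide C l'"
      by (rule equalizer_cancel[OF C fg eq' arrow_Cmp[OF C k' k] ide(2)])
        (use Cmp_assoc[OF C k' k i'] ik ik' Cmp_Ide[OF C i'] in simp)
  qed
qed

lemma equalizer_iso_transfer:
  assumes C: "category C" and fg: "arrow C f a b" "arrow C g a b"
    and eq: "is_equalizer C l a b i f g" and k: "is_iso C m l k" and m: "m \<in> Obj C"
    and ik: "i \<cdot>\<^bsub>C\<^esub> k = j"
  shows "is_equalizer C m a b j f g"
proof -
  note i = is_equalizer_arrow[OF eq]
  have "l \<in> Obj C"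
    using i by (simp add: arrow_def)
  then obtain k' where k: "arrow C k m l" and k': "arrow C k' l m" and kk': "k \<cdot>\<^bsub>C\<^esub> k' = Ide C l"
    and k'k: "k' \<cdot>\<^bsub>C\<^esub> k = Ide C m"
    using is_isoE[OF k m] by blast
  show ?thesis
    unfolding is_equalizer_def
  proof (intro conjI allI impI)
    show "arrow C j m a"
      using arrow_Cmp[OF C k i] ik by simp
    show "f \<cdot>\<^bsub>C\<^esub> j = g \<cdot>\<^bsub>C\<^esub> j"
      using Cmp_assoc[OF C k i fg(1)] Cmp_assoc[OF C k i fg(2)] is_equalizer_commutes[OF eq] ik by simp
    fix z t assume t: "arrow C t z a \<and> f \<cdot>\<^bsub>C\<^esub> t = g \<cdot>\<^bsub>C\<^esub> t"
    then obtain h where h: "arrow C h z l" "i \<cdot>\<^bsub>C\<^esub> h = t"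
      using equalizer_factor[OF eq] by blast
    show "\<exists>!h. arrow C h z m \<and> j \<cdot>\<^bsub>C\<^esub> h = t"
    proof (rule ex1I[of _ "k' \<cdot>\<^bsub>C\<^esub> h"])
      have "i \<cdot>\<^bsub>C\<^esub> (k \<cdot>\<^bsub>C\<^esub> (k' \<cdot>\<^bsub>C\<^esub> h)) = t"
        using Cmp_assoc[OF C h(1) k' k] kk' Ide_Cmp[OF C h(1)] h(2) by simp
      then show "arrow C (k' \<cdot>\<^bsub>C\<^esub> h) z m \<and> j \<cdot>\<^bsub>C\<^esub> (k' \<cdot>\<^bsub>C\<^esub> h) = t"
        using arrow_Cmp[OF C h(1) k'] Cmp_assoc[OF C arrow_Cmp[OF C h(1) k'] k i] ik by simp
      fix h' assume h': "arrow C h' z m \<and> j \<cdot>\<^bsub>C\<^esub> h' = t"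
      then have "i \<cdot>\<^bsub>C\<^esub> (k \<cdot>\<^bsub>C\<^esub> h') = i \<cdot>\<^bsub>C\<^esub> h"
        using Cmp_assoc[OF C _ k i] ik h(2) by metis
      then have "k \<cdot>\<^bsub>C\<^esub> h' = h"
        using equalizer_cancel[OF C fg eq arrow_Cmp[OF C _ k] h(1)] h' by blast
      then show "h' = k' \<cdot>\<^bsub>C\<^esub> h"
        using Cmp_assoc[OF C _ k k'] k'k Ide_Cmp[OF C] h' by metis
    qed
  qed
qed


section \<open>Adjunctions\<close>

locale adjoint_pair =
  fixes C :: "('o, 'm) cat" and D :: "('p, 'k) cat" and F R u e
  assumes adj: "adjunction C D F R u e"
begin

lemma F: "is_functor C D F" and R: "is_functor D C R"
  using adj by (simp_all add: adjunction_def)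

lemma C: "category C" and D: "category D"
  using F by (simp_all add: is_functor_def)

lemma unit_arrow: "a \<in> Obj C \<Longrightarrow> arrow C (u a) a (fo R (fo F a))"
  using adj functor_Obj[OF F] functor_Obj[OF R] by (simp add: adjunction_def nat_trans_def arrow_def)

lemma counit_arrow: "b \<in> Obj D \<Longrightarrow> arrow D (e b) (fo F (fo R b)) b"
  using adj functor_Obj[OF F] functor_Obj[OF R] by (simp add: adjunction_def nat_trans_def arrow_def)

lemma unit_natural:
  "arrow C f a b \<Longrightarrow> u b \<cdot>\<^bsub>C\<^esub> f = fm R (fo F a) (fo F b) (fm F a b f) \<cdot>\<^bsub>C\<^esub> u a"
  using adj by (simp add: adjunction_def nat_trans_def arrow_def)

lemma counit_natural:
  "arrow D f a b \<Longrightarrow> e b \<cdot>\<^bsub>D\<^esub> fm F (fo R a) (fo R b) (fm R a b f) = f \<cdot>\<^bsub>D\<^esub> e a"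
  using adj by (simp add: adjunction_def nat_trans_def arrow_def)

lemma triangle_left: "a \<in> Obj C \<Longrightarrow> e (fo F a) \<cdot>\<^bsub>D\<^esub> fm F a (fo R (fo F a)) (u a) = Ide D (fo F a)"
  using adj by (simp add: adjunction_def)

lemma triangle_right: "b \<in> Obj D \<Longrightarrow> fm R (fo F (fo R b)) b (e b) \<cdot>\<^bsub>C\<^esub> u (fo R b) = Ide C (fo R b)"
  using adj by (simp add: adjunction_def)

lemma transpose_left:
  assumes h: "arrow D h (fo F a) b" and a: "a \<in> Obj C"
  shows "e b \<cdot>\<^bsub>D\<^esub> fm F a (fo R b) (fm R (fo F a) b h \<cdot>\<^bsub>C\<^esub> u a) = h"
proof -
  have b: "b \<in> Obj D"
    using h by (simp add: arrow_def)
  note u = unit_arrow[OF a] and Rh = functor_arrow[OF R h]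
  have "e b \<cdot>\<^bsub>D\<^esub> fm F a (fo R b) (fm R (fo F a) b h \<cdot>\<^bsub>C\<^esub> u a)
      = e b \<cdot>\<^bsub>D\<^esub> (fm F (fo R (fo F a)) (fo R b) (fm R (fo F a) b h) \<cdot>\<^bsub>D\<^esub> fm F a (fo R (fo F a)) (u a))"
    using functor_Cmp[OF F u Rh] by simp
  also have "\<dots> = h \<cdot>\<^bsub>D\<^esub> (e (fo F a) \<cdot>\<^bsub>D\<^esub> fm F a (fo R (fo F a)) (u a))"
    using Cmp_assoc[OF D functor_arrow[OF F u] functor_arrow[OF F Rh] counit_arrow[OF b]]
      counit_natural[OF h]
      Cmp_assoc[OF D functor_arrow[OF F u] counit_arrow[OF functor_Obj[OF F a]] h] by simp
  finally show ?thesis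
    using triangle_left[OF a] Cmp_Ide[OF D h] by simp
qed

lemma transpose_right:
  assumes k: "arrow C k a (fo R b)" and b: "b \<in> Obj D"
  shows "fm R (fo F a) b (e b \<cdot>\<^bsub>D\<^esub> fm F a (fo R b) k) \<cdot>\<^bsub>C\<^esub> u a = k"
proof -
  have a: "a \<in> Obj C"
    using k by (simp add: arrow_def)
  note e = counit_arrow[OF b] and Fk = functor_arrow[OF F k]
  have "fm R (fo F a) b (e b \<cdot>\<^bsub>D\<^esub> fm F a (fo R b) k) \<cdot>\<^bsub>C\<^esub> u a
      = (fm R (fo F (fo R b)) b (e b) \<cdot>\<^bsub>C\<^esub> fm R (fo F a) (fo F (fo R b)) (fm F a (fo R b) k)) \<cdot>\<^bsub>C\<^esub> u a"
    using functor_Cmp[OF R Fk e] by simp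
  also have "\<dots> = (fm R (fo F (fo R b)) b (e b) \<cdot>\<^bsub>C\<^esub> u (fo R b)) \<cdot>\<^bsub>C\<^esub> k"
    using Cmp_assoc[OF C unit_arrow[OF a] functor_arrow[OF R Fk] functor_arrow[OF R e]]
      unit_natural[OF k] Cmp_assoc[OF C k unit_arrow[OF functor_Obj[OF R b]] functor_arrow[OF R e]]
    by simp
  finally show ?thesis
    using triangle_right[OF b] Ide_Cmp[OF C k] by simp
qed

text \<open>
  An arrow \<open>k\<close> equalizes \<open>R f\<close> and \<open>R g\<close> exactly if its transpose \<open>e\<^sub>a \<cdot> F k\<close> equalizes \<open>f\<close>
  and \<open>g\<close>.
\<close>

lemma right_adjoint_preserves_equalizers:
  assumes eq: "is_equalizer D l a b i f g" and fg: "arrow D f a b" "arrow D g a b"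
  shows "is_equalizer C (fo R l) (fo R a) (fo R b) (fm R l a i) (fm R a b f) (fm R a b g)"
  unfolding is_equalizer_def
proof (intro conjI allI impI)
  note i = is_equalizer_arrow[OF eq] and comm = is_equalizer_commutes[OF eq]
  have obj: "l \<in> Obj D" "a \<in> Obj D" "b \<in> Obj D"
    using i fg by (auto simp: arrow_def)
  show "arrow C (fm R l a i) (fo R l) (fo R a)"
    by (rule functor_arrow[OF R i])
  show "fm R a b f \<cdot>\<^bsub>C\<^esub> fm R l a i = fm R a b g \<cdot>\<^bsub>C\<^esub> fm R l a i"
    using functor_Cmp[OF R i fg(1)] functor_Cmp[OF R i fg(2)] comm by simp
  fix z k assume "arrow C k z (fo R a) \<and> fm R a b f \<cdot>\<^bsub>C\<^esub> k = fm R a b g \<cdot>\<^bsub>C\<^esub> k"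
  then have k: "arrow C k z (fo R a)" and k_comm: "fm R a b f \<cdot>\<^bsub>C\<^esub> k = fm R a b g \<cdot>\<^bsub>C\<^esub> k"
    by auto
  have z: "z \<in> Obj C"
    using k by (simp add: arrow_def)
  define t where "t = e a \<cdot>\<^bsub>D\<^esub> fm F z (fo R a) k"
  note Fk = functor_arrow[OF F k]
  have t: "arrow D t (fo F z) a"
    using arrow_Cmp[OF D Fk counit_arrow[OF obj(2)]] by (simp add: t_def)
  have post: "h \<cdot>\<^bsub>D\<^esub> t = e b \<cdot>\<^bsub>D\<^esub> fm F z (fo R b) (fm R a b h \<cdot>\<^bsub>C\<^esub> k)" if h: "arrow D h a b" for h
    using Cmp_assoc[OF D Fk counit_arrow[OF obj(2)] h] counit_natural[OF h]
      Cmp_assoc[OF D Fk functor_arrow[OF F functor_arrow[OF R h]] counit_arrow[OF obj(3)]]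
      functor_Cmp[OF F k functor_arrow[OF R h]] by (simp add: t_def)
  have "f \<cdot>\<^bsub>D\<^esub> t = g \<cdot>\<^bsub>D\<^esub> t"
    using post fg k_comm by simp
  then obtain s where s: "arrow D s (fo F z) l" and i_s: "i \<cdot>\<^bsub>D\<^esub> s = t"
    using equalizer_factor[OF eq t] by blast
  show "\<exists>!h. arrow C h z (fo R l) \<and> fm R l a i \<cdot>\<^bsub>C\<^esub> h = k"
  proof (rule ex1I[of _ "fm R (fo F z) l s \<cdot>\<^bsub>C\<^esub> u z"])
    have "fm R l a i \<cdot>\<^bsub>C\<^esub> (fm R (fo F z) l s \<cdot>\<^bsub>C\<^esub> u z) = fm R (fo F z) a t \<cdot>\<^bsub>C\<^esub> u z"
      using Cmp_assoc[OF C unit_arrow[OF z] functor_arrow[OF R s] functor_arrow[OF R i]]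
        functor_Cmp[OF R s i] i_s by simp
    then show "arrow C (fm R (fo F z) l s \<cdot>\<^bsub>C\<^esub> u z) z (fo R l)
        \<and> fm R l a i \<cdot>\<^bsub>C\<^esub> (fm R (fo F z) l s \<cdot>\<^bsub>C\<^esub> u z) = k"
      using transpose_right[OF k obj(2)] arrow_Cmp[OF C unit_arrow[OF z] functor_arrow[OF R s]]
      by (simp add: t_def)
    fix h assume "arrow C h z (fo R l) \<and> fm R l a i \<cdot>\<^bsub>C\<^esub> h = k"
    then have h: "arrow C h z (fo R l)" and ih: "fm R l a i \<cdot>\<^bsub>C\<^esub> h = k"
      by auto
    note Fh = functor_arrow[OF F h] and el = counit_arrow[OF obj(1)]
    have "i \<cdot>\<^bsub>D\<^esub> (e l \<cdot>\<^bsub>D\<^esub> fm F z (fo R l) h) = t"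
      using Cmp_assoc[OF D Fh el i] counit_natural[OF i]
        Cmp_assoc[OF D Fh functor_arrow[OF F functor_arrow[OF R i]] counit_arrow[OF obj(2)]]
        functor_Cmp[OF F h functor_arrow[OF R i]] ih by (simp add: t_def)
    then have "e l \<cdot>\<^bsub>D\<^esub> fm F z (fo R l) h = s"
      using equalizer_cancel[OF D fg eq arrow_Cmp[OF D Fh el] s] i_s by simp
    then show "h = fm R (fo F z) l s \<cdot>\<^bsub>C\<^esub> u z"
      using transpose_right[OF h obj(1)] by simp
  qed
qed

text \<open>
  If \<open>R m\<close> identifies \<open>g\<close> and \<open>h\<close>, then \<open>m\<close> identifies their transposes.
\<close>

lemma right_adjoint_cancel_mono:
  assumes m: "is_mono D a b m" and ab: "a \<in> Obj D" "b \<in> Obj D"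
    and g: "arrow C g z (fo R a)" and h: "arrow C h z (fo R a)"
    and eq: "fm R a b m \<cdot>\<^bsub>C\<^esub> g = fm R a b m \<cdot>\<^bsub>C\<^esub> h"
  shows "g = h"
proof -
  have z: "z \<in> Obj C"
    using g by (simp add: arrow_def)
  have m': "arrow D m a b"
    using m ab by (simp add: is_mono_def arrow_def)
  have post: "m \<cdot>\<^bsub>D\<^esub> (e a \<cdot>\<^bsub>D\<^esub> fm F z (fo R a) k) = e b \<cdot>\<^bsub>D\<^esub> fm F z (fo R b) (fm R a b m \<cdot>\<^bsub>C\<^esub> k)"
    if k: "arrow C k z (fo R a)" for k
    using Cmp_assoc[OF D functor_arrow[OF F k] counit_arrow[OF ab(1)] m'] counit_natural[OF m']
      Cmp_assoc[OF D functor_arrow[OF F k] functor_arrow[OF F functor_arrow[OF R m']] counit_arrow[OF ab(2)]]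
      functor_Cmp[OF F k functor_arrow[OF R m']] by simp
  have "arrow D (e a \<cdot>\<^bsub>D\<^esub> fm F z (fo R a) k) (fo F z) a" if k: "arrow C k z (fo R a)" for k
    by (rule arrow_Cmp[OF D functor_arrow[OF F k] counit_arrow[OF ab(1)]])
  note this[OF g] this[OF h]
  moreover have "m \<cdot>\<^bsub>D\<^esub> (e a \<cdot>\<^bsub>D\<^esub> fm F z (fo R a) g) = m \<cdot>\<^bsub>D\<^esub> (e a \<cdot>\<^bsub>D\<^esub> fm F z (fo R a) h)"
    using post[OF g] post[OF h] eq by simp
  ultimately have "e a \<cdot>\<^bsub>D\<^esub> fm F z (fo R a) g = e a \<cdot>\<^bsub>D\<^esub> fm F z (fo R a) h"
    using m unfolding is_mono_def arrow_def by blast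
  then show "g = h"
    by (metis transpose_right[OF g ab(1)] transpose_right[OF h ab(1)])
qed

lemma right_adjoint_preserves_mono:
  assumes "is_mono D a b m" and "a \<in> Obj D" and "b \<in> Obj D"
  shows "is_mono C (fo R a) (fo R b) (fm R a b m)"
  unfolding is_mono_def
proof (intro conjI ballI impI)
  show "fm R a b m \<in> Hom C (fo R a) (fo R b)"
    using functor_arrow[OF R, of m a b] assms by (simp add: is_mono_def arrow_def)
  fix z g h assume "z \<in> Obj C" "g \<in> Hom C z (fo R a)" "h \<in> Hom C z (fo R a)"
    and eq: "fm R a b m \<cdot>\<^bsub>C\<^esub> g = fm R a b m \<cdot>\<^bsub>C\<^esub> h"
  then have "arrow C g z (fo R a)" and "arrow C h z (fo R a)"
    using functor_Obj[OF R assms(2)] by (simp_all add: arrow_def)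
  then show "g = h"
    using right_adjoint_cancel_mono[OF assms _ _ eq] by blast
qed

end


section \<open>The comparison functor of an adjunction\<close>

definition coproduct ::
  "('o, 'm, 'p, 'k) functr \<Rightarrow> ('p, 'k, 'o, 'm) functr \<Rightarrow> ('o \<Rightarrow> 'm) \<Rightarrow> 'p \<Rightarrow> 'k" where
  "coproduct F R u Y = fm F (fo R Y) (fo R (fo F (fo R Y))) (u (fo R Y))"

definition comparison ::
  "('o, 'm, 'p, 'k) functr \<Rightarrow> ('p, 'k, 'o, 'm) functr \<Rightarrow> ('o \<Rightarrow> 'm) \<Rightarrow> ('o, 'm, 'p \<times> 'k, 'k) functr" where
  "comparison F R u = \<lparr>fo = (\<lambda>a. (fo F a, fm F a (fo R (fo F a)) (u a))), fm = fm F\<rparr>"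

context adjoint_pair
begin

abbreviation "J \<equiv> functor_comp F R"
abbreviation "\<delta> \<equiv> coproduct F R u"
abbreviation "EM \<equiv> em_cat D J e \<delta>"
abbreviation "Fu a \<equiv> fm F a (fo R (fo F a)) (u a)"

definition coalgebra :: "'p \<Rightarrow> 'k \<Rightarrow> bool" where
  "coalgebra E \<rho> \<longleftrightarrow> arrow D \<rho> E (fo J E) \<and> e E \<cdot>\<^bsub>D\<^esub> \<rho> = Ide D E \<and>
     fm J E (fo J E) \<rho> \<cdot>\<^bsub>D\<^esub> \<rho> = \<delta> E \<cdot>\<^bsub>D\<^esub> \<rho>"

definition coalgebra_map :: "'p \<Rightarrow> 'k \<Rightarrow> 'p \<Rightarrow> 'k \<Rightarrow> 'k \<Rightarrow> bool" where
  "coalgebra_map E \<rho> E' \<rho>' f \<longleftrightarrow> arrow D f E E' \<and> \<rho>' \<cdot>\<^bsub>D\<^esub> f = fm J E E' f \<cdot>\<^bsub>D\<^esub> \<rho>"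

lemma J: "is_functor D D J"
  by (rule is_functor_comp[OF R F])

lemma coproduct_arrow: "Y \<in> Obj D \<Longrightarrow> arrow D (\<delta> Y) (fo J Y) (fo J (fo J Y))"
  using functor_arrow[OF F unit_arrow[OF functor_Obj[OF R]]] by (simp add: coproduct_def)

lemma coproduct_natural:
  assumes f: "arrow D f a b"
  shows "\<delta> b \<cdot>\<^bsub>D\<^esub> fm J a b f = fm J (fo J a) (fo J b) (fm J a b f) \<cdot>\<^bsub>D\<^esub> \<delta> a"
proof -
  have ab: "a \<in> Obj D" "b \<in> Obj D"
    using f by (auto simp: arrow_def)
  note Rf = functor_arrow[OF R f] and u = unit_arrow[OF functor_Obj[OF R]]
  show ?thesis
    using unit_natural[OF Rf] functor_Cmp[OF F Rf u[OF ab(2)]]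
      functor_Cmp[OF F u[OF ab(1)] functor_arrow[OF R functor_arrow[OF F Rf]]]
    by (simp add: coproduct_def)
qed

lemma counit_coproduct: "Y \<in> Obj D \<Longrightarrow> e (fo J Y) \<cdot>\<^bsub>D\<^esub> \<delta> Y = Ide D (fo J Y)"
  using triangle_left[OF functor_Obj[OF R]] by (simp add: coproduct_def)

lemma J_counit_coproduct:
  assumes Y: "Y \<in> Obj D"
  shows "fm J (fo J Y) Y (e Y) \<cdot>\<^bsub>D\<^esub> \<delta> Y = Ide D (fo J Y)"
  using functor_Cmp[OF F unit_arrow[OF functor_Obj[OF R Y]] functor_arrow[OF R counit_arrow[OF Y]]]
    triangle_right[OF Y] functor_Ide[OF F functor_Obj[OF R Y]]
  by (simp add: coproduct_def)

text \<open>
  This is \<open>F\<close> applied to the naturality of the unit with respect to the unit at \<open>R Y\<close>.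
\<close>

lemma coproduct_coassoc:
  assumes Y: "Y \<in> Obj D"
  shows "\<delta> (fo J Y) \<cdot>\<^bsub>D\<^esub> \<delta> Y = fm J (fo J Y) (fo J (fo J Y)) (\<delta> Y) \<cdot>\<^bsub>D\<^esub> \<delta> Y"
proof -
  note u = unit_arrow[OF functor_Obj[OF R Y]]
  note Fu = functor_arrow[OF F u]
  show ?thesis
    using unit_natural[OF u] functor_Cmp[OF F u unit_arrow[OF functor_Obj[OF R functor_Obj[OF F functor_Obj[OF R Y]]]]]
     functor_Cmp[OF F u functor_arrow[OF R Fu]] by (simp add: coproduct_def)
qed

lemma Obj_EM: "(E, \<rho>) \<in> Obj EM \<longleftrightarrow> coalgebra E \<rho>"
  using functor_Obj[OF J] by (auto simp: em_cat_def coalgebra_def arrow_def)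

lemma Ide_EM [simp]: "Ide EM (E, \<rho>) = Ide D E"
  and Cmp_EM [simp]: "Cmp EM = Cmp D"
  by (simp_all add: em_cat_def)

lemma coalgebra_Obj: "coalgebra E \<rho> \<Longrightarrow> E \<in> Obj D"
  by (simp add: coalgebra_def arrow_def)

lemma arrow_EM:
  "arrow EM f (E, \<rho>) (E', \<rho>') \<longleftrightarrow> coalgebra E \<rho> \<and> coalgebra E' \<rho>' \<and> coalgebra_map E \<rho> E' \<rho>' f"
  using Obj_EM coalgebra_Obj by (auto simp: arrow_def coalgebra_map_def em_cat_def)

lemma coalgebra_map_Ide:
  assumes E: "coalgebra E \<rho>"
  shows "coalgebra_map E \<rho> E \<rho> (Ide D E)"
proof -
  have \<rho>: "arrow D \<rho> E (fo J E)"
    using E by (simp add: coalgebra_def)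
  show ?thesis
    using arrow_Ide[OF D coalgebra_Obj[OF E]] Cmp_Ide[OF D \<rho>] Ide_Cmp[OF D \<rho>]
      functor_Ide[OF J coalgebra_Obj[OF E]] by (simp add: coalgebra_map_def)
qed

lemma coalgebra_map_Cmp:
  assumes "coalgebra E \<rho>" "coalgebra E' \<rho>'" "coalgebra E'' \<rho>''"
    and f: "coalgebra_map E \<rho> E' \<rho>' f" and g: "coalgebra_map E' \<rho>' E'' \<rho>'' g"
  shows "coalgebra_map E \<rho> E'' \<rho>'' (g \<cdot>\<^bsub>D\<^esub> f)"
proof -
  have \<rho>: "arrow D \<rho> E (fo J E)" and \<rho>': "arrow D \<rho>' E' (fo J E')" and \<rho>'': "arrow D \<rho>'' E'' (fo J E'')"
    using assms by (auto simp: coalgebra_def)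
  have f: "arrow D f E E'" "\<rho>' \<cdot>\<^bsub>D\<^esub> f = fm J E E' f \<cdot>\<^bsub>D\<^esub> \<rho>"
    and g: "arrow D g E' E''" "\<rho>'' \<cdot>\<^bsub>D\<^esub> g = fm J E' E'' g \<cdot>\<^bsub>D\<^esub> \<rho>'"
    using f g by (simp_all add: coalgebra_map_def)
  have "\<rho>'' \<cdot>\<^bsub>D\<^esub> (g \<cdot>\<^bsub>D\<^esub> f) = (fm J E' E'' g \<cdot>\<^bsub>D\<^esub> \<rho>') \<cdot>\<^bsub>D\<^esub> f"
    using Cmp_assoc[OF D f(1) g(1) \<rho>''] g by simp
  also have "\<dots> = (fm J E' E'' g \<cdot>\<^bsub>D\<^esub> fm J E E' f) \<cdot>\<^bsub>D\<^esub> \<rho>"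
    using Cmp_assoc[OF D f(1) \<rho>' functor_arrow[OF J g(1)]] f(2)
      Cmp_assoc[OF D \<rho> functor_arrow[OF J f(1)] functor_arrow[OF J g(1)]] by simp
  also have "\<dots> = fm J E E'' (g \<cdot>\<^bsub>D\<^esub> f) \<cdot>\<^bsub>D\<^esub> \<rho>"
    using functor_Cmp[OF J f(1) g(1)] by simp
  finally show ?thesis
    using arrow_Cmp[OF D f(1) g(1)] by (simp add: coalgebra_map_def)
qed

lemma category_EM: "category EM"
proof -
  have *: "coalgebra_map E \<rho> E' \<rho>' f" if "(E, \<rho>) \<in> Obj EM" "(E', \<rho>') \<in> Obj EM" "f \<in> Hom EM (E, \<rho>) (E', \<rho>')"
    for E \<rho> E' \<rho>' f
    using that arrow_EM unfolding arrow_def by blast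
  have f: "arrow D f E E'" if "(E, \<rho>) \<in> Obj EM" "(E', \<rho>') \<in> Obj EM" "f \<in> Hom EM (E, \<rho>) (E', \<rho>')"
    for E \<rho> E' \<rho>' f
    using *[OF that] by (simp add: coalgebra_map_def)
  show ?thesis
    unfolding category_def
  proof (intro conjI ballI; clarify)
    fix E \<rho> assume "(E, \<rho>) \<in> Obj EM"
    then show "Ide EM (E, \<rho>) \<in> Hom EM (E, \<rho>) (E, \<rho>)"
      using coalgebra_map_Ide arrow_EM unfolding arrow_def Obj_EM by (metis Ide_EM)
  next
    fix E \<rho> E' \<rho>' E'' \<rho>'' f g
    assume "(E, \<rho>) \<in> Obj EM" "(E', \<rho>') \<in> Obj EM" "(E'', \<rho>'') \<in> Obj EM"
      "f \<in> Hom EM (E, \<rho>) (E', \<rho>')" "g \<in> Hom EM (E', \<rho>') (E'', \<rho>'')"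
    then show "g \<cdot>\<^bsub>EM\<^esub> f \<in> Hom EM (E, \<rho>) (E'', \<rho>'')"
      using coalgebra_map_Cmp * arrow_EM unfolding arrow_def Obj_EM by (metis Cmp_EM)
  next
    fix E \<rho> E' \<rho>' f
    assume "(E, \<rho>) \<in> Obj EM" "(E', \<rho>') \<in> Obj EM" "f \<in> Hom EM (E, \<rho>) (E', \<rho>')"
    then show "f \<cdot>\<^bsub>EM\<^esub> Ide EM (E, \<rho>) = f" "Ide EM (E', \<rho>') \<cdot>\<^bsub>EM\<^esub> f = f"
      using f Cmp_Ide[OF D] Ide_Cmp[OF D] by (metis Cmp_EM Ide_EM)+
  next
    fix E \<rho> E' \<rho>' E'' \<rho>'' E3 \<rho>3 f g h
    assume "(E, \<rho>) \<in> Obj EM" "(E', \<rho>') \<in> Obj EM" "(E'', \<rho>'') \<in> Obj EM" "(E3, \<rho>3) \<in> Obj EM"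
      "f \<in> Hom EM (E, \<rho>) (E', \<rho>')" "g \<in> Hom EM (E', \<rho>') (E'', \<rho>'')" "h \<in> Hom EM (E'', \<rho>'') (E3, \<rho>3)"
    then show "h \<cdot>\<^bsub>EM\<^esub> (g \<cdot>\<^bsub>EM\<^esub> f) = (h \<cdot>\<^bsub>EM\<^esub> g) \<cdot>\<^bsub>EM\<^esub> f"
      using f Cmp_assoc[OF D] by (metis Cmp_EM)
  qed
qed

text \<open>
  The counit law is a triangle identity; coassociativity is \<open>F\<close> applied to the naturality of the
  unit with respect to \<open>u\<^sub>a\<close>.
\<close>

lemma comparison_coalgebra:
  assumes a: "a \<in> Obj C"
  shows "coalgebra (fo F a) (Fu a)"
proof -
  note u = unit_arrow[OF a]
  note Fu = functor_arrow[OF F u]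
  have "fm F a (fo R (fo F (fo R (fo F a)))) (u (fo R (fo F a)) \<cdot>\<^bsub>C\<^esub> u a)
      = fm F (fo R (fo F a)) (fo R (fo F (fo R (fo F a)))) (u (fo R (fo F a))) \<cdot>\<^bsub>D\<^esub> Fu a"
    by (rule functor_Cmp[OF F u unit_arrow[OF functor_Obj[OF R functor_Obj[OF F a]]]])
  moreover have "fm F a (fo R (fo F (fo R (fo F a)))) (u (fo R (fo F a)) \<cdot>\<^bsub>C\<^esub> u a)
      = fm F (fo R (fo F a)) (fo R (fo F (fo R (fo F a)))) (fm R (fo F a) (fo F (fo R (fo F a))) (Fu a))
        \<cdot>\<^bsub>D\<^esub> Fu a"
    using functor_Cmp[OF F u functor_arrow[OF R Fu]] unit_natural[OF u] by simp
  ultimately show ?thesis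
    using triangle_left[OF a] Fu by (simp add: coalgebra_def coproduct_def)
qed

lemma comparison_coalgebra_map:
  assumes f: "arrow C f a b"
  shows "coalgebra_map (fo F a) (Fu a) (fo F b) (Fu b) (fm F a b f)"
proof -
  have a: "a \<in> Obj C" and b: "b \<in> Obj C"
    using f by (auto simp: arrow_def)
  show ?thesis
    using functor_Cmp[OF F f unit_arrow[OF b]] unit_natural[OF f] functor_arrow[OF F f]
      functor_Cmp[OF F unit_arrow[OF a] functor_arrow[OF R functor_arrow[OF F f]]]
    by (simp add: coalgebra_map_def)
qed

lemma fo_comparison [simp]: "fo (comparison F R u) a = (fo F a, Fu a)"
  and fm_comparison [simp]: "fm (comparison F R u) = fm F"
  by (simp_all add: comparison_def)

lemma comparison_functor: "is_functor C EM (comparison F R u)"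
proof (rule is_functorI[OF C category_EM])
  show "fo (comparison F R u) a \<in> Obj EM" if "a \<in> Obj C" for a
    using comparison_coalgebra[OF that] by (simp add: Obj_EM)
  show "fm (comparison F R u) a b f \<in> Hom EM (fo (comparison F R u) a) (fo (comparison F R u) b)"
    if f: "arrow C f a b" for f a b
  proof -
    have "a \<in> Obj C" and "b \<in> Obj C"
      using f by (auto simp: arrow_def)
    then have "arrow EM (fm F a b f) (fo F a, Fu a) (fo F b, Fu b)"
      using comparison_coalgebra comparison_coalgebra_map[OF f] by (simp add: arrow_EM)
    then show ?thesis
      by (simp add: arrow_def)
  qed
qed (simp_all add: functor_Ide[OF F] functor_Cmp[OF F])

text \<open>The equalizer is split by the counit: an arrow \<open>k\<close> equalizing the pair factors through \<open>\<rho>\<close> as \<open>e\<^sub>E k\<close>.\<close>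

lemma coalgebra_equalizer:
  assumes E: "coalgebra E \<rho>"
  shows "is_equalizer D E (fo J E) (fo J (fo J E)) \<rho> (\<delta> E) (fm J E (fo J E) \<rho>)"
  unfolding is_equalizer_def
proof (intro conjI allI impI)
  have \<rho>: "arrow D \<rho> E (fo J E)" and counit: "e E \<cdot>\<^bsub>D\<^esub> \<rho> = Ide D E"
    and coassoc: "fm J E (fo J E) \<rho> \<cdot>\<^bsub>D\<^esub> \<rho> = \<delta> E \<cdot>\<^bsub>D\<^esub> \<rho>"
    using E by (auto simp: coalgebra_def)
  have EE: "E \<in> Obj D" and JE: "fo J E \<in> Obj D"
    using coalgebra_Obj[OF E] functor_Obj[OF J] by auto
  note e = counit_arrow[OF EE]
  have e': "arrow D (e E) (fo J E) E" and eJ: "arrow D (e (fo J E)) (fo J (fo J E)) (fo J E)"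
    using e counit_arrow[OF JE] by simp_all
  show "arrow D \<rho> E (fo J E)" "\<delta> E \<cdot>\<^bsub>D\<^esub> \<rho> = fm J E (fo J E) \<rho> \<cdot>\<^bsub>D\<^esub> \<rho>"
    using \<rho> coassoc by simp_all
  fix z k assume "arrow D k z (fo J E) \<and> \<delta> E \<cdot>\<^bsub>D\<^esub> k = fm J E (fo J E) \<rho> \<cdot>\<^bsub>D\<^esub> k"
  then have k: "arrow D k z (fo J E)" and comm: "\<delta> E \<cdot>\<^bsub>D\<^esub> k = fm J E (fo J E) \<rho> \<cdot>\<^bsub>D\<^esub> k"
    by auto
  show "\<exists>!h. arrow D h z E \<and> \<rho> \<cdot>\<^bsub>D\<^esub> h = k"
  proof (rule ex1I[of _ "e E \<cdot>\<^bsub>D\<^esub> k"])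
    have "\<rho> \<cdot>\<^bsub>D\<^esub> (e E \<cdot>\<^bsub>D\<^esub> k) = e (fo J E) \<cdot>\<^bsub>D\<^esub> (fm J E (fo J E) \<rho> \<cdot>\<^bsub>D\<^esub> k)"
      using Cmp_assoc[OF D k e' \<rho>] counit_natural[OF \<rho>]
        Cmp_assoc[OF D k functor_arrow[OF J \<rho>] eJ] by simp
    also have "\<dots> = k"
      using Cmp_assoc[OF D k coproduct_arrow[OF EE] eJ] comm counit_coproduct[OF EE] Ide_Cmp[OF D k]
      by simp
    finally show "arrow D (e E \<cdot>\<^bsub>D\<^esub> k) z E \<and> \<rho> \<cdot>\<^bsub>D\<^esub> (e E \<cdot>\<^bsub>D\<^esub> k) = k"
      using arrow_Cmp[OF D k e'] by simp
    fix h assume h: "arrow D h z E \<and> \<rho> \<cdot>\<^bsub>D\<^esub> h = k"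
    then show "h = e E \<cdot>\<^bsub>D\<^esub> k"
      using Cmp_assoc[OF D _ \<rho> e'] counit Ide_Cmp[OF D] by metis
  qed
qed

end


section \<open>Comonadicity\<close>

text \<open>
  The hypotheses of Beck's theorem, asked for all parallel pairs instead of the pairs that \<open>F\<close>
  makes part of a split equalizer.
\<close>

locale comonadic_pair = adjoint_pair +
  assumes equalizers: "has_equalizers C"
    and conservative: "reflects_isos C D F"
    and preserves_equalizers:
      "\<And>l a b i f g. is_equalizer C l a b i f g \<Longrightarrow> arrow C f a b \<Longrightarrow> arrow C g a b \<Longrightarrow>
         is_equalizer D (fo F l) (fo F a) (fo F b) (fm F l a i) (fm F a b f) (fm F a b g)"
begin

text \<open>
  The arrow from \<open>a\<close> to the equalizer of the pair becomes invertible under \<open>F\<close>, as \<open>F u\<^sub>a\<close> is an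
  equalizer of the image of the pair as well; hence it is invertible.
\<close>

lemma unit_equalizer:
  assumes a: "a \<in> Obj C"
  shows "is_equalizer C a (fo R (fo F a)) (fo R (fo F (fo R (fo F a)))) (u a)
           (u (fo R (fo F a))) (fm R (fo F a) (fo F (fo R (fo F a))) (Fu a))"
    (is "is_equalizer C a ?b ?c _ ?f ?g")
proof -
  note u = unit_arrow[OF a]
  have f: "arrow C ?f ?b ?c" and g: "arrow C ?g ?b ?c"
    using unit_arrow[OF functor_Obj[OF R functor_Obj[OF F a]]]
      functor_arrow[OF R functor_arrow[OF F u]] by auto
  obtain l i where eq: "is_equalizer C l ?b ?c i ?f ?g"
    using equalizers f g unfolding has_equalizers_def by blast
  obtain k where k: "arrow C k a l" and ik: "i \<cdot>\<^bsub>C\<^esub> k = u a"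
    using equalizer_factor[OF eq u unit_natural[OF u]] by blast
  have "is_iso D (fo F a) (fo F l) (fm F a l k)"
  proof (rule equalizer_comparison_iso[OF D functor_arrow[OF F f] functor_arrow[OF F g] _
        preserves_equalizers[OF eq f g] functor_arrow[OF F k]])
    show "is_equalizer D (fo F a) (fo F ?b) (fo F ?c) (Fu a) (fm F ?b ?c ?f) (fm F ?b ?c ?g)"
      using coalgebra_equalizer[OF comparison_coalgebra[OF a]] by (simp add: coproduct_def)
    show "fm F l ?b i \<cdot>\<^bsub>D\<^esub> fm F a l k = Fu a"
      using functor_Cmp[OF F k is_equalizer_arrow[OF eq]] ik by simp
  qed
  then have "is_iso C a l k"
    using conservative k unfolding reflects_isos_def by blast
  then show ?thesis
    using equalizer_iso_transfer[OF C f g eq _ a ik] by blast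
qed

text \<open>
  A coalgebra map \<open>g : F a \<rightarrow> F b\<close> transposes to an arrow \<open>a \<rightarrow> R F b\<close>. That \<open>g\<close> respects the
  structure maps says that this arrow equalizes the pair of which \<open>u\<^sub>b\<close> is the equalizer; its
  factorization through \<open>u\<^sub>b\<close> is the preimage of \<open>g\<close>.
\<close>

lemma comparison_fully_faithful: "fully_faithful C EM (comparison F R u)"
proof (rule fully_faithfulI[OF comparison_functor])
  fix a b f g
  assume f: "arrow C f a b" and g: "arrow C g a b"
    and "fm (comparison F R u) a b f = fm (comparison F R u) a b g"
  then have "u b \<cdot>\<^bsub>C\<^esub> f = u b \<cdot>\<^bsub>C\<^esub> g"
    using unit_natural[OF f] unit_natural[OF g] by simp
  moreover have b: "b \<in> Obj C"
    using f by (simp add: arrow_def)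
  ultimately show "f = g"
    using equalizer_cancel[OF C _ _ unit_equalizer[OF b] f g]
      unit_arrow[OF functor_Obj[OF R functor_Obj[OF F b]]]
      functor_arrow[OF R functor_arrow[OF F unit_arrow[OF b]]] by blast
next
  fix a b g
  assume a: "a \<in> Obj C" and b: "b \<in> Obj C"
    and "g \<in> Hom EM (fo (comparison F R u) a) (fo (comparison F R u) b)"
  then have "arrow EM g (fo F a, Fu a) (fo F b, Fu b)"
    using comparison_coalgebra by (simp add: arrow_def Obj_EM)
  then have g: "arrow D g (fo F a) (fo F b)"
    and g_map: "Fu b \<cdot>\<^bsub>D\<^esub> g = fm J (fo F a) (fo F b) g \<cdot>\<^bsub>D\<^esub> Fu a"
    by (auto simp: arrow_EM coalgebra_map_def)
  note u = unit_arrow[OF a] and Rg = functor_arrow[OF R g] and Fb = functor_Obj[OF F b]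
  note Fub = functor_arrow[OF F unit_arrow[OF b]] and Fua = functor_arrow[OF F u]
  define k where "k = fm R (fo F a) (fo F b) g \<cdot>\<^bsub>C\<^esub> u a"
  have k: "arrow C k a (fo R (fo F b))"
    using arrow_Cmp[OF C u Rg] by (simp add: k_def)
  have Fk: "fm F a (fo R (fo F b)) k = Fu b \<cdot>\<^bsub>D\<^esub> g"
    using functor_Cmp[OF F u Rg] g_map by (simp add: k_def)
  have "u (fo R (fo F b)) \<cdot>\<^bsub>C\<^esub> k
      = fm R (fo F a) (fo F (fo R (fo F b))) (Fu b \<cdot>\<^bsub>D\<^esub> g) \<cdot>\<^bsub>C\<^esub> u a"
    using unit_natural[OF k] Fk by simp
  also have "\<dots> = fm R (fo F b) (fo F (fo R (fo F b))) (Fu b) \<cdot>\<^bsub>C\<^esub> k"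
    using functor_Cmp[OF R g Fub] Cmp_assoc[OF C u Rg functor_arrow[OF R Fub]] by (simp add: k_def)
  finally obtain f where f: "arrow C f a b" and uf: "u b \<cdot>\<^bsub>C\<^esub> f = k"
    using equalizer_factor[OF unit_equalizer[OF b] k] by blast
  have "fm F a b f = (e (fo F b) \<cdot>\<^bsub>D\<^esub> Fu b) \<cdot>\<^bsub>D\<^esub> fm F a b f"
    using triangle_left[OF b] Ide_Cmp[OF D functor_arrow[OF F f]] by simp
  also have "\<dots> = e (fo F b) \<cdot>\<^bsub>D\<^esub> fm F a (fo R (fo F b)) k"
    using Cmp_assoc[OF D functor_arrow[OF F f] Fub counit_arrow[OF Fb]]
      functor_Cmp[OF F f unit_arrow[OF b]] uf by simp
  also have "\<dots> = g"
    using transpose_left[OF g a] by (simp add: k_def)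
  finally show "\<exists>f\<in>Hom C a b. fm (comparison F R u) a b f = g"
    using f by (auto simp: arrow_def)
qed

text \<open>
  A coalgebra \<open>\<rho> : E \<rightarrow> F R E\<close> comes from the equalizer \<open>l\<close> of \<open>u\<^sub>R\<^sub>E\<close> and \<open>R \<rho>\<close>: the image of this pair
  under \<open>F\<close> has both \<open>F l\<close> and \<open>E\<close> as equalizers.
\<close>

lemma comparison_essentially_surjective: "essentially_surjective C EM (comparison F R u)"
  unfolding essentially_surjective_def
proof clarify
  fix E \<rho> assume "(E, \<rho>) \<in> Obj EM"
  then have E: "coalgebra E \<rho>"
    by (simp add: Obj_EM)
  have \<rho>: "arrow D \<rho> E (fo F (fo R E))" and counit: "e E \<cdot>\<^bsub>D\<^esub> \<rho> = Ide D E"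
    using E by (auto simp: coalgebra_def)
  note EE = coalgebra_Obj[OF E]
  note f = unit_arrow[OF functor_Obj[OF R EE]] and g = functor_arrow[OF R \<rho>]
  obtain l i where eq: "is_equalizer C l (fo R E) (fo R (fo F (fo R E))) i
      (u (fo R E)) (fm R E (fo F (fo R E)) \<rho>)"
    using equalizers f g unfolding has_equalizers_def by blast
  note i = is_equalizer_arrow[OF eq]
  have l: "l \<in> Obj C"
    using i by (simp add: arrow_def)
  note Feq = preserves_equalizers[OF eq f g]
  have \<rho>eq: "is_equalizer D E (fo F (fo R E)) (fo F (fo R (fo F (fo R E)))) \<rho>
      (fm F (fo R E) (fo R (fo F (fo R E))) (u (fo R E)))
      (fm F (fo R E) (fo R (fo F (fo R E))) (fm R E (fo F (fo R E)) \<rho>))"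
    using coalgebra_equalizer[OF E] by (simp add: coproduct_def)
  obtain \<theta> where \<theta>: "arrow D \<theta> (fo F l) E" and \<rho>\<theta>: "\<rho> \<cdot>\<^bsub>D\<^esub> \<theta> = fm F l (fo R E) i"
    using equalizer_factor[OF \<rho>eq is_equalizer_arrow[OF Feq] is_equalizer_commutes[OF Feq]] by blast
  have iso: "is_iso D (fo F l) E \<theta>"
    by (rule equalizer_comparison_iso[OF D functor_arrow[OF F f] functor_arrow[OF F g] Feq \<rho>eq \<theta> \<rho>\<theta>])
  then obtain \<theta>' where \<theta>': "arrow D \<theta>' E (fo F l)" and inv: "\<theta>' \<cdot>\<^bsub>D\<^esub> \<theta> = Ide D (fo F l)"
    "\<theta> \<cdot>\<^bsub>D\<^esub> \<theta>' = Ide D E"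
    using is_isoE[OF iso functor_Obj[OF F l] EE] by blast
  have "e E \<cdot>\<^bsub>D\<^esub> fm F l (fo R E) i = \<theta>"
    using Cmp_assoc[OF D \<theta> \<rho> counit_arrow[OF EE]] \<rho>\<theta> counit Ide_Cmp[OF D \<theta>] by simp
  then have "fm R (fo F l) E \<theta> \<cdot>\<^bsub>C\<^esub> u l = i"
    using transpose_right[OF i EE] by simp
  then have map: "coalgebra_map (fo F l) (Fu l) E \<rho> \<theta>"
    using functor_Cmp[OF F unit_arrow[OF l] functor_arrow[OF R \<theta>]] \<theta> \<rho>\<theta>
    by (simp add: coalgebra_map_def)
  have J\<theta>': "fm J E (fo F l) \<theta>' \<cdot>\<^bsub>D\<^esub> fm J (fo F l) E \<theta> = Ide D (fo J (fo F l))"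
    using functor_Cmp[OF J \<theta> \<theta>'] inv functor_Ide[OF J functor_Obj[OF F l]] by simp
  note Ful = functor_arrow[OF F unit_arrow[OF l]]
  note J\<theta>_arrows = functor_arrow[OF J \<theta>] functor_arrow[OF J \<theta>']
  have "fm J E (fo F l) \<theta>' \<cdot>\<^bsub>D\<^esub> \<rho> = fm J E (fo F l) \<theta>' \<cdot>\<^bsub>D\<^esub> (\<rho> \<cdot>\<^bsub>D\<^esub> (\<theta> \<cdot>\<^bsub>D\<^esub> \<theta>'))"
    using inv Cmp_Ide[OF D \<rho>] by simp
  also have "\<dots> = fm J E (fo F l) \<theta>' \<cdot>\<^bsub>D\<^esub> ((fm J (fo F l) E \<theta> \<cdot>\<^bsub>D\<^esub> Fu l) \<cdot>\<^bsub>D\<^esub> \<theta>')"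
    using Cmp_assoc[OF D \<theta>' \<theta> \<rho>] map by (simp add: coalgebra_map_def)
  also have "\<dots> = (fm J E (fo F l) \<theta>' \<cdot>\<^bsub>D\<^esub> fm J (fo F l) E \<theta>) \<cdot>\<^bsub>D\<^esub> (Fu l \<cdot>\<^bsub>D\<^esub> \<theta>')"
    using Cmp_assoc[OF D \<theta>' Ful] Cmp_assoc[OF D arrow_Cmp[OF D \<theta>' Ful]] J\<theta>_arrows by simp
  also have "\<dots> = Fu l \<cdot>\<^bsub>D\<^esub> \<theta>'"
    using J\<theta>' Ide_Cmp[OF D arrow_Cmp[OF D \<theta>' Ful]] by simp
  finally have map': "coalgebra_map E \<rho> (fo F l) (Fu l) \<theta>'"
    using \<theta>' by (simp add: coalgebra_map_def)
  have "is_iso EM (fo F l, Fu l) (E, \<rho>) \<theta>"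
    by (rule is_isoI[of _ _ _ _ \<theta>']) (simp_all add: arrow_EM comparison_coalgebra l E map map' inv)
  then show "\<exists>a\<in>Obj C. \<exists>f. is_iso EM (fo (comparison F R u) a) (E, \<rho>) f"
    using l by auto
qed

theorem comparison_equivalence: "is_equivalence C EM (comparison F R u)"
  by (rule equivalence_if_fully_faithful_essentially_surjective
      [OF comparison_functor comparison_fully_faithful comparison_essentially_surjective])

end


section \<open>Coalgebras as generalized PDEs\<close>

text \<open>
  The transposition \<open>(F P E \<rightarrow> Y) \<cong> (E \<rightarrow> F R Y)\<close> for \<open>P\<close> left adjoint to \<open>F\<close>, with unit \<open>n\<close>, and
  \<open>F\<close> left adjoint to \<open>R\<close>, with unit \<open>u\<close>.
\<close>

definition adjunct ::
  "('o, 'm) cat \<Rightarrow> ('p, 'k) cat \<Rightarrow> ('p, 'k, 'o, 'm) functr \<Rightarrow> ('o, 'm, 'p, 'k) functr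
     \<Rightarrow> ('p, 'k, 'o, 'm) functr \<Rightarrow> ('p \<Rightarrow> 'k) \<Rightarrow> ('o \<Rightarrow> 'm) \<Rightarrow> 'p \<Rightarrow> 'p \<Rightarrow> 'k \<Rightarrow> 'k" where
  "adjunct C D P F R n u E Y \<sigma> =
     fm F (fo P E) (fo R Y) (fm R (fo F (fo P E)) Y \<sigma> \<cdot>\<^bsub>C\<^esub> u (fo P E)) \<cdot>\<^bsub>D\<^esub> n E"

text \<open>
  Here \<open>P\<close>, \<open>F\<close>, \<open>R\<close> stand for \<open>f\<^sub>!\<close>, \<open>f\<^sup>*\<close>, \<open>f\<^sub>*\<close>. The left adjoint enters in two ways: it
  provides the monad \<open>T = F P\<close> in terms of which solutions are defined, and it makes \<open>F\<close> a right
  adjoint, so that \<open>F\<close> preserves equalizers and monomorphisms.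
\<close>

locale adjoint_triple = left: adjoint_pair D C P F n c + adjoint_pair C D F R u e
  for C :: "('o, 'm) cat" and D :: "('p, 'k) cat" and P F R n c u e +
  assumes C_equalizers: "has_equalizers C" and F_conservative: "reflects_isos C D F"

sublocale adjoint_triple \<subseteq> comonadic_pair C D F R u e
  by unfold_locales
    (fact C_equalizers F_conservative left.right_adjoint_preserves_equalizers)+

context adjoint_triple
begin

abbreviation "T \<equiv> functor_comp F P"
abbreviation "adj_J \<equiv> adjunct C D P F R n u"
abbreviation "PDEs \<equiv> pde_cat D T n J e \<delta> adj_J"
abbreviation "solves \<equiv> formal_solution_family D T n J \<delta> adj_J"

lemma T: "is_functor D D T"
  by (rule is_functor_comp[OF left.F F])

lemma J_cancel_mono:
  assumes m: "is_mono D a b m" and ab: "a \<in> Obj D" "b \<in> Obj D"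
    and g: "arrow D g z (fo J a)" and h: "arrow D h z (fo J a)"
    and eq: "fm J a b m \<cdot>\<^bsub>D\<^esub> g = fm J a b m \<cdot>\<^bsub>D\<^esub> h"
  shows "g = h"
  using left.right_adjoint_cancel_mono[OF right_adjoint_preserves_mono[OF m ab]
      functor_Obj[OF R ab(1)] functor_Obj[OF R ab(2)]] g h eq by simp

lemma adjunct_arrow:
  assumes E: "E \<in> Obj D" and \<sigma>: "arrow D \<sigma> (fo T E) Y"
  shows "arrow D (adj_J E Y \<sigma>) E (fo J Y)"
proof -
  have "arrow D \<sigma> (fo F (fo P E)) Y"
    using \<sigma> by simp
  then have "arrow C (fm R (fo F (fo P E)) Y \<sigma> \<cdot>\<^bsub>C\<^esub> u (fo P E)) (fo P E) (fo R Y)"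
    using arrow_Cmp[OF C unit_arrow[OF functor_Obj[OF left.F E]]] functor_arrow[OF R] by blast
  then show ?thesis
    using arrow_Cmp[OF D left.unit_arrow[OF E]] functor_arrow[OF F] by (simp add: adjunct_def)
qed

lemma adjunct_natural:
  assumes E: "E \<in> Obj D" and \<sigma>: "arrow D \<sigma> (fo T E) Y" and \<tau>: "arrow D \<tau> Y Y'"
  shows "adj_J E Y' (\<tau> \<cdot>\<^bsub>D\<^esub> \<sigma>) = fm J Y Y' \<tau> \<cdot>\<^bsub>D\<^esub> adj_J E Y \<sigma>"
proof -
  have \<sigma>: "arrow D \<sigma> (fo F (fo P E)) Y"
    using \<sigma> by simp
  note u = unit_arrow[OF functor_Obj[OF left.F E]]
  note R\<sigma> = functor_arrow[OF R \<sigma>] and R\<tau> = functor_arrow[OF R \<tau>]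
  note k = arrow_Cmp[OF C u R\<sigma>]
  have "fm R (fo F (fo P E)) Y' (\<tau> \<cdot>\<^bsub>D\<^esub> \<sigma>) \<cdot>\<^bsub>C\<^esub> u (fo P E)
      = fm R Y Y' \<tau> \<cdot>\<^bsub>C\<^esub> (fm R (fo F (fo P E)) Y \<sigma> \<cdot>\<^bsub>C\<^esub> u (fo P E))"
    using functor_Cmp[OF R \<sigma> \<tau>] Cmp_assoc[OF C u R\<sigma> R\<tau>] by simp
  then show ?thesis
    using functor_Cmp[OF F k R\<tau>]
      Cmp_assoc[OF D left.unit_arrow[OF E, simplified] functor_arrow[OF F k] functor_arrow[OF F R\<tau>]]
    by (simp add: adjunct_def)
qed

text \<open>
  For a formally integrable PDE \<open>m : E \<rightarrow> J Y\<close> the projection of the prolongation to \<open>J E\<close> becomes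
  an arrow \<open>\<rho> : E \<rightarrow> J E\<close> under the identification of the prolongation with \<open>E\<close>; the last conjunct
  is the commutativity of the prolongation square. A coalgebra is the case \<open>m = \<rho>\<close>.
\<close>

definition resolves :: "'p \<Rightarrow> 'k \<Rightarrow> 'p \<Rightarrow> 'k \<Rightarrow> bool" where
  "resolves E \<rho> Y m \<longleftrightarrow> coalgebra E \<rho> \<and> Y \<in> Obj D \<and> is_mono D E (fo J Y) m \<and>
     \<delta> Y \<cdot>\<^bsub>D\<^esub> m = fm J E (fo J Y) m \<cdot>\<^bsub>D\<^esub> \<rho>"

lemma coalgebra_mono:
  assumes E: "coalgebra E \<rho>"
  shows "is_mono D E (fo J E) \<rho>"
  unfolding is_mono_def
proof (intro conjI ballI impI)
  have \<rho>: "arrow D \<rho> E (fo J E)"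
    using E by (simp add: coalgebra_def)
  then show "\<rho> \<in> Hom D E (fo J E)"
    by (simp add: arrow_def)
  fix z g h
  assume "z \<in> Obj D" "g \<in> Hom D z E" "h \<in> Hom D z E" and eq: "\<rho> \<cdot>\<^bsub>D\<^esub> g = \<rho> \<cdot>\<^bsub>D\<^esub> h"
  then have g: "arrow D g z E" and h: "arrow D h z E"
    using coalgebra_Obj[OF E] by (auto simp: arrow_def)
  show "g = h"
    using equalizer_cancel[OF D coproduct_arrow[OF coalgebra_Obj[OF E]] functor_arrow[OF J \<rho>]
        coalgebra_equalizer[OF E] g h eq] .
qed

lemma coalgebra_resolves: "coalgebra E \<rho> \<Longrightarrow> resolves E \<rho> E \<rho>"
  using coalgebra_mono coalgebra_Obj by (simp add: resolves_def coalgebra_def)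

text \<open>
  By naturality both sides of the equation that defines solutions are composites with the
  monomorphism \<open>J m\<close>, which can be cancelled. So the solutions of \<open>m\<close> are determined by \<open>\<rho>\<close>.
\<close>

lemma solves_iff:
  assumes res: "resolves E \<rho> Y m"
  shows "solves (Y, E, m) X s \<longleftrightarrow>
    X \<in> Obj D \<and> arrow D s (fo T X) E \<and> (\<rho> \<cdot>\<^bsub>D\<^esub> s) \<cdot>\<^bsub>D\<^esub> n X = adj_J X E s"
proof (cases "X \<in> Obj D \<and> arrow D s (fo T X) E")
  case True
  then have X: "X \<in> Obj D" and s: "arrow D s (fo T X) E"
    by auto
  have E: "E \<in> Obj D" and Y: "Y \<in> Obj D" and \<rho>: "arrow D \<rho> E (fo J E)"
    and m_mono: "is_mono D E (fo J Y) m" and m_comm: "\<delta> Y \<cdot>\<^bsub>D\<^esub> m = fm J E (fo J Y) m \<cdot>\<^bsub>D\<^esub> \<rho>"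
    using res coalgebra_Obj by (auto simp: resolves_def coalgebra_def)
  note JY = functor_Obj[OF J Y]
  have m: "arrow D m E (fo J Y)"
    using m_mono E JY by (simp add: is_mono_def arrow_def)
  note Jm = functor_arrow[OF J m]
  have n: "arrow D (n X) X (fo T X)"
    using left.unit_arrow[OF X] by simp
  have l: "arrow D ((\<rho> \<cdot>\<^bsub>D\<^esub> s) \<cdot>\<^bsub>D\<^esub> n X) X (fo J E)"
    by (rule arrow_Cmp[OF D n arrow_Cmp[OF D s \<rho>]])
  have r: "arrow D (adj_J X E s) X (fo J E)"
    by (rule adjunct_arrow[OF X s])
  have "\<delta> Y \<cdot>\<^bsub>D\<^esub> ((m \<cdot>\<^bsub>D\<^esub> s) \<cdot>\<^bsub>D\<^esub> n X) = (\<delta> Y \<cdot>\<^bsub>D\<^esub> (m \<cdot>\<^bsub>D\<^esub> s)) \<cdot>\<^bsub>D\<^esub> n X"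
    by (rule Cmp_assoc[OF D n arrow_Cmp[OF D s m] coproduct_arrow[OF Y]])
  also have "\<dots> = (fm J E (fo J Y) m \<cdot>\<^bsub>D\<^esub> (\<rho> \<cdot>\<^bsub>D\<^esub> s)) \<cdot>\<^bsub>D\<^esub> n X"
    using Cmp_assoc[OF D s m coproduct_arrow[OF Y]] Cmp_assoc[OF D s \<rho> Jm] m_comm by simp
  also have "\<dots> = fm J E (fo J Y) m \<cdot>\<^bsub>D\<^esub> ((\<rho> \<cdot>\<^bsub>D\<^esub> s) \<cdot>\<^bsub>D\<^esub> n X)"
    by (rule Cmp_assoc[OF D n arrow_Cmp[OF D s \<rho>] Jm, symmetric])
  finally have "solves (Y, E, m) X s \<longleftrightarrow>
      fm J E (fo J Y) m \<cdot>\<^bsub>D\<^esub> ((\<rho> \<cdot>\<^bsub>D\<^esub> s) \<cdot>\<^bsub>D\<^esub> n X) = fm J E (fo J Y) m \<cdot>\<^bsub>D\<^esub> adj_J X E s"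
    using X s adjunct_natural[OF X s m] by (simp add: formal_solution_family_def arrow_def)
  then show ?thesis
    using J_cancel_mono[OF m_mono E JY l r] X s by auto
next
  case False
  have "E \<in> Obj D"
    using res coalgebra_Obj by (auto simp: resolves_def)
  then show ?thesis
    using False functor_Obj[OF T] by (auto simp: formal_solution_family_def arrow_def)
qed

lemma coalgebra_map_preserves_solutions:
  assumes res: "resolves E \<rho> Y m" and res': "resolves E' \<rho>' Y' m'"
    and f: "coalgebra_map E \<rho> E' \<rho>' f" and s: "solves (Y, E, m) X s"
  shows "solves (Y', E', m') X (f \<cdot>\<^bsub>D\<^esub> s)"
proof -
  have X: "X \<in> Obj D" and s: "arrow D s (fo T X) E"
    and s_sol: "(\<rho> \<cdot>\<^bsub>D\<^esub> s) \<cdot>\<^bsub>D\<^esub> n X = adj_J X E s"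
    using s solves_iff[OF res] by auto
  have \<rho>: "arrow D \<rho> E (fo J E)" and \<rho>': "arrow D \<rho>' E' (fo J E')"
    using res res' by (auto simp: resolves_def coalgebra_def)
  have f: "arrow D f E E'" and f_map: "\<rho>' \<cdot>\<^bsub>D\<^esub> f = fm J E E' f \<cdot>\<^bsub>D\<^esub> \<rho>"
    using f by (auto simp: coalgebra_map_def)
  note Jf = functor_arrow[OF J f]
  have n: "arrow D (n X) X (fo T X)"
    using left.unit_arrow[OF X] by simp
  have "\<rho>' \<cdot>\<^bsub>D\<^esub> (f \<cdot>\<^bsub>D\<^esub> s) = fm J E E' f \<cdot>\<^bsub>D\<^esub> (\<rho> \<cdot>\<^bsub>D\<^esub> s)"
    using Cmp_assoc[OF D s f \<rho>'] Cmp_assoc[OF D s \<rho> Jf] f_map by simp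
  then have "(\<rho>' \<cdot>\<^bsub>D\<^esub> (f \<cdot>\<^bsub>D\<^esub> s)) \<cdot>\<^bsub>D\<^esub> n X = fm J E E' f \<cdot>\<^bsub>D\<^esub> ((\<rho> \<cdot>\<^bsub>D\<^esub> s) \<cdot>\<^bsub>D\<^esub> n X)"
    using Cmp_assoc[OF D n arrow_Cmp[OF D s \<rho>] Jf] by simp
  also have "\<dots> = adj_J X E' (f \<cdot>\<^bsub>D\<^esub> s)"
    using s_sol adjunct_natural[OF X s f] by simp
  finally show ?thesis
    using solves_iff[OF res'] X arrow_Cmp[OF D s f] by simp
qed

text \<open>
  Composing the two sides of \<open>\<delta>\<^sub>E i = J \<rho> r\<close> with the counit at \<open>J E\<close> and with \<open>J\<close> of the counit
  at \<open>E\<close> yields \<open>i = r = \<rho> e\<^sub>E r\<close>, so \<open>E\<close> is its own prolongation.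
\<close>

lemma coalgebra_formally_integrable:
  assumes E: "coalgebra E \<rho>"
  shows "formally_integrable D J e \<delta> (E, E, \<rho>)"
proof -
  have \<rho>: "arrow D \<rho> E (fo J E)" and counit: "e E \<cdot>\<^bsub>D\<^esub> \<rho> = Ide D E"
    and coassoc: "fm J E (fo J E) \<rho> \<cdot>\<^bsub>D\<^esub> \<rho> = \<delta> E \<cdot>\<^bsub>D\<^esub> \<rho>"
    using E by (auto simp: coalgebra_def)
  note EE = coalgebra_Obj[OF E]
  note JE = functor_Obj[OF J EE]
  note JJE = functor_Obj[OF J JE]
  note \<delta> = coproduct_arrow[OF EE] and J\<rho> = functor_arrow[OF J \<rho>]
  have e: "arrow D (e E) (fo J E) E" and eJ: "arrow D (e (fo J E)) (fo J (fo J E)) (fo J E)"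
    using counit_arrow[OF EE] counit_arrow[OF JE] by simp_all
  note Je = functor_arrow[OF J e]
  have "is_pullback D E (fo J E) (fo J E) (fo J (fo J E)) \<rho> (\<delta> E) \<rho> (fm J E (fo J E) \<rho>)"
    unfolding is_pullback_def
  proof (intro conjI ballI impI)
    fix z i r
    assume "z \<in> Obj D" "i \<in> Hom D z (fo J E)" "r \<in> Hom D z (fo J E)"
      and comm: "\<delta> E \<cdot>\<^bsub>D\<^esub> i = fm J E (fo J E) \<rho> \<cdot>\<^bsub>D\<^esub> r"
    then have i: "arrow D i z (fo J E)" and r: "arrow D r z (fo J E)" and z: "z \<in> Obj D"
      using JE by (auto simp: arrow_def)
    note er = arrow_Cmp[OF D r e]
    have "i = e (fo J E) \<cdot>\<^bsub>D\<^esub> (\<delta> E \<cdot>\<^bsub>D\<^esub> i)"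
      using Cmp_assoc[OF D i \<delta> eJ] counit_coproduct[OF EE] Ide_Cmp[OF D i] by simp
    also have "\<dots> = (e (fo J E) \<cdot>\<^bsub>D\<^esub> fm J E (fo J E) \<rho>) \<cdot>\<^bsub>D\<^esub> r"
      using comm Cmp_assoc[OF D r J\<rho> eJ] by simp
    also have "\<dots> = \<rho> \<cdot>\<^bsub>D\<^esub> (e E \<cdot>\<^bsub>D\<^esub> r)"
      using counit_natural[OF \<rho>] Cmp_assoc[OF D r e \<rho>] by simp
    finally have i_eq: "i = \<rho> \<cdot>\<^bsub>D\<^esub> (e E \<cdot>\<^bsub>D\<^esub> r)" .
    have "i = fm J (fo J E) E (e E) \<cdot>\<^bsub>D\<^esub> (\<delta> E \<cdot>\<^bsub>D\<^esub> i)"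
      using Cmp_assoc[OF D i \<delta> Je] J_counit_coproduct[OF EE] Ide_Cmp[OF D i] by simp
    also have "\<dots> = fm J E E (e E \<cdot>\<^bsub>D\<^esub> \<rho>) \<cdot>\<^bsub>D\<^esub> r"
      using comm Cmp_assoc[OF D r J\<rho> Je] functor_Cmp[OF J \<rho> e] by simp
    also have "\<dots> = r"
      unfolding counit functor_Ide[OF J EE] by (rule Ide_Cmp[OF D r])
    finally have ir: "i = r" .
    show "\<exists>!h. h \<in> Hom D z E \<and> \<rho> \<cdot>\<^bsub>D\<^esub> h = i \<and> \<rho> \<cdot>\<^bsub>D\<^esub> h = r"
    proof (rule ex1I[of _ "e E \<cdot>\<^bsub>D\<^esub> r"])
      show "e E \<cdot>\<^bsub>D\<^esub> r \<in> Hom D z E \<and> \<rho> \<cdot>\<^bsub>D\<^esub> (e E \<cdot>\<^bsub>D\<^esub> r) = i \<and> \<rho> \<cdot>\<^bsub>D\<^esub> (e E \<cdot>\<^bsub>D\<^esub> r) = r"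
        using er i_eq ir by (simp add: arrow_def)
      fix h assume "h \<in> Hom D z E \<and> \<rho> \<cdot>\<^bsub>D\<^esub> h = i \<and> \<rho> \<cdot>\<^bsub>D\<^esub> h = r"
      then show "h = e E \<cdot>\<^bsub>D\<^esub> r"
        using Cmp_assoc[OF D _ \<rho> e, of h z] counit Ide_Cmp[OF D, of h z E] z EE ir by (simp add: arrow_def)
    qed
  qed (use EE \<rho> coassoc \<delta> J\<rho> in \<open>simp_all add: arrow_def\<close>)
  moreover have "is_iso D E E (e E \<cdot>\<^bsub>D\<^esub> \<rho>)"
    unfolding counit by (rule is_isoI) (use arrow_Ide[OF D EE] Ide_Cmp[OF D arrow_Ide[OF D EE]] in auto)
  ultimately show ?thesis
    unfolding formally_integrable_def by blast
qed

lemma coalgebra_pde: "coalgebra E \<rho> \<Longrightarrow> (E, E, \<rho>) \<in> Obj PDEs"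
  using coalgebra_formally_integrable coalgebra_mono coalgebra_Obj
  by (simp add: pde_cat_def generalized_pde_def)

text \<open>
  Cancelling the monomorphism \<open>J J m\<close> reduces the coassociativity of \<open>\<rho>\<close> to that of the coproduct
  at \<open>Y\<close>.
\<close>

lemma pde_resolves:
  assumes "(Y, E, m) \<in> Obj PDEs"
  obtains \<rho> where "resolves E \<rho> Y m"
proof -
  have Y: "Y \<in> Obj D" and E: "E \<in> Obj D" and m_mono: "is_mono D E (fo J Y) m"
    and int: "formally_integrable D J e \<delta> (Y, E, m)"
    using assms by (auto simp: pde_cat_def generalized_pde_def)
  note JY = functor_Obj[OF J Y] and JE = functor_Obj[OF J E]
  have m: "arrow D m E (fo J Y)"
    using m_mono E JY by (simp add: is_mono_def arrow_def)
  note \<delta> = coproduct_arrow[OF Y] and Jm = functor_arrow[OF J m]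
  obtain Q i r where pb: "is_pullback D Q (fo J Y) (fo J E) (fo J (fo J Y)) i (\<delta> Y) r (fm J E (fo J Y) m)"
    and iso: "is_iso D Q E (e E \<cdot>\<^bsub>D\<^esub> r)"
    using int unfolding formally_integrable_def by auto
  have Q: "Q \<in> Obj D" and i: "arrow D i Q (fo J Y)" and r: "arrow D r Q (fo J E)"
    and comm: "\<delta> Y \<cdot>\<^bsub>D\<^esub> i = fm J E (fo J Y) m \<cdot>\<^bsub>D\<^esub> r"
    using pb JY JE by (auto simp: is_pullback_def arrow_def)
  have e: "arrow D (e E) (fo J E) E" and eJ: "arrow D (e (fo J Y)) (fo J (fo J Y)) (fo J Y)"
    using counit_arrow[OF E] counit_arrow[OF JY] by simp_all
  obtain w where w: "arrow D w E Q" and ew: "(e E \<cdot>\<^bsub>D\<^esub> r) \<cdot>\<^bsub>D\<^esub> w = Ide D E"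
    using is_isoE[OF iso Q E] by blast
  define \<rho> where "\<rho> = r \<cdot>\<^bsub>D\<^esub> w"
  have \<rho>: "arrow D \<rho> E (fo J E)"
    using arrow_Cmp[OF D w r] by (simp add: \<rho>_def)
  have counit: "e E \<cdot>\<^bsub>D\<^esub> \<rho> = Ide D E"
    using ew Cmp_assoc[OF D w r e] by (simp add: \<rho>_def)
  have "i = e (fo J Y) \<cdot>\<^bsub>D\<^esub> (\<delta> Y \<cdot>\<^bsub>D\<^esub> i)"
    using Cmp_assoc[OF D i \<delta> eJ] counit_coproduct[OF Y] Ide_Cmp[OF D i] by simp
  also have "\<dots> = (e (fo J Y) \<cdot>\<^bsub>D\<^esub> fm J E (fo J Y) m) \<cdot>\<^bsub>D\<^esub> r"
    using comm Cmp_assoc[OF D r Jm eJ] by simp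
  also have "\<dots> = m \<cdot>\<^bsub>D\<^esub> (e E \<cdot>\<^bsub>D\<^esub> r)"
    using counit_natural[OF m] Cmp_assoc[OF D r e m] by simp
  finally have "i \<cdot>\<^bsub>D\<^esub> w = m"
    using Cmp_assoc[OF D w arrow_Cmp[OF D r e] m] ew Cmp_Ide[OF D m] by simp
  then have m_comm: "\<delta> Y \<cdot>\<^bsub>D\<^esub> m = fm J E (fo J Y) m \<cdot>\<^bsub>D\<^esub> \<rho>"
    using Cmp_assoc[OF D w i \<delta>] comm Cmp_assoc[OF D w r Jm] by (simp add: \<rho>_def)
  note J\<rho> = functor_arrow[OF J \<rho>] and \<delta>E = coproduct_arrow[OF E] and \<delta>J = coproduct_arrow[OF JY]
    and JJm = functor_arrow[OF J Jm] and J\<delta> = functor_arrow[OF J \<delta>]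
  have "fm J (fo J E) (fo J (fo J Y)) (fm J E (fo J Y) m) \<cdot>\<^bsub>D\<^esub> (fm J E (fo J E) \<rho> \<cdot>\<^bsub>D\<^esub> \<rho>)
      = fm J E (fo J (fo J Y)) (\<delta> Y \<cdot>\<^bsub>D\<^esub> m) \<cdot>\<^bsub>D\<^esub> \<rho>"
    using Cmp_assoc[OF D \<rho> J\<rho> JJm] functor_Cmp[OF J \<rho> Jm] m_comm by simp
  also have "\<dots> = fm J (fo J Y) (fo J (fo J Y)) (\<delta> Y) \<cdot>\<^bsub>D\<^esub> (\<delta> Y \<cdot>\<^bsub>D\<^esub> m)"
    using functor_Cmp[OF J m \<delta>] Cmp_assoc[OF D \<rho> Jm J\<delta>] m_comm by simp
  also have "\<dots> = (\<delta> (fo J Y) \<cdot>\<^bsub>D\<^esub> \<delta> Y) \<cdot>\<^bsub>D\<^esub> m"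
    using coproduct_coassoc[OF Y] Cmp_assoc[OF D m \<delta> J\<delta>] by simp
  also have "\<dots> = (\<delta> (fo J Y) \<cdot>\<^bsub>D\<^esub> fm J E (fo J Y) m) \<cdot>\<^bsub>D\<^esub> \<rho>"
    using Cmp_assoc[OF D m \<delta> \<delta>J] m_comm Cmp_assoc[OF D \<rho> Jm \<delta>J] by simp
  also have "\<dots> = fm J (fo J E) (fo J (fo J Y)) (fm J E (fo J Y) m) \<cdot>\<^bsub>D\<^esub> (\<delta> E \<cdot>\<^bsub>D\<^esub> \<rho>)"
    using coproduct_natural[OF m] Cmp_assoc[OF D \<rho> \<delta>E JJm] by simp
  finally have eq: "fm J (fo J E) (fo J (fo J Y)) (fm J E (fo J Y) m) \<cdot>\<^bsub>D\<^esub> (fm J E (fo J E) \<rho> \<cdot>\<^bsub>D\<^esub> \<rho>)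
      = fm J (fo J E) (fo J (fo J Y)) (fm J E (fo J Y) m) \<cdot>\<^bsub>D\<^esub> (\<delta> E \<cdot>\<^bsub>D\<^esub> \<rho>)" .
  have Jm_mono: "is_mono D (fo J E) (fo J (fo J Y)) (fm J E (fo J Y) m)"
    using left.right_adjoint_preserves_mono[OF right_adjoint_preserves_mono[OF m_mono E JY]]
      functor_Obj[OF R E] functor_Obj[OF R JY] by simp
  have "fm J E (fo J E) \<rho> \<cdot>\<^bsub>D\<^esub> \<rho> = \<delta> E \<cdot>\<^bsub>D\<^esub> \<rho>"
    by (rule J_cancel_mono[OF Jm_mono JE functor_Obj[OF J JY] arrow_Cmp[OF D \<rho> J\<rho>]
          arrow_Cmp[OF D \<rho> \<delta>E] eq])
  then have "resolves E \<rho> Y m"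
    using \<rho> counit Y m_mono m_comm by (simp add: resolves_def coalgebra_def)
  then show ?thesis
    by (rule that)
qed

lemma Ide_PDE [simp]: "Ide PDEs (Y, E, m) = Ide D E"
  and Cmp_PDE [simp]: "Cmp PDEs = Cmp D"
  by (simp_all add: pde_cat_def)

lemma arrow_PDE:
  "arrow PDEs f (Y, E, m) (Y', E', m') \<longleftrightarrow> (Y, E, m) \<in> Obj PDEs \<and> (Y', E', m') \<in> Obj PDEs \<and>
     arrow D f E E' \<and> (\<forall>X s. solves (Y, E, m) X s \<longrightarrow> solves (Y', E', m') X (f \<cdot>\<^bsub>D\<^esub> s))"
  by (auto simp: pde_cat_def generalized_pde_def arrow_def)

lemma solves_arrow: "(Y, E, m) \<in> Obj PDEs \<Longrightarrow> solves (Y, E, m) X s \<Longrightarrow> arrow D s (fo T X) E"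
  using functor_Obj[OF T] by (auto simp: formal_solution_family_def pde_cat_def generalized_pde_def arrow_def)

lemma category_PDE: "category PDEs"
proof -
  have split: "\<exists>Y E m. A = (Y, E, m)" for A :: "'p \<times> 'p \<times> 'k"
    by (cases A) auto
  have Ide: "arrow PDEs (Ide PDEs A) A A" if A: "A \<in> Obj PDEs" for A
  proof -
    obtain Y E m where [simp]: "A = (Y, E, m)"
      using split by blast
    have "E \<in> Obj D"
      using A by (simp add: pde_cat_def generalized_pde_def)
    then show ?thesis
      using arrow_Ide[OF D] solves_arrow Ide_Cmp[OF D] A by (simp add: arrow_PDE) metis
  qed
  have Cmp: "arrow PDEs (g \<cdot>\<^bsub>PDEs\<^esub> f) A A''" if f: "arrow PDEs f A A'" and g: "arrow PDEs g A' A''"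
    for A A' A'' f g
  proof -
    obtain Y E m where [simp]: "A = (Y, E, m)"
      using split by blast
    obtain Y' E' m' where [simp]: "A' = (Y', E', m')"
      using split by blast
    obtain Y'' E'' m'' where [simp]: "A'' = (Y'', E'', m'')"
      using split by blast
    have "arrow D f E E'" "arrow D g E' E''"
      using f g by (simp_all add: arrow_PDE)
    then have "(g \<cdot>\<^bsub>D\<^esub> f) \<cdot>\<^bsub>D\<^esub> s = g \<cdot>\<^bsub>D\<^esub> (f \<cdot>\<^bsub>D\<^esub> s)" if "solves (Y, E, m) X s" for X s
      using Cmp_assoc[OF D solves_arrow[OF _ that]] f by (simp add: arrow_PDE)
    then show ?thesis
      using f g arrow_Cmp[OF D] by (simp add: arrow_PDE) blast
  qed
  have D_arrow: "arrow D f (fst (snd A)) (fst (snd A'))" if "arrow PDEs f A A'" for f A A'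
    using that arrow_PDE[of f] split by (metis fst_conv snd_conv)
  have Ide_fst: "Ide PDEs A = Ide D (fst (snd A))" for A
    using split[of A] by auto
  show ?thesis
    unfolding category_def
  proof (intro conjI ballI)
    show "Ide PDEs A \<in> Hom PDEs A A" if "A \<in> Obj PDEs" for A
      using Ide[OF that] by (simp add: arrow_def)
    fix A A' f assume "A \<in> Obj PDEs" "A' \<in> Obj PDEs" "f \<in> Hom PDEs A A'"
    then have f: "arrow PDEs f A A'"
      by (simp add: arrow_def)
    show "f \<cdot>\<^bsub>PDEs\<^esub> Ide PDEs A = f" "Ide PDEs A' \<cdot>\<^bsub>PDEs\<^esub> f = f"
      using Cmp_Ide[OF D D_arrow[OF f]] Ide_Cmp[OF D D_arrow[OF f]] by (simp_all add: Ide_fst)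
    fix A'' g assume "A'' \<in> Obj PDEs" "g \<in> Hom PDEs A' A''"
    then have g: "arrow PDEs g A' A''"
      using f by (simp add: arrow_def)
    show "g \<cdot>\<^bsub>PDEs\<^esub> f \<in> Hom PDEs A A''"
      using Cmp[OF f g] by (simp add: arrow_def)
    fix A3 h assume "A3 \<in> Obj PDEs" "h \<in> Hom PDEs A'' A3"
    then have h: "arrow PDEs h A'' A3"
      using g by (simp add: arrow_def)
    show "h \<cdot>\<^bsub>PDEs\<^esub> (g \<cdot>\<^bsub>PDEs\<^esub> f) = (h \<cdot>\<^bsub>PDEs\<^esub> g) \<cdot>\<^bsub>PDEs\<^esub> f"
      using Cmp_assoc[OF D D_arrow[OF f] D_arrow[OF g] D_arrow[OF h]] by simp
  qed
qed

text \<open>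
  One solution family is enough: \<open>F c\<^sub>a : T F a \<rightarrow> F a\<close>, where \<open>c\<close> is the counit of the adjunction
  of \<open>P\<close> and \<open>F\<close>, has adjunct \<open>F u\<^sub>a\<close> and restricts to the identity along the unit \<open>n\<close>. For its
  image under \<open>f\<close> the equation of a solution is the one of a coalgebra map.
\<close>

lemma preserves_solutions_coalgebra_map:
  assumes a: "a \<in> Obj C" and E': "coalgebra E' \<rho>'" and f: "arrow D f (fo F a) E'"
    and pres: "\<And>X s. solves (fo F a, fo F a, Fu a) X s \<Longrightarrow> solves (E', E', \<rho>') X (f \<cdot>\<^bsub>D\<^esub> s)"
  shows "coalgebra_map (fo F a) (Fu a) E' \<rho>' f"
proof -
  \<comment> \<open>the structure map of \<open>F a\<close> as an algebra of the monad \<open>F P\<close>\<close>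
  define \<alpha> where "\<alpha> = fm F (fo P (fo F a)) a (c a)"
  note ca = left.counit_arrow[OF a] and Fa = functor_Obj[OF F a]
  have \<alpha>: "arrow D \<alpha> (fo T (fo F a)) (fo F a)"
    using functor_arrow[OF F ca] by (simp add: \<alpha>_def)
  have n: "arrow D (n (fo F a)) (fo F a) (fo T (fo F a))"
    using left.unit_arrow[OF Fa] by simp
  have \<alpha>n: "\<alpha> \<cdot>\<^bsub>D\<^esub> n (fo F a) = Ide D (fo F a)"
    using left.triangle_right[OF a] by (simp add: \<alpha>_def)
  note u = unit_arrow[OF a]
  note Fu = functor_arrow[OF F u]
  have Fu': "arrow D (Fu a) (fo F a) (fo J (fo F a))"
    using Fu by simp
  have \<rho>': "arrow D \<rho>' E' (fo J E')"
    using E' by (simp add: coalgebra_def)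
  have "adj_J (fo F a) (fo F a) \<alpha> = fm F (fo P (fo F a)) (fo R (fo F a)) (u a \<cdot>\<^bsub>C\<^esub> c a) \<cdot>\<^bsub>D\<^esub> n (fo F a)"
    using unit_natural[OF ca] by (simp add: adjunct_def \<alpha>_def)
  also have "\<dots> = Fu a \<cdot>\<^bsub>D\<^esub> (\<alpha> \<cdot>\<^bsub>D\<^esub> n (fo F a))"
    using functor_Cmp[OF F ca u] Cmp_assoc[OF D n \<alpha> Fu'] by (simp add: \<alpha>_def)
  also have "\<dots> = Fu a"
    using \<alpha>n Cmp_Ide[OF D Fu] by simp
  finally have adj_\<alpha>: "adj_J (fo F a) (fo F a) \<alpha> = Fu a" .
  have "(Fu a \<cdot>\<^bsub>D\<^esub> \<alpha>) \<cdot>\<^bsub>D\<^esub> n (fo F a) = Fu a"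
    using Cmp_assoc[OF D n \<alpha> Fu'] \<alpha>n Cmp_Ide[OF D Fu] by simp
  then have "solves (fo F a, fo F a, Fu a) (fo F a) \<alpha>"
    using solves_iff[OF coalgebra_resolves[OF comparison_coalgebra[OF a]]] Fa \<alpha> adj_\<alpha> by simp
  then have "solves (E', E', \<rho>') (fo F a) (f \<cdot>\<^bsub>D\<^esub> \<alpha>)"
    by (rule pres)
  then have "(\<rho>' \<cdot>\<^bsub>D\<^esub> (f \<cdot>\<^bsub>D\<^esub> \<alpha>)) \<cdot>\<^bsub>D\<^esub> n (fo F a) = adj_J (fo F a) E' (f \<cdot>\<^bsub>D\<^esub> \<alpha>)"
    using solves_iff[OF coalgebra_resolves[OF E']] by simp
  moreover have "adj_J (fo F a) E' (f \<cdot>\<^bsub>D\<^esub> \<alpha>) = fm J (fo F a) E' f \<cdot>\<^bsub>D\<^esub> Fu a"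
    using adjunct_natural[OF Fa \<alpha> f] adj_\<alpha> by simp
  moreover have "(\<rho>' \<cdot>\<^bsub>D\<^esub> (f \<cdot>\<^bsub>D\<^esub> \<alpha>)) \<cdot>\<^bsub>D\<^esub> n (fo F a) = \<rho>' \<cdot>\<^bsub>D\<^esub> f"
    using Cmp_assoc[OF D n arrow_Cmp[OF D \<alpha> f] \<rho>'] Cmp_assoc[OF D n \<alpha> f] \<alpha>n Cmp_Ide[OF D f] by simp
  ultimately show ?thesis
    using f by (simp add: coalgebra_map_def)
qed

abbreviation "K \<equiv> functor_comp em_to_pde (comparison F R u)"

lemma fo_K: "fo K a = (fo F a, fo F a, Fu a)"
  and fm_K: "fm K a b f = fm F a b f"
  by (simp_all add: em_to_pde_def)

lemma coalgebra_map_arrow_PDE: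
  assumes "resolves E \<rho> Y m" and "resolves E' \<rho>' Y' m'"
    and "(Y, E, m) \<in> Obj PDEs" and "(Y', E', m') \<in> Obj PDEs" and "coalgebra_map E \<rho> E' \<rho>' f"
  shows "arrow PDEs f (Y, E, m) (Y', E', m')"
  using assms coalgebra_map_preserves_solutions[OF assms(1,2,5)]
  by (simp add: arrow_PDE coalgebra_map_def)

lemma K_functor: "is_functor C PDEs K"
proof (rule is_functorI[OF C category_PDE])
  show "fo K a \<in> Obj PDEs" if "a \<in> Obj C" for a
    using coalgebra_pde[OF comparison_coalgebra[OF that]] unfolding fo_K .
  show "fm K a b f \<in> Hom PDEs (fo K a) (fo K b)" if f: "arrow C f a b" for f a b
  proof -
    have ab: "a \<in> Obj C" "b \<in> Obj C"
      using f by (auto simp: arrow_def)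
    note coalg = comparison_coalgebra[OF ab(1)] comparison_coalgebra[OF ab(2)]
    show ?thesis
      using coalgebra_map_arrow_PDE[OF coalg[THEN coalgebra_resolves] coalg[THEN coalgebra_pde]
          comparison_coalgebra_map[OF f]]
      unfolding fo_K fm_K by (simp add: arrow_def)
  qed
qed (simp_all only: fo_K fm_K Ide_PDE Cmp_PDE functor_Ide[OF F] functor_Cmp[OF F])

theorem pde_equivalence: "is_equivalence C PDEs K"
proof (rule equivalence_if_fully_faithful_essentially_surjective[OF K_functor])
  show "fully_faithful C PDEs K"
  proof (rule fully_faithfulI[OF K_functor])
    show "f = g" if "arrow C f a b" "arrow C g a b" "fm K a b f = fm K a b g" for a b f g
      using that comparison_fully_faithful
      unfolding fm_K fm_comparison fully_faithful_def bij_betw_def inj_on_def arrow_def by blast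
  next
    fix a b g assume a: "a \<in> Obj C" and b: "b \<in> Obj C" and "g \<in> Hom PDEs (fo K a) (fo K b)"
    then have g: "arrow PDEs g (fo F a, fo F a, Fu a) (fo F b, fo F b, Fu b)"
      using functor_Obj[OF K_functor a] functor_Obj[OF K_functor b] unfolding fo_K by (simp add: arrow_def)
    have "coalgebra_map (fo F a) (Fu a) (fo F b) (Fu b) g"
      using preserves_solutions_coalgebra_map[OF a comparison_coalgebra[OF b]] g by (simp add: arrow_PDE)
    then have "arrow EM g (fo (comparison F R u) a) (fo (comparison F R u) b)"
      using comparison_coalgebra a b by (simp add: arrow_EM)
    then have "g \<in> fm (comparison F R u) a b ` Hom C a b"
      using comparison_fully_faithful a b by (auto simp: fully_faithful_def bij_betw_def arrow_def)
    then show "\<exists>f\<in>Hom C a b. fm K a b f = g"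
      unfolding fm_K by auto
  qed
  show "essentially_surjective C PDEs K"
    unfolding essentially_surjective_def
  proof clarify
    fix Y E m assume pde: "(Y, E, m) \<in> Obj PDEs"
    then obtain \<rho> where res: "resolves E \<rho> Y m"
      by (rule pde_resolves)
    then have E: "coalgebra E \<rho>"
      by (simp add: resolves_def)
    then obtain a f where a: "a \<in> Obj C" and iso: "is_iso EM (fo (comparison F R u) a) (E, \<rho>) f"
      using comparison_essentially_surjective Obj_EM unfolding essentially_surjective_def by blast
    note coalg = comparison_coalgebra[OF a]
    obtain g where "arrow EM f (fo F a, Fu a) (E, \<rho>)" and "arrow EM g (E, \<rho>) (fo F a, Fu a)"
      and inv: "g \<cdot>\<^bsub>D\<^esub> f = Ide D (fo F a)" "f \<cdot>\<^bsub>D\<^esub> g = Ide D E"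
      using is_isoE[OF iso] functor_Obj[OF comparison_functor a] E by (auto simp: Obj_EM)
    then have f: "coalgebra_map (fo F a) (Fu a) E \<rho> f" and g: "coalgebra_map E \<rho> (fo F a) (Fu a) g"
      by (auto simp: arrow_EM)
    have "is_iso PDEs (fo K a) (Y, E, m) f"
      unfolding fo_K
      by (rule is_isoI[OF coalgebra_map_arrow_PDE[OF coalgebra_resolves[OF coalg] res coalgebra_pde[OF coalg] pde f]
            coalgebra_map_arrow_PDE[OF res coalgebra_resolves[OF coalg] pde coalgebra_pde[OF coalg] g]])
        (simp_all add: inv)
    then show "\<exists>a\<in>Obj C. \<exists>f. is_iso PDEs (fo K a) (Y, E, m) f"
      using a by blast
  qed
qed

end


section \<open>Sheaves over a fixed sheaf\<close>

text \<open>
  The sheaf condition refers to the restrictions along the members of a cover; naturality is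
  available for these only if they are arrows of the site.
\<close>

definition covers_by_arrows :: "('o, 'm) cat \<Rightarrow> ('o \<Rightarrow> ('o \<times> 'm) set set) \<Rightarrow> bool" where
  "covers_by_arrows S K \<longleftrightarrow>
     (\<forall>c \<in> Obj S. \<forall>R \<in> K c. \<forall>(d, f) \<in> R. d \<in> Obj S \<and> f \<in> Hom S d c)"

lemma op_cat_simps [simp]:
  "Obj (op_cat S) = Obj S" "Hom (op_cat S) a b = Hom S b a" "Ide (op_cat S) = Ide S"
  "Cmp (op_cat S) g f = Cmp S f g"
  by (simp_all add: op_cat_def)

lemma Sets_simps [simp]:
  "A \<in> Obj Sets \<longleftrightarrow> small A" "f \<in> Hom Sets A B \<longleftrightarrow> dom f = A \<and> ran f \<subseteq> B"
  "Ide Sets A = Some |` A" "Cmp Sets g f = g \<circ>\<^sub>m f"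
  by (simp_all add: Sets_def)

lemma Sheaves_simps [simp]:
  "X \<in> Obj (Sheaves S K) \<longleftrightarrow> is_sheaf S K X"
  "Ide (Sheaves S K) X = (\<lambda>c. if c \<in> Obj S then Some |` fo X c else Map.empty)"
  "Cmp (Sheaves S K) \<beta> \<alpha> = (\<lambda>c. \<beta> c \<circ>\<^sub>m \<alpha> c)"
  by (simp_all add: Sheaves_def)

lemma slice_simps [simp]:
  "(E, p) \<in> Obj (slice C b) \<longleftrightarrow> E \<in> Obj C \<and> p \<in> Hom C E b"
  "f \<in> Hom (slice C b) (E, p) (E', p') \<longleftrightarrow> f \<in> Hom C E E' \<and> p' \<cdot>\<^bsub>C\<^esub> f = p"
  "Ide (slice C b) (E, p) = Ide C E" "Cmp (slice C b) = Cmp C"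
  by (simp_all add: slice_def)

lemma map_comp_assoc: "h \<circ>\<^sub>m (g \<circ>\<^sub>m f) = (h \<circ>\<^sub>m g) \<circ>\<^sub>m f"
  by (simp add: map_comp_def fun_eq_iff split: option.splits)

lemma sheaf_functor: "is_sheaf S K X \<Longrightarrow> is_functor (op_cat S) Sets X"
  by (simp add: is_sheaf_def)

lemma restriction_SomeD:
  assumes "is_functor (op_cat S) Sets X" and "c \<in> Obj S" and "d \<in> Obj S" and "h \<in> Hom S d c"
    and "fm X c d h s = Some t"
  shows "s \<in> fo X c" and "t \<in> fo X d"
proof -
  have "dom (fm X c d h) = fo X c" and "ran (fm X c d h) \<subseteq> fo X d"
    using assms(1-4) by (simp_all add: is_functor_def)
  then show "s \<in> fo X c" and "t \<in> fo X d"
    using assms(5) by (auto simp: dom_def ran_def)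
qed

lemma restriction_defined:
  assumes "is_functor (op_cat S) Sets X" and "c \<in> Obj S" and "d \<in> Obj S" and "h \<in> Hom S d c"
    and "s \<in> fo X c"
  obtains t where "fm X c d h s = Some t" and "t \<in> fo X d"
proof -
  have "dom (fm X c d h) = fo X c"
    using assms by (simp add: is_functor_def)
  then obtain t where "fm X c d h s = Some t"
    using assms(5) by auto
  then show thesis
    using that restriction_SomeD[OF assms(1-4)] by blast
qed

lemma restriction_Cmp:
  assumes "is_functor (op_cat S) Sets X" and "c \<in> Obj S" and "d \<in> Obj S" and "e \<in> Obj S"
    and "h \<in> Hom S d c" and "k \<in> Hom S e d"
  shows "fm X c e (h \<cdot>\<^bsub>S\<^esub> k) = fm X d e k \<circ>\<^sub>m fm X c d h"
  using assms unfolding is_functor_def by (simp add: op_cat_def)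

lemma restriction_Ide:
  assumes "is_functor (op_cat S) Sets X" and "c \<in> Obj S"
  shows "fm X c c (Ide S c) = Some |` fo X c"
  using assms by (simp add: is_functor_def)

lemma sheaf_map_SomeD:
  assumes "\<alpha> \<in> Hom (Sheaves S K) X Y" and "\<alpha> c s = Some t"
  shows "c \<in> Obj S" and "s \<in> fo X c" and "t \<in> fo Y c"
proof -
  show c: "c \<in> Obj S"
    using assms by (auto simp: Sheaves_def)
  show "s \<in> fo X c" and "t \<in> fo Y c"
    using assms c by (auto simp: Sheaves_def nat_trans_def dom_def ran_def)
qed

lemma sheaf_map_defined:
  assumes "\<alpha> \<in> Hom (Sheaves S K) X Y" and "c \<in> Obj S" and "s \<in> fo X c"
  obtains t where "\<alpha> c s = Some t" and "t \<in> fo Y c"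
proof -
  have "dom (\<alpha> c) = fo X c"
    using assms by (simp add: Sheaves_def nat_trans_def)
  then obtain t where "\<alpha> c s = Some t"
    using assms(3) by auto
  then show thesis
    using that sheaf_map_SomeD[OF assms(1)] by blast
qed

lemma sheaf_map_natural:
  assumes "\<alpha> \<in> Hom (Sheaves S K) X Y" and "c \<in> Obj S" and "d \<in> Obj S" and "h \<in> Hom S d c"
    and "\<alpha> c s = Some t" and "fm X c d h s = Some s'"
  shows "fm Y c d h t = \<alpha> d s'"
proof -
  have "\<alpha> d \<circ>\<^sub>m fm X c d h = fm Y c d h \<circ>\<^sub>m \<alpha> c"
    using assms by (simp add: Sheaves_def nat_trans_def)
  from fun_cong[OF this, of s] show ?thesis
    using assms by simp
qed

lemma sheaf_mapI:
  assumes X: "is_functor (op_cat S) Sets X"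
    and dom: "\<And>c. c \<in> Obj S \<Longrightarrow> dom (\<alpha> c) = fo X c"
    and ran: "\<And>c s t. c \<in> Obj S \<Longrightarrow> \<alpha> c s = Some t \<Longrightarrow> t \<in> fo Y c"
    and empty: "\<And>c. c \<notin> Obj S \<Longrightarrow> \<alpha> c = Map.empty"
    and nat: "\<And>c d h s t s'. c \<in> Obj S \<Longrightarrow> d \<in> Obj S \<Longrightarrow> h \<in> Hom S d c \<Longrightarrow> \<alpha> c s = Some t \<Longrightarrow>
                fm X c d h s = Some s' \<Longrightarrow> fm Y c d h t = \<alpha> d s'"
  shows "\<alpha> \<in> Hom (Sheaves S K) X Y"
proof -
  have "(\<alpha> d \<circ>\<^sub>m fm X c d h) s = (fm Y c d h \<circ>\<^sub>m \<alpha> c) s"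
    if c: "c \<in> Obj S" "d \<in> Obj S" "h \<in> Hom S d c" for c d h s
  proof (cases "s \<in> fo X c")
    case True
    then obtain t where "\<alpha> c s = Some t"
      using dom[OF c(1)] by blast
    moreover obtain s' where "fm X c d h s = Some s'"
      using restriction_defined[OF X c True] by blast
    ultimately show ?thesis
      using nat[OF c] by simp
  next
    case False
    then have "\<alpha> c s = None"
      using dom[OF c(1)] by auto
    moreover have "fm X c d h s = None"
      using restriction_SomeD[OF X c] False by (cases "fm X c d h s") auto
    ultimately show ?thesis
      by simp
  qed
  then have "\<alpha> d \<circ>\<^sub>m fm X c d h = fm Y c d h \<circ>\<^sub>m \<alpha> c"
    if "c \<in> Obj S" "d \<in> Obj S" "h \<in> Hom S d c" for c d h
    using that by blast
  then show ?thesis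
    using dom ran empty by (auto simp: Sheaves_def nat_trans_def ran_def)
qed

subsection \<open>Equalizers\<close>

definition eq_sheaf ::
  "('o, 'm, 'u) psh \<Rightarrow> ('o, 'u) psh_map \<Rightarrow> ('o, 'u::set_universe) psh_map \<Rightarrow> ('o, 'm, 'u) psh" where
  "eq_sheaf X \<alpha> \<beta> =
     \<lparr>fo = (\<lambda>c. {s \<in> fo X c. \<alpha> c s = \<beta> c s}),
      fm = (\<lambda>c d h. fm X c d h |` {s \<in> fo X c. \<alpha> c s = \<beta> c s})\<rparr>"

text \<open>
  The unique amalgamation in \<open>X\<close> of a matching family of the equalizer lies in the equalizer, since
  its two images in \<open>Y\<close> agree on the cover. That needs naturality along the members of the cover.
\<close>

lemma is_sheaf_eq_sheaf:
  assumes cov: "covers_by_arrows S K" and X: "is_sheaf S K X" and Y: "is_sheaf S K Y"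
    and \<alpha>: "\<alpha> \<in> Hom (Sheaves S K) X Y" and \<beta>: "\<beta> \<in> Hom (Sheaves S K) X Y"
  shows "is_sheaf S K (eq_sheaf X \<alpha> \<beta>)"
proof -
  note FX = sheaf_functor[OF X]
  have restr: "\<alpha> d t = \<beta> d t" if c: "c \<in> Obj S" "d \<in> Obj S" "h \<in> Hom S d c"
    and s: "\<alpha> c s = \<beta> c s" and st: "fm X c d h s = Some t" for c d h s t
  proof -
    obtain y where y: "\<alpha> c s = Some y"
      using sheaf_map_defined[OF \<alpha> c(1) restriction_SomeD(1)[OF FX c st]] by blast
    then show ?thesis
      using sheaf_map_natural[OF \<alpha> c y st] sheaf_map_natural[OF \<beta> c _ st, of y] s by simp
  qed
  show ?thesis
    unfolding is_sheaf_def
  proof (intro conjI ballI allI impI)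
    show "is_functor (op_cat S) Sets (eq_sheaf X \<alpha> \<beta>)"
    proof (rule is_functorI)
      show "category (op_cat S)" "category (Sets :: ('c set, 'c \<rightharpoonup> 'c) cat)"
        using FX by (simp_all add: is_functor_def)
      show "fo (eq_sheaf X \<alpha> \<beta>) c \<in> Obj Sets" if "c \<in> Obj (op_cat S)" for c
        using functor_Obj[OF FX that] small_subset[of "fo X c"] by (simp add: eq_sheaf_def)
      show "fm (eq_sheaf X \<alpha> \<beta>) c c (Ide (op_cat S) c) = Ide Sets (fo (eq_sheaf X \<alpha> \<beta>) c)"
        if "c \<in> Obj (op_cat S)" for c
        using restriction_Ide[OF FX, of c] that by (auto simp: eq_sheaf_def restrict_map_def)
    next
      fix h c d assume "arrow (op_cat S) h c d"
      then have c: "c \<in> Obj S" "d \<in> Obj S" "h \<in> Hom S d c"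
        by (auto simp: arrow_def)
      show "fm (eq_sheaf X \<alpha> \<beta>) c d h \<in> Hom Sets (fo (eq_sheaf X \<alpha> \<beta>) c) (fo (eq_sheaf X \<alpha> \<beta>) d)"
        using restr[OF c] restriction_SomeD[OF FX c] restriction_defined[OF FX c]
        by (auto simp: eq_sheaf_def ran_def restrict_map_def dom_def split: if_splits) metis
      fix k e assume "arrow (op_cat S) k d e"
      then have e: "e \<in> Obj S" "k \<in> Hom S e d"
        by (auto simp: arrow_def)
      show "fm (eq_sheaf X \<alpha> \<beta>) c e (k \<cdot>\<^bsub>op_cat S\<^esub> h)
          = fm (eq_sheaf X \<alpha> \<beta>) d e k \<cdot>\<^bsub>Sets\<^esub> fm (eq_sheaf X \<alpha> \<beta>) c d h"
      proof
        fix s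
        show "fm (eq_sheaf X \<alpha> \<beta>) c e (k \<cdot>\<^bsub>op_cat S\<^esub> h) s
          = (fm (eq_sheaf X \<alpha> \<beta>) d e k \<cdot>\<^bsub>Sets\<^esub> fm (eq_sheaf X \<alpha> \<beta>) c d h) s"
        proof (cases "s \<in> fo X c \<and> \<alpha> c s = \<beta> c s")
          case True
          then obtain t where t: "fm X c d h s = Some t" "t \<in> fo X d"
            using restriction_defined[OF FX c] by blast
          then show ?thesis
            using True restr[OF c _ t(1)] restriction_Cmp[OF FX c(1,2) e(1) c(3) e(2)]
            by (simp add: eq_sheaf_def)
        next
          case False
          then show ?thesis
            by (auto simp: eq_sheaf_def restrict_map_def map_comp_def)
        qed
      qed
    qed
  next
    fix c R x assume c: "c \<in> Obj S" and R: "R \<in> K c"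
      and x: "matching_family S (eq_sheaf X \<alpha> \<beta>) c R x"
    have arr: "d \<in> Obj S" "h \<in> Hom S d c" if "(d, h) \<in> R" for d h
      using bspec[OF bspec[OF bspec[OF cov[unfolded covers_by_arrows_def] c] R] that] by auto
    have x_in: "x (d, h) \<in> fo X d" "\<alpha> d (x (d, h)) = \<beta> d (x (d, h))" if "(d, h) \<in> R" for d h
      using x that by (auto simp: matching_family_def eq_sheaf_def)
    have x_comp: "fm X d a g (x (d, h)) = fm X d' a g' (x (d', h'))"
      if R: "(d, h) \<in> R" "(d', h') \<in> R" and "a \<in> Obj S" "g \<in> Hom S a d" "g' \<in> Hom S a d'"
        "h \<cdot>\<^bsub>S\<^esub> g = h' \<cdot>\<^bsub>S\<^esub> g'" for d h d' h' a g g'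
    proof -
      have "fm (eq_sheaf X \<alpha> \<beta>) d a g (x (d, h)) = fm (eq_sheaf X \<alpha> \<beta>) d' a g' (x (d', h'))"
        using x that unfolding matching_family_def by blast
      then show ?thesis
        using x_in[OF R(1)] x_in[OF R(2)] by (simp add: eq_sheaf_def)
    qed
    have xX: "matching_family S X c R x"
      using x_in x_comp unfolding matching_family_def by blast
    have "\<exists>!s. s \<in> fo X c \<and> (\<forall>(d, h)\<in>R. fm X c d h s = Some (x (d, h)))"
      using X c R xX unfolding is_sheaf_def by blast
    then obtain s where s_all: "s \<in> fo X c \<and> (\<forall>(d, h)\<in>R. fm X c d h s = Some (x (d, h)))"
      and s_uniq: "\<And>s'. s' \<in> fo X c \<and> (\<forall>(d, h)\<in>R. fm X c d h s' = Some (x (d, h))) \<Longrightarrow> s' = s"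
      by (elim ex1E) blast
    have s_in: "s \<in> fo X c"
      using s_all by simp
    have s: "fm X c d h s = Some (x (d, h))" if "(d, h) \<in> R" for d h
      using s_all that by auto
    define y where "y = (\<lambda>(d, h). the (\<alpha> d (x (d, h))))"
    have y: "\<alpha> d (x (d, h)) = Some (y (d, h))" "y (d, h) \<in> fo Y d" if R: "(d, h) \<in> R" for d h
    proof -
      obtain t where "\<alpha> d (x (d, h)) = Some t" "t \<in> fo Y d"
        using sheaf_map_defined[OF \<alpha> arr(1)[OF R] x_in(1)[OF R]] by blast
      then show "\<alpha> d (x (d, h)) = Some (y (d, h))" "y (d, h) \<in> fo Y d"
        by (simp_all add: y_def)
    qed
    have yY: "matching_family S Y c R y"
      unfolding matching_family_def
    proof (intro conjI; clarify)
      fix d h assume "(d, h) \<in> R"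
      then show "y (d, h) \<in> fo Y d"
        by (rule y)
    next
      fix d h d' h' a g g'
      assume R: "(d, h) \<in> R" "(d', h') \<in> R" and a: "a \<in> Obj S" "g \<in> Hom S a d" "g' \<in> Hom S a d'"
        and eq: "h \<cdot>\<^bsub>S\<^esub> g = h' \<cdot>\<^bsub>S\<^esub> g'"
      obtain t where t: "fm X d a g (x (d, h)) = Some t"
        using restriction_defined[OF FX arr(1)[OF R(1)] a(1,2) x_in(1)[OF R(1)]] by blast
      have t': "fm X d' a g' (x (d', h')) = Some t"
        using x_comp[OF R a eq] t by simp
      show "fm Y d a g (y (d, h)) = fm Y d' a g' (y (d', h'))"
        using sheaf_map_natural[OF \<alpha> arr(1)[OF R(1)] a(1,2) y(1)[OF R(1)] t]
          sheaf_map_natural[OF \<alpha> arr(1)[OF R(2)] a(1,3) y(1)[OF R(2)] t'] by simp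
    qed
    obtain t where t: "\<alpha> c s = Some t" "t \<in> fo Y c"
      using sheaf_map_defined[OF \<alpha> c s_in] by blast
    obtain t' where t': "\<beta> c s = Some t'" "t' \<in> fo Y c"
      using sheaf_map_defined[OF \<beta> c s_in] by blast
    have "fm Y c d h t = Some (y (d, h))" "fm Y c d h t' = Some (y (d, h))" if dh: "(d, h) \<in> R" for d h
      using sheaf_map_natural[OF \<alpha> c arr[OF dh] t(1) s[OF dh]]
        sheaf_map_natural[OF \<beta> c arr[OF dh] t'(1) s[OF dh]] y(1)[OF dh] x_in(2)[OF dh] by simp_all
    then have "\<forall>(d, h)\<in>R. fm Y c d h t = Some (y (d, h))" "\<forall>(d, h)\<in>R. fm Y c d h t' = Some (y (d, h))"
      by blast+
    moreover have "\<exists>!t. t \<in> fo Y c \<and> (\<forall>(d, h)\<in>R. fm Y c d h t = Some (y (d, h)))"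
      using Y c R yY unfolding is_sheaf_def by blast
    ultimately have "t = t'"
      using t(2) t'(2) by blast
    then have s_eq: "\<alpha> c s = \<beta> c s"
      using t t' by simp
    show "\<exists>!s. s \<in> fo (eq_sheaf X \<alpha> \<beta>) c \<and> (\<forall>(d, h)\<in>R. fm (eq_sheaf X \<alpha> \<beta>) c d h s = Some (x (d, h)))"
    proof (rule ex1I[of _ s])
      show "s \<in> fo (eq_sheaf X \<alpha> \<beta>) c \<and> (\<forall>(d, h)\<in>R. fm (eq_sheaf X \<alpha> \<beta>) c d h s = Some (x (d, h)))"
        using s_all s_eq by (auto simp: eq_sheaf_def)
      fix s' assume "s' \<in> fo (eq_sheaf X \<alpha> \<beta>) c
        \<and> (\<forall>(d, h)\<in>R. fm (eq_sheaf X \<alpha> \<beta>) c d h s' = Some (x (d, h)))"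
      then show "s' = s"
        by (intro s_uniq) (auto simp: eq_sheaf_def)
    qed
  qed
qed

lemma slice_Sheaves_has_equalizers:
  assumes cov: "covers_by_arrows S K"
  shows "has_equalizers (slice (Sheaves S K) B)"
  unfolding has_equalizers_def
proof (intro allI impI; elim conjE)
  fix A A' f g assume fg: "arrow (slice (Sheaves S K) B) f A A'" "arrow (slice (Sheaves S K) B) g A A'"
  obtain X p Y q where A: "A = (X, p)" "A' = (Y, q)"
    by (cases A, cases A') auto
  have X: "is_sheaf S K X" and Y: "is_sheaf S K Y" and p: "p \<in> Hom (Sheaves S K) X B"
    and f: "f \<in> Hom (Sheaves S K) X Y" and g: "g \<in> Hom (Sheaves S K) X Y"
    using fg by (auto simp: A arrow_def)
  define L where "L = eq_sheaf X f g"
  define i where "i = (\<lambda>c. if c \<in> Obj S then Some |` fo L c else Map.empty)"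
  have L: "is_sheaf S K L"
    unfolding L_def by (rule is_sheaf_eq_sheaf[OF cov X Y f g])
  have fo_L: "s \<in> fo L c \<longleftrightarrow> s \<in> fo X c \<and> f c s = g c s" for s c
    by (simp add: L_def eq_sheaf_def)
  have fm_L: "fm L c d h s = fm X c d h s" if "s \<in> fo L c" for c d h s
    using that by (simp add: L_def eq_sheaf_def)
  have i_Some: "i c s = Some t \<longleftrightarrow> c \<in> Obj S \<and> s \<in> fo L c \<and> t = s" for c s t
    by (auto simp: i_def restrict_map_def)
  have i: "i \<in> Hom (Sheaves S K) L X"
  proof (rule sheaf_mapI[OF sheaf_functor[OF L]])
    show "dom (i c) = fo L c" if "c \<in> Obj S" for c
      using that by (auto simp: i_def)
    show "fm X c d h t = i d s'"
      if c: "c \<in> Obj S" "d \<in> Obj S" "h \<in> Hom S d c" and s: "i c s = Some t"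
        and s': "fm L c d h s = Some s'" for c d h s t s'
    proof -
    have "i d s' = Some s'"
      using restriction_SomeD[OF sheaf_functor[OF L] c s'] c by (simp add: i_Some)
    moreover have "s \<in> fo L c" "t = s"
      using s i_Some by auto
    ultimately show ?thesis
      using fm_L s' by simp
    qed
    show "t \<in> fo X c" if "i c s = Some t" for c s t
      using that by (simp add: i_Some fo_L)
  qed (simp add: i_def)
  have pi: "(\<lambda>c. p c \<circ>\<^sub>m i c) \<in> Hom (Sheaves S K) L B"
  proof (rule sheaf_mapI[OF sheaf_functor[OF L]])
    show "dom (p c \<circ>\<^sub>m i c) = fo L c" if "c \<in> Obj S" for c
      using that sheaf_map_defined[OF p that] fo_L i_Some
      by (auto simp: dom_def map_comp_Some_iff) metis
    show "t \<in> fo B c" if "(p c \<circ>\<^sub>m i c) s = Some t" for c s t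
      using that sheaf_map_SomeD[OF p] by (auto simp: map_comp_Some_iff)
    show "p c \<circ>\<^sub>m i c = Map.empty" if "c \<notin> Obj S" for c
      using that by (simp add: i_def)
    fix c d h s t s' assume c: "c \<in> Obj S" "d \<in> Obj S" "h \<in> Hom S d c"
      and s: "(p c \<circ>\<^sub>m i c) s = Some t" and s': "fm L c d h s = Some s'"
    then have "i c s = Some s" "p c s = Some t" "s \<in> fo L c"
      by (auto simp: map_comp_Some_iff i_Some)
    moreover have "i d s' = Some s'"
      using restriction_SomeD[OF sheaf_functor[OF L] c s'] c by (simp add: i_Some)
    ultimately show "fm B c d h t = (p d \<circ>\<^sub>m i d) s'"
      using sheaf_map_natural[OF p c] s' fm_L by simp
  qed
  have "is_equalizer (slice (Sheaves S K) B) (L, \<lambda>c. p c \<circ>\<^sub>m i c) A A' i f g"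
    unfolding is_equalizer_def
  proof (intro conjI allI impI)
    show "arrow (slice (Sheaves S K) B) i (L, \<lambda>c. p c \<circ>\<^sub>m i c) A"
      using fg L pi i by (simp add: arrow_def A)
    show "f \<cdot>\<^bsub>slice (Sheaves S K) B\<^esub> i = g \<cdot>\<^bsub>slice (Sheaves S K) B\<^esub> i"
      using fo_L by (auto simp: fun_eq_iff map_comp_def i_def restrict_map_def)
    fix Zr k assume k_asm: "arrow (slice (Sheaves S K) B) k Zr A
      \<and> f \<cdot>\<^bsub>slice (Sheaves S K) B\<^esub> k = g \<cdot>\<^bsub>slice (Sheaves S K) B\<^esub> k"
    obtain Z r where Zr: "Zr = (Z, r)"
      by (cases Zr) auto
    have Z: "is_sheaf S K Z" and r: "r \<in> Hom (Sheaves S K) Z B" and k: "k \<in> Hom (Sheaves S K) Z X"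
      and pk: "(\<lambda>c. p c \<circ>\<^sub>m k c) = r" and eq: "(\<lambda>c. f c \<circ>\<^sub>m k c) = (\<lambda>c. g c \<circ>\<^sub>m k c)"
      using k_asm by (auto simp: arrow_def Zr A)
    have k_in: "t \<in> fo L c" if "k c s = Some t" for c s t
      using fun_cong[OF fun_cong[OF eq, of c], of s] that sheaf_map_SomeD[OF k that] by (simp add: fo_L)
    have kL: "k \<in> Hom (Sheaves S K) Z L"
    proof (rule sheaf_mapI[OF sheaf_functor[OF Z]])
      show "dom (k c) = fo Z c" if "c \<in> Obj S" for c
        using sheaf_map_defined[OF k that] sheaf_map_SomeD[OF k] by (auto simp: dom_def) metis
      show "k c = Map.empty" if "c \<notin> Obj S" for c
        using k that by (simp add: Sheaves_def)
      show "fm L c d h t = k d s'" if "c \<in> Obj S" "d \<in> Obj S" "h \<in> Hom S d c" "k c s = Some t"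
        "fm Z c d h s = Some s'" for c d h s t s'
        using sheaf_map_natural[OF k that] fm_L k_in that by simp
    qed (rule k_in)
    have i_comp: "(\<lambda>c. i c \<circ>\<^sub>m j c) = j" if j: "j \<in> Hom (Sheaves S K) Z L" for j
    proof (intro ext)
      fix c s
      show "(i c \<circ>\<^sub>m j c) s = j c s"
        using sheaf_map_SomeD[OF j, of c s] by (cases "j c s") (simp_all add: i_Some)
    qed
    show "\<exists>!h. arrow (slice (Sheaves S K) B) h Zr (L, \<lambda>c. p c \<circ>\<^sub>m i c) \<and> i \<cdot>\<^bsub>slice (Sheaves S K) B\<^esub> h = k"
    proof (rule ex1I[of _ k])
      have "(\<lambda>c. (p c \<circ>\<^sub>m i c) \<circ>\<^sub>m k c) = r"
        using fun_cong[OF i_comp[OF kL]] pk by (simp add: map_comp_assoc[symmetric])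
      then show "arrow (slice (Sheaves S K) B) k Zr (L, \<lambda>c. p c \<circ>\<^sub>m i c)
        \<and> i \<cdot>\<^bsub>slice (Sheaves S K) B\<^esub> k = k"
        using kL i_comp[OF kL] Z r L pi by (simp add: arrow_def Zr)
      fix h assume "arrow (slice (Sheaves S K) B) h Zr (L, \<lambda>c. p c \<circ>\<^sub>m i c)
        \<and> i \<cdot>\<^bsub>slice (Sheaves S K) B\<^esub> h = k"
      then show "h = k"
        using i_comp[of h] by (simp add: arrow_def Zr)
    qed
  qed
  then show "\<exists>l i. is_equalizer (slice (Sheaves S K) B) l A A' i f g"
    by blast
qed


subsection \<open>Base change along a surjective map\<close>

lemma sheaf_map_Cmp:
  assumes X: "is_functor (op_cat S) Sets X"
    and \<alpha>: "\<alpha> \<in> Hom (Sheaves S K) X Y" and \<beta>: "\<beta> \<in> Hom (Sheaves S K) Y Z"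
  shows "(\<lambda>c. \<beta> c \<circ>\<^sub>m \<alpha> c) \<in> Hom (Sheaves S K) X Z"
proof (rule sheaf_mapI[OF X])
  show "dom (\<beta> c \<circ>\<^sub>m \<alpha> c) = fo X c" if "c \<in> Obj S" for c
    using sheaf_map_defined[OF \<alpha> that] sheaf_map_defined[OF \<beta> that] sheaf_map_SomeD[OF \<alpha>]
    by (auto simp: dom_def map_comp_Some_iff) metis
  show "t \<in> fo Z c" if "(\<beta> c \<circ>\<^sub>m \<alpha> c) s = Some t" for c s t
    using that sheaf_map_SomeD[OF \<beta>] by (auto simp: map_comp_Some_iff)
  show "\<beta> c \<circ>\<^sub>m \<alpha> c = Map.empty" if "c \<notin> Obj S" for c
    using that \<alpha> by (simp add: Sheaves_def)
  fix c d h s t s' assume c: "c \<in> Obj S" "d \<in> Obj S" "h \<in> Hom S d c"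
    and st: "(\<beta> c \<circ>\<^sub>m \<alpha> c) s = Some t" and s': "fm X c d h s = Some s'"
  obtain y where y: "\<alpha> c s = Some y" "\<beta> c y = Some t"
    using st by (auto simp: map_comp_Some_iff)
  obtain y' where y': "\<alpha> d s' = Some y'"
    using sheaf_map_defined[OF \<alpha> c(2) restriction_SomeD(2)[OF X c s']] by blast
  show "fm Z c d h t = (\<beta> d \<circ>\<^sub>m \<alpha> d) s'"
    using sheaf_map_natural[OF \<alpha> c y(1) s'] sheaf_map_natural[OF \<beta> c y(2)] y' by simp
qed

lemma sheaf_map_bijective_iso:
  assumes X: "is_functor (op_cat S) Sets X" and Y: "is_functor (op_cat S) Sets Y"
    and \<alpha>: "\<alpha> \<in> Hom (Sheaves S K) X Y"
    and inj: "\<And>c s s' t. \<alpha> c s = Some t \<Longrightarrow> \<alpha> c s' = Some t \<Longrightarrow> s = s'"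
    and surj: "\<And>c t. c \<in> Obj S \<Longrightarrow> t \<in> fo Y c \<Longrightarrow> \<exists>s. \<alpha> c s = Some t"
  obtains \<beta> where "\<beta> \<in> Hom (Sheaves S K) Y X"
    and "\<beta> \<cdot>\<^bsub>Sheaves S K\<^esub> \<alpha> = Ide (Sheaves S K) X" and "\<alpha> \<cdot>\<^bsub>Sheaves S K\<^esub> \<beta> = Ide (Sheaves S K) Y"
proof
  define \<beta> where "\<beta> = (\<lambda>c t. if \<exists>s. \<alpha> c s = Some t then Some (SOME s. \<alpha> c s = Some t) else None)"
  have \<beta>: "\<beta> c t = Some s \<longleftrightarrow> \<alpha> c s = Some t" for c s t
    using inj by (auto simp: \<beta>_def intro: someI_ex some_equality)
  show "\<beta> \<in> Hom (Sheaves S K) Y X"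
  proof (rule sheaf_mapI[OF Y])
    show "dom (\<beta> c) = fo Y c" if "c \<in> Obj S" for c
      using surj[OF that] sheaf_map_SomeD[OF \<alpha>] by (auto simp: dom_def \<beta>)
    show "s \<in> fo X c" if "\<beta> c t = Some s" for c s t
      using that sheaf_map_SomeD[OF \<alpha>] by (auto simp: \<beta>)
    show "\<beta> c = Map.empty" if "c \<notin> Obj S" for c
      using that \<alpha> by (simp add: Sheaves_def \<beta>_def)
    fix c d h t s t' assume c: "c \<in> Obj S" "d \<in> Obj S" "h \<in> Hom S d c"
      and "\<beta> c t = Some s" and t': "fm Y c d h t = Some t'"
    then have s: "\<alpha> c s = Some t"
      by (simp add: \<beta>)
    obtain s' where s': "fm X c d h s = Some s'"
      using restriction_defined[OF X c sheaf_map_SomeD(2)[OF \<alpha> s]] by blast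
    then have "\<beta> d t' = Some s'"
      using sheaf_map_natural[OF \<alpha> c s s'] t' by (simp add: \<beta>)
    then show "fm X c d h s = \<beta> d t'"
      using s' by simp
  qed
  have "(\<beta> c \<circ>\<^sub>m \<alpha> c) s = Ide (Sheaves S K) X c s" for c s
  proof (cases "c \<in> Obj S \<and> s \<in> fo X c")
    case True
    then obtain t where "\<alpha> c s = Some t"
      using sheaf_map_defined[OF \<alpha>] by blast
    then show ?thesis
      using True \<beta>[of c t s] by simp
  next
    case False
    then have "\<alpha> c s = None"
      using sheaf_map_SomeD[OF \<alpha>] by (cases "\<alpha> c s") auto
    then show ?thesis
      using False by auto
  qed
  then show "\<beta> \<cdot>\<^bsub>Sheaves S K\<^esub> \<alpha> = Ide (Sheaves S K) X"
    by (auto simp only: Sheaves_simps fun_eq_iff)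
  have "(\<alpha> c \<circ>\<^sub>m \<beta> c) t = Ide (Sheaves S K) Y c t" for c t
  proof (cases "c \<in> Obj S \<and> t \<in> fo Y c")
    case True
    then obtain s where s: "\<alpha> c s = Some t"
      using surj by blast
    then show ?thesis
      using True \<beta>[of c t s] by simp
  next
    case False
    then have "\<beta> c t = None"
      using sheaf_map_SomeD[OF \<alpha>] \<beta> by (metis option.exhaust)
    then show ?thesis
      using False by auto
  qed
  then show "\<alpha> \<cdot>\<^bsub>Sheaves S K\<^esub> \<beta> = Ide (Sheaves S K) Y"
    by (auto simp only: Sheaves_simps fun_eq_iff)
qed

lemma unpair_upair [simp]: "unpair (upair z) = z"
  by (simp add: unpair_def inj_upair)

lemma upair_eq_iff [simp]: "upair z = upair w \<longleftrightarrow> z = w"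
  using inj_upair by (auto dest: injD)

lemma fib_set_iff: "upair (s, x) \<in> fib_set f p c \<longleftrightarrow> (\<exists>y. p c s = Some y \<and> f c x = Some y)"
  by (auto simp: fib_set_def)

lemma fib_setE:
  assumes "z \<in> fib_set f p c"
  obtains s x y where "z = upair (s, x)" and "p c s = Some y" and "f c x = Some y"
  using assms by (auto simp: fib_set_def)

lemma fo_fib_prod [simp]: "fo (fib_prod X f E p) = fib_set f p"
  by (simp add: fib_prod_def)

lemma fm_fib_prod:
  "upair (s, x) \<in> fib_set f p c \<Longrightarrow> fm E c d h s = Some s' \<Longrightarrow> fm X c d h x = Some x' \<Longrightarrow>
     fm (fib_prod X f E p) c d h (upair (s, x)) = Some (upair (s', x'))"
  by (simp add: fib_prod_def pair_map_def)

lemma fib_proj_apply: "upair (s, x) \<in> fib_set f p c \<Longrightarrow> fib_proj f p c (upair (s, x)) = Some x"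
  by (simp add: fib_proj_def)

lemma fo_base_pull [simp]: "fo (base_pull X f) (E, p) = (fib_prod X f E p, fib_proj f p)"
  by (simp add: base_pull_def)

lemma fm_base_pull:
  "upair (s, x) \<in> fib_set f p c \<Longrightarrow> \<phi> c s = Some t \<Longrightarrow>
     fm (base_pull X f) (E, p) A' \<phi> c (upair (s, x)) = Some (upair (t, x))"
  by (cases A') (simp add: base_pull_def pair_map_def)

lemma fm_base_pull_None: "z \<notin> fib_set f p c \<Longrightarrow> fm (base_pull X f) (E, p) A' \<phi> c z = None"
  by (cases A') (simp add: base_pull_def pair_map_def)

text \<open>
  If \<open>f x = y\<close>, then the fibre of \<open>E\<close> over \<open>y\<close> is the fibre of the pullback over \<open>x\<close>. As every \<open>y\<close>
  has such an \<open>x\<close>, a map is bijective on all fibres if its pullback is.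
\<close>

lemma base_pull_reflects_isos:
  assumes surj: "\<And>c y. c \<in> Obj S \<Longrightarrow> y \<in> fo Y c \<Longrightarrow> \<exists>x. f c x = Some y"
  shows "reflects_isos (slice (Sheaves S K) Y) (slice (Sheaves S K) X) (base_pull X f)"
  unfolding reflects_isos_def
proof (intro allI impI; elim conjE)
  fix A A' \<phi>
  assume \<phi>: "arrow (slice (Sheaves S K) Y) \<phi> A A'"
    and iso: "is_iso (slice (Sheaves S K) X) (fo (base_pull X f) A) (fo (base_pull X f) A')
      (fm (base_pull X f) A A' \<phi>)"
  obtain E p E' p' where A: "A = (E, p)" "A' = (E', p')"
    by (cases A, cases A') auto
  have E: "is_sheaf S K E" and E': "is_sheaf S K E'" and p: "p \<in> Hom (Sheaves S K) E Y"
    and p': "p' \<in> Hom (Sheaves S K) E' Y" and \<phi>H: "\<phi> \<in> Hom (Sheaves S K) E E'"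
    and p'\<phi>: "(\<lambda>c. p' c \<circ>\<^sub>m \<phi> c) = p"
    using \<phi> by (auto simp: A arrow_def)
  define \<Phi> where "\<Phi> = fm (base_pull X f) A A' \<phi>"
  obtain \<psi> where l: "(\<lambda>c. \<psi> c \<circ>\<^sub>m \<Phi> c) = Ide (Sheaves S K) (fib_prod X f E p)"
    and r: "(\<lambda>c. \<Phi> c \<circ>\<^sub>m \<psi> c) = Ide (Sheaves S K) (fib_prod X f E' p')"
    using iso by (auto simp: is_iso_def A \<Phi>_def simp del: Sheaves_simps(2))
  have p_eq: "p c s = p' c t" if "\<phi> c s = Some t" for c s t
    using fun_cong[OF fun_cong[OF p'\<phi>, of c], of s] that by simp
  have \<Phi>_apply: "\<Phi> c (upair (s, x)) = Some (upair (t, x))"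
    if "upair (s, x) \<in> fib_set f p c" "\<phi> c s = Some t" for c s x t
    unfolding \<Phi>_def A using that by (intro fm_base_pull)
  have \<psi>\<Phi>: "\<psi> c w = Some z" if "\<Phi> c z = Some w" "z \<in> fib_set f p c" "c \<in> Obj S" for c z w
    using fun_cong[OF fun_cong[OF l, of c], of z] that by simp
  have inj: "s = s'" if s: "\<phi> c s = Some t" "\<phi> c s' = Some t" for c s s' t
  proof -
    have c: "c \<in> Obj S" and t: "t \<in> fo E' c"
      using sheaf_map_SomeD[OF \<phi>H s(1)] by auto
    obtain y where y: "p' c t = Some y" "y \<in> fo Y c"
      using sheaf_map_defined[OF p' c t] by blast
    obtain x where x: "f c x = Some y"
      using surj[OF c y(2)] by blast
    have z: "upair (s, x) \<in> fib_set f p c" "upair (s', x) \<in> fib_set f p c"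
      using p_eq[OF s(1)] p_eq[OF s(2)] x y by (auto simp: fib_set_iff)
    show "s = s'"
      using \<psi>\<Phi>[OF \<Phi>_apply[OF z(1) s(1)] z(1) c] \<psi>\<Phi>[OF \<Phi>_apply[OF z(2) s(2)] z(2) c] by simp
  qed
  have surj': "\<exists>s. \<phi> c s = Some t" if c: "c \<in> Obj S" and t: "t \<in> fo E' c" for c t
  proof -
    obtain y where y: "p' c t = Some y" "y \<in> fo Y c"
      using sheaf_map_defined[OF p' c t] by blast
    obtain x where x: "f c x = Some y"
      using surj[OF c y(2)] by blast
    have "upair (t, x) \<in> fib_set f p' c"
      using x y by (auto simp: fib_set_iff)
    then obtain z where z: "\<Phi> c z = Some (upair (t, x))"
      using fun_cong[OF fun_cong[OF r, of c], of "upair (t, x)"] c by (auto simp: map_comp_Some_iff)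
    then have "z \<in> fib_set f p c"
      using fm_base_pull_None[of z f p c X E A' \<phi>] by (auto simp: \<Phi>_def A)
    then obtain s x' y' where z_eq: "z = upair (s, x')" and zf: "upair (s, x') \<in> fib_set f p c"
      and s: "p c s = Some y'"
      by (metis fib_setE)
    obtain t' where "\<phi> c s = Some t'"
      using sheaf_map_defined[OF \<phi>H c sheaf_map_SomeD(2)[OF p s]] by blast
    then show ?thesis
      using \<Phi>_apply[OF zf] z z_eq by auto
  qed
  obtain \<beta> where \<beta>: "\<beta> \<in> Hom (Sheaves S K) E' E" and \<beta>\<phi>: "\<beta> \<cdot>\<^bsub>Sheaves S K\<^esub> \<phi> = Ide (Sheaves S K) E"
    and \<phi>\<beta>: "\<phi> \<cdot>\<^bsub>Sheaves S K\<^esub> \<beta> = Ide (Sheaves S K) E'"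
    using inj surj' by (rule sheaf_map_bijective_iso[OF sheaf_functor[OF E] sheaf_functor[OF E'] \<phi>H])
  have "(p c \<circ>\<^sub>m \<beta> c) t = p' c t" for c t
  proof (cases "\<beta> c t")
    case None
    then have "\<not> (c \<in> Obj S \<and> t \<in> fo E' c)"
      using sheaf_map_defined[OF \<beta>, of c t] by auto
    then have "p' c t = None"
      using sheaf_map_SomeD[OF p', of c t] by (cases "p' c t") auto
    then show ?thesis
      using None by simp
  next
    case (Some s)
    then have "\<phi> c s = Some t"
      using fun_cong[OF fun_cong[OF \<phi>\<beta>, of c], of t] sheaf_map_SomeD[OF \<beta> Some] by simp
    then show ?thesis
      using Some p_eq by simp
  qed
  then have "(\<lambda>c. p c \<circ>\<^sub>m \<beta> c) = p'"
    by blast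
  then show "is_iso (slice (Sheaves S K) Y) A A' \<phi>"
    using \<phi> \<beta> \<beta>\<phi> \<phi>\<beta> by (auto simp: is_iso_def arrow_def A)
qed


subsection \<open>Postcomposition is left adjoint to pullback\<close>

text \<open>
  The projection \<open>(s, x) \<mapsto> s\<close> of \<open>f\<^sub>! f\<^sup>* E\<close> to \<open>E\<close>.
\<close>

definition base_counit ::
  "('o, 'u) psh_map \<Rightarrow> ('o, 'm, 'u) psh \<times> ('o, 'u) psh_map \<Rightarrow> ('o, 'u::set_universe) psh_map" where
  "base_counit f = (\<lambda>(E, p) c z. if z \<in> fib_set f p c then Some (fst (unpair z)) else None)"

lemma fo_base_post [simp]: "fo (base_post f) (E, p) = (E, \<lambda>c. f c \<circ>\<^sub>m p c)"
  and fm_base_post [simp]: "fm (base_post f) A B \<phi> = \<phi>"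
  by (simp_all add: base_post_def)

lemma base_unit_apply: "p c s = Some x \<Longrightarrow> base_unit (E, p) c s = Some (upair (s, x))"
  by (simp add: base_unit_def)

lemma base_unit_None: "p c s = None \<Longrightarrow> base_unit (E, p) c s = None"
  by (simp add: base_unit_def)

lemma base_counit_apply: "upair (s, x) \<in> fib_set f p c \<Longrightarrow> base_counit f (E, p) c (upair (s, x)) = Some s"
  by (simp add: base_counit_def)

lemma base_counit_None: "z \<notin> fib_set f p c \<Longrightarrow> base_counit f (E, p) c z = None"
  by (simp add: base_counit_def)

text \<open>
  The second hypothesis contains the facts that the slices are categories and that the pullback of
  a sheaf is a sheaf.
\<close>

lemma base_change_adjunction:
  assumes f: "f \<in> Hom (Sheaves S K) X Y"
    and pull: "is_functor (slice (Sheaves S K) Y) (slice (Sheaves S K) X) (base_pull X f)"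
  shows "adjunction (slice (Sheaves S K) X) (slice (Sheaves S K) Y)
           (base_post f) (base_pull X f) base_unit (base_counit f)"
proof -
  let ?C = "slice (Sheaves S K) Y" and ?D = "slice (Sheaves S K) X"
  have catC: "category ?C" and catD: "category ?D"
    using pull by (simp_all add: is_functor_def)
  have post_obj: "fo (base_post f) A \<in> Obj ?C" if "A \<in> Obj ?D" for A
    using that sheaf_map_Cmp[OF sheaf_functor _ f] by (cases A) auto
  have post: "is_functor ?D ?C (base_post f)"
  proof (rule is_functorI[OF catD catC])
    show "fm (base_post f) A B \<phi> \<in> Hom ?C (fo (base_post f) A) (fo (base_post f) B)"
      if "arrow ?D \<phi> A B" for A B \<phi>
      using that by (cases A, cases B) (auto simp: arrow_def map_comp_assoc[symmetric])
    show "fm (base_post f) A A (Ide ?D A) = Ide ?C (fo (base_post f) A)" for A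
      by (cases A) simp
    show "fm (base_post f) A A'' (\<psi> \<cdot>\<^bsub>?D\<^esub> \<phi>) = fm (base_post f) A' A'' \<psi> \<cdot>\<^bsub>?C\<^esub> fm (base_post f) A A' \<phi>"
      for A A' A'' \<phi> \<psi>
      by simp
  qed (rule post_obj)
  have slice_mapD: "p c s = p' c t"
    if "\<phi> \<in> Hom (slice (Sheaves S K) B) (E, p) (E', p')" "\<phi> c s = Some t" for B \<phi> E p E' p' c s t
  proof -
    have "(\<lambda>c. p' c \<circ>\<^sub>m \<phi> c) = p"
      using that by simp
    from fun_cong[OF fun_cong[OF this, of c], of s] show ?thesis
      using that by simp
  qed
  have undefined_None: "\<alpha> c s = None" if "\<alpha> \<in> Hom (Sheaves S K) Z W" "\<not> (c \<in> Obj S \<and> s \<in> fo Z c)" for \<alpha> Z W c s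
    using sheaf_map_SomeD[OF that(1)] that(2) by (cases "\<alpha> c s") auto
  have unit_fib: "upair (s, x) \<in> fib_set f (\<lambda>c. f c \<circ>\<^sub>m p c) c"
    if "p \<in> Hom (Sheaves S K) E X" "p c s = Some x" for p E c s x
    using sheaf_map_defined[OF f sheaf_map_SomeD(1,3)[OF that]] that(2) by (auto simp: fib_set_iff)
  have unit: "base_unit (E, p) \<in> Hom (Sheaves S K) E (fib_prod X f E (\<lambda>c. f c \<circ>\<^sub>m p c))"
    if E: "is_sheaf S K E" and p: "p \<in> Hom (Sheaves S K) E X" for E p
  proof (rule sheaf_mapI[OF sheaf_functor[OF E]])
    show "dom (base_unit (E, p) c) = fo E c" if "c \<in> Obj S" for c
      using sheaf_map_defined[OF p that] sheaf_map_SomeD[OF p] by (auto simp: base_unit_def dom_def) metis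
    show "z \<in> fo (fib_prod X f E (\<lambda>c. f c \<circ>\<^sub>m p c)) c" if "base_unit (E, p) c s = Some z" for c s z
      using that unit_fib[OF p] by (auto simp: base_unit_def)
    show "base_unit (E, p) c = Map.empty" if "c \<notin> Obj S" for c
      using that p by (simp add: base_unit_def Sheaves_def fun_eq_iff)
    fix c d h s z s' assume c: "c \<in> Obj S" "d \<in> Obj S" "h \<in> Hom S d c"
      and "base_unit (E, p) c s = Some z" and s': "fm E c d h s = Some s'"
    then obtain x where x: "p c s = Some x" and z: "z = upair (s, x)"
      by (auto simp: base_unit_def)
    obtain x' where x': "p d s' = Some x'"
      using sheaf_map_defined[OF p c(2) restriction_SomeD(2)[OF sheaf_functor[OF E] c s']] by blast
    show "fm (fib_prod X f E (\<lambda>c. f c \<circ>\<^sub>m p c)) c d h z = base_unit (E, p) d s'"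
      using fm_fib_prod[OF unit_fib[OF p x] s', of X] sheaf_map_natural[OF p c x s'] x' z
      by (simp add: base_unit_apply)
  qed
  have unit_nat: "nat_trans ?D ?D id_functor (functor_comp (base_pull X f) (base_post f)) base_unit"
    unfolding nat_trans_def
  proof (intro conjI ballI)
    fix A assume "A \<in> Obj ?D"
    then obtain E p where A: "A = (E, p)" and E: "is_sheaf S K E" and p: "p \<in> Hom (Sheaves S K) E X"
      by (cases A) auto
    have "(fib_proj f (\<lambda>c. f c \<circ>\<^sub>m p c) c \<circ>\<^sub>m base_unit (E, p) c) s = p c s" for c s
      by (cases "p c s") (simp_all add: base_unit_apply base_unit_None fib_proj_apply[OF unit_fib[OF p]])
    then show "base_unit A \<in> Hom ?D (fo id_functor A) (fo (functor_comp (base_pull X f) (base_post f)) A)"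
      using unit[OF E p] by (simp add: A fun_eq_iff)
  next
    fix A B \<phi> assume "A \<in> Obj ?D" "B \<in> Obj ?D" and \<phi>: "\<phi> \<in> Hom ?D A B"
    then obtain E p E' p' where A: "A = (E, p)" "B = (E', p')" and p: "p \<in> Hom (Sheaves S K) E X"
      and p': "p' \<in> Hom (Sheaves S K) E' X" and \<phi>H: "\<phi> \<in> Hom (Sheaves S K) E E'"
      by (cases A, cases B) auto
    have "(base_unit B c \<circ>\<^sub>m \<phi> c) s
        = (fm (base_pull X f) (E, \<lambda>c. f c \<circ>\<^sub>m p c) (E', \<lambda>c. f c \<circ>\<^sub>m p' c) \<phi> c \<circ>\<^sub>m base_unit A c) s" for c s
    proof (cases "\<phi> c s")
      case None
      then have "p c s = None"
        using undefined_None[OF p, of c s] sheaf_map_defined[OF \<phi>H, of c s] by (metis option.distinct(1))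
      then show ?thesis
        using None by (simp add: A base_unit_None)
    next
      case (Some t)
      note pt = slice_mapD[OF \<phi>[unfolded A] Some]
      obtain x where x: "p c s = Some x"
        using sheaf_map_defined[OF p sheaf_map_SomeD(1,2)[OF \<phi>H Some]] by blast
      then show ?thesis
        using Some pt fm_base_pull[where \<phi> = \<phi> and X = X, OF unit_fib[OF p x] Some] by (simp add: A base_unit_apply)
    qed
    then show "base_unit B \<cdot>\<^bsub>?D\<^esub> fm id_functor A B \<phi>
        = fm (functor_comp (base_pull X f) (base_post f)) A B \<phi> \<cdot>\<^bsub>?D\<^esub> base_unit A"
      by (simp add: A fun_eq_iff)
  qed
  have fib_sheaf: "is_sheaf S K (fib_prod X f E p)" and proj: "fib_proj f p \<in> Hom (Sheaves S K) (fib_prod X f E p) X"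
    if "(E, p) \<in> Obj ?C" for E p
    using functor_Obj[OF pull that] by simp_all
  have counit: "base_counit f (E, p) \<in> Hom (Sheaves S K) (fib_prod X f E p) E"
    if A: "(E, p) \<in> Obj ?C" for E p
  proof (rule sheaf_mapI[OF sheaf_functor[OF fib_sheaf[OF A]]])
    have E: "is_sheaf S K E" and p: "p \<in> Hom (Sheaves S K) E Y"
      using A by auto
    show "dom (base_counit f (E, p) c) = fo (fib_prod X f E p) c" for c
      by (auto simp: base_counit_def dom_def)
    show "s \<in> fo E c" if "base_counit f (E, p) c z = Some s" for c z s
      using that sheaf_map_SomeD[OF p] by (auto simp: base_counit_def split: if_splits elim!: fib_setE)
    show "base_counit f (E, p) c = Map.empty" if "c \<notin> Obj S" for c
      using that p by (auto simp: base_counit_def fun_eq_iff Sheaves_def elim!: fib_setE)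
    fix c d h z s z' assume c: "c \<in> Obj S" "d \<in> Obj S" "h \<in> Hom S d c"
      and zs: "base_counit f (E, p) c z = Some s" and z': "fm (fib_prod X f E p) c d h z = Some z'"
    have z: "z \<in> fib_set f p c"
      using zs by (auto simp: base_counit_def split: if_splits)
    then obtain x y where z_eq: "z = upair (s, x)" and y: "p c s = Some y" and x: "f c x = Some y"
      using zs by (auto simp: base_counit_def elim!: fib_setE)
    obtain s' where s': "fm E c d h s = Some s'"
      using restriction_defined[OF sheaf_functor[OF E] c sheaf_map_SomeD(2)[OF p y]] by blast
    have "z' = upair (s', the (fm X c d h x))"
      using z' z s' by (simp add: z_eq fib_prod_def pair_map_def)
    then show "fm E c d h s = base_counit f (E, p) d z'"
      using restriction_SomeD(2)[OF sheaf_functor[OF fib_sheaf[OF A]] c z'] s'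
      by (simp add: base_counit_apply)
  qed
  have counit_nat: "nat_trans ?C ?C (functor_comp (base_post f) (base_pull X f)) id_functor (base_counit f)"
    unfolding nat_trans_def
  proof (intro conjI ballI)
    fix A assume A_in: "A \<in> Obj ?C"
    then obtain E p where A: "A = (E, p)"
      by (cases A) auto
    have "(p c \<circ>\<^sub>m base_counit f (E, p) c) z = (f c \<circ>\<^sub>m fib_proj f p c) z" for c z
      by (cases "z \<in> fib_set f p c")
        (auto simp: base_counit_def fib_proj_def elim!: fib_setE)
    then show "base_counit f A \<in> Hom ?C (fo (functor_comp (base_post f) (base_pull X f)) A) (fo id_functor A)"
      using counit A_in by (simp add: A fun_eq_iff)
  next
    fix A B \<phi> assume "A \<in> Obj ?C" "B \<in> Obj ?C" and \<phi>: "\<phi> \<in> Hom ?C A B"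
    then obtain E p E' p' where A: "A = (E, p)" "B = (E', p')" and p: "p \<in> Hom (Sheaves S K) E Y"
      and \<phi>H: "\<phi> \<in> Hom (Sheaves S K) E E'"
      by (cases A, cases B) auto
    have "(base_counit f B c \<circ>\<^sub>m fm (base_pull X f) A B \<phi> c) z = (\<phi> c \<circ>\<^sub>m base_counit f A c) z" for c z
    proof (cases "z \<in> fib_set f p c")
      case True
      then obtain s x y where z: "z = upair (s, x)" and y: "p c s = Some y" "f c x = Some y"
        by (rule fib_setE)
      obtain t where t: "\<phi> c s = Some t"
        using sheaf_map_defined[OF \<phi>H sheaf_map_SomeD(1,2)[OF p y(1)]] by blast
      have "upair (t, x) \<in> fib_set f p' c"
        unfolding fib_set_iff using slice_mapD[OF \<phi>[unfolded A] t] y by metis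
      then show ?thesis
        using True t fm_base_pull[of s x f p c \<phi> t X E B] by (simp add: A z base_counit_apply)
    next
      case False
      then show ?thesis
        using fm_base_pull_None[OF False, of X E B \<phi>] by (simp add: A base_counit_None)
    qed
    then show "base_counit f B \<cdot>\<^bsub>?C\<^esub> fm (functor_comp (base_post f) (base_pull X f)) A B \<phi>
        = fm id_functor A B \<phi> \<cdot>\<^bsub>?C\<^esub> base_counit f A"
      by (simp add: fun_eq_iff)
  qed
  show ?thesis
    unfolding adjunction_def
  proof (intro conjI ballI post pull unit_nat counit_nat)
    fix A assume "A \<in> Obj ?D"
    then obtain E p where A: "A = (E, p)" and p: "p \<in> Hom (Sheaves S K) E X"
      by (cases A) auto
    have "(base_counit f (E, \<lambda>c. f c \<circ>\<^sub>m p c) c \<circ>\<^sub>m base_unit (E, p) c) s = Ide (Sheaves S K) E c s" for c s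
    proof (cases "p c s")
      case None
      then have "\<not> (c \<in> Obj S \<and> s \<in> fo E c)"
        using sheaf_map_defined[OF p, of c s] by auto
      then show ?thesis
        using None by (auto simp: base_unit_None)
    next
      case (Some x)
      then show ?thesis
        using base_counit_apply[OF unit_fib[OF p Some]] sheaf_map_SomeD[OF p Some]
        by (simp add: base_unit_apply)
    qed
    then show "base_counit f (fo (base_post f) A) \<cdot>\<^bsub>?C\<^esub>
        fm (base_post f) A (fo (base_pull X f) (fo (base_post f) A)) (base_unit A)
        = Ide ?C (fo (base_post f) A)"
      by (simp add: A fun_eq_iff)
  next
    fix A assume A_in: "A \<in> Obj ?C"
    then obtain E p where A: "A = (E, p)" and p: "p \<in> Hom (Sheaves S K) E Y"
      by (cases A) auto
    let ?G = "fib_prod X f E p" and ?q = "fib_proj f p"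
    have proj': "?q \<in> Hom (Sheaves S K) ?G X"
      using proj A_in A by blast
    have "(fm (base_pull X f) (?G, \<lambda>c. f c \<circ>\<^sub>m ?q c) (E, p) (base_counit f (E, p)) c \<circ>\<^sub>m base_unit (?G, ?q) c) z
        = Ide (Sheaves S K) ?G c z" for c z
    proof (cases "z \<in> fib_set f p c")
      case True
      then obtain s x y where z: "z = upair (s, x)" and y: "p c s = Some y"
        by (auto elim: fib_setE)
      have q: "?q c z = Some x"
        using True z fib_proj_apply[of s x f p c] by simp
      show ?thesis
        using fm_base_pull[where \<phi> = "base_counit f (E, p)", OF unit_fib[OF proj' q], of s X ?G "(E, p)"] True q
          sheaf_map_SomeD(1)[OF p y]
        by (simp add: z base_unit_apply base_counit_apply)
    next
      case False
      then have "?q c z = None"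
        by (simp add: fib_proj_def)
      then show ?thesis
        using False by (auto simp: base_unit_None)
    qed
    then show "fm (base_pull X f) (fo (base_post f) (fo (base_pull X f) A)) A (base_counit f A) \<cdot>\<^bsub>?D\<^esub>
        base_unit (fo (base_pull X f) A) = Ide ?D (fo (base_pull X f) A)"
      by (simp add: A fun_eq_iff)
  qed
qed


section \<open>Smooth functions are closed under products and composition\<close>

lemma Rn_upd: "x \<in> Rn n \<Longrightarrow> i < n \<Longrightarrow> x(i := t) \<in> Rn n"
  by (auto simp: Rn_def)

lemma foldr_part_cong:
  assumes "\<And>x. x \<in> Rn n \<Longrightarrow> f x = g x" and "set js \<subseteq> {..<n}" and "x \<in> Rn n"
  shows "foldr part js f x = foldr part js g x"
  using assms(2,3)
proof (induction js arbitrary: x)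
  case (Cons i js)
  have "(\<lambda>t. foldr part js f (x(i := t))) = (\<lambda>t. foldr part js g (x(i := t)))"
    using Cons.IH Cons.prems Rn_upd by auto
  then show ?case
    by (simp add: part_def[of i])
qed (use assms(1) in auto)

lemma smooth_on_cong:
  assumes fg: "\<And>x. x \<in> Rn n \<Longrightarrow> f x = g x" and f: "smooth_on n (Rn n) f"
  shows "smooth_on n (Rn n) g"
  unfolding smooth_on_def
proof (intro allI impI conjI ballI)
  fix js assume js: "set js \<subseteq> {..<n}"
  note cong = foldr_part_cong[of n f g, OF fg js]
  have "continuous_on (Rn n) (foldr part js f)"
    using f js by (simp add: smooth_on_def)
  then show "continuous_on (Rn n) (foldr part js g)"
    using cong by (rule continuous_on_eq)
  fix i x assume "i < n" "x \<in> Rn n"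
  moreover from this have "(\<lambda>t. foldr part js f (x(i := t))) = (\<lambda>t. foldr part js g (x(i := t)))"
    using cong Rn_upd by auto
  ultimately show "(\<lambda>t. foldr part js g (x(i := t))) field_differentiable (at (x i))"
    using f js unfolding smooth_on_def by metis
qed

text \<open>
  Smoothness is coinductive: it suffices to find a class of continuous functions which is closed
  under partial derivatives. Derivatives are compared on \<open>Rn n\<close> only, as \<open>part\<close> has unrelated values
  elsewhere.
\<close>

lemma smooth_on_coinduct:
  assumes f: "A f"
    and cont: "\<And>f. A f \<Longrightarrow> continuous_on (Rn n) f"
    and deriv: "\<And>f i. A f \<Longrightarrow> i < n \<Longrightarrow>
      \<exists>g. A g \<and> (\<forall>x \<in> Rn n. ((\<lambda>t. f (x(i := t))) has_real_derivative g x) (at (x i)))"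
  shows "smooth_on n (Rn n) f"
  unfolding smooth_on_def
proof (intro allI impI)
  fix js assume "set js \<subseteq> {..<n}"
  then have "\<exists>g. A g \<and> (\<forall>x \<in> Rn n. foldr part js f x = g x)"
  proof (induction js)
    case Nil
    then show ?case
      using f by auto
  next
    case (Cons i js)
    then obtain g where g: "A g" "\<And>x. x \<in> Rn n \<Longrightarrow> foldr part js f x = g x"
      by auto
    have i: "i < n"
      using Cons.prems by simp
    obtain h where h: "A h" "\<And>x. x \<in> Rn n \<Longrightarrow> ((\<lambda>t. g (x(i := t))) has_real_derivative h x) (at (x i))"
      using deriv[OF g(1) i] by blast
    have "foldr part (i # js) f x = h x" if x: "x \<in> Rn n" for x
    proof -
      have "(\<lambda>t. foldr part js f (x(i := t))) = (\<lambda>t. g (x(i := t)))"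
        using g(2) Rn_upd[OF x i] by auto
      then show ?thesis
        using DERIV_imp_deriv[OF h(2)[OF x]] by (simp add: part_def)
    qed
    then show ?case
      using h(1) by blast
  qed
  then obtain g where g: "A g" "\<And>x. x \<in> Rn n \<Longrightarrow> foldr part js f x = g x"
    by blast
  show "continuous_on (Rn n) (foldr part js f) \<and>
      (\<forall>i<n. \<forall>x\<in>Rn n. (\<lambda>t. foldr part js f (x(i := t))) field_differentiable at (x i))"
  proof (intro conjI allI impI ballI)
    show "continuous_on (Rn n) (foldr part js f)"
      using cont[OF g(1)] g(2) by (simp cong: continuous_on_cong)
    fix i x assume i: "i < n" and x: "x \<in> Rn n"
    have "(\<lambda>t. foldr part js f (x(i := t))) = (\<lambda>t. g (x(i := t)))"
      using g(2) Rn_upd[OF x i] by auto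
    then show "(\<lambda>t. foldr part js f (x(i := t))) field_differentiable at (x i)"
      using deriv[OF g(1) i] x by (auto simp: field_differentiable_def)
  qed
qed

lemma smooth_on_continuous: "smooth_on n U f \<Longrightarrow> continuous_on U f"
  unfolding smooth_on_def by (metis empty_iff empty_set foldr.simps(1) id_apply subsetI)

lemma smooth_on_has_part:
  assumes "smooth_on n U f" and "i < n" and "x \<in> U"
  shows "((\<lambda>t. f (x(i := t))) has_real_derivative part i f x) (at (x i))"
proof -
  have "(\<lambda>t. foldr part [] f (x(i := t))) field_differentiable (at (x i))"
    using assms unfolding smooth_on_def by (metis empty_iff empty_set subsetI)
  then show ?thesis
    by (simp add: part_def DERIV_deriv_iff_field_differentiable)
qed

lemma smooth_on_part:
  assumes "smooth_on n U f" and "i < n"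
  shows "smooth_on n U (part i f)"
  unfolding smooth_on_def
proof (intro allI impI)
  fix js assume "set js \<subseteq> {..<n}"
  then have "set (js @ [i]) \<subseteq> {..<n}"
    using assms(2) by auto
  then show "continuous_on U (foldr part js (part i f)) \<and>
      (\<forall>ia<n. \<forall>x\<in>U. (\<lambda>t. foldr part js (part i f) (x(ia := t))) field_differentiable at (x ia))"
    using assms(1)[unfolded smooth_on_def, rule_format, of "js @ [i]"] by auto
qed

lemma smooth_on_const: "smooth_on n (Rn n) (\<lambda>x. c)"
  by (rule smooth_on_coinduct[of "\<lambda>f. \<exists>c. f = (\<lambda>x. c)"]) (auto intro!: exI[of _ "\<lambda>x. 0"])

lemma mean_value_unordered:
  fixes f :: "real \<Rightarrow> real"
  assumes f: "\<And>s. (f has_real_derivative f' s) (at s)"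
  shows "\<exists>\<xi>. \<bar>\<xi> - a\<bar> \<le> \<bar>b - a\<bar> \<and> f b - f a = (b - a) * f' \<xi>"
proof (cases a b rule: linorder_cases)
  case less
  then obtain z where "a < z" "z < b" "f b - f a = (b - a) * f' z"
    using MVT2[of a b f f'] f by blast
  then show ?thesis
    by (intro exI[of _ z]) auto
next
  case greater
  then obtain z where "b < z" "z < a" "f a - f b = (a - b) * f' z"
    using MVT2[of b a f f'] f by blast
  then show ?thesis
    by (intro exI[of _ z]) (auto simp: algebra_simps)
qed auto

lemma tendsto_coordinatewise:
  fixes f :: "'a \<Rightarrow> nat \<Rightarrow> real"
  assumes "\<And>j. ((\<lambda>t. f t j) \<longlongrightarrow> l j) F"
  shows "(f \<longlongrightarrow> l) F"
proof -
  have "limitin (product_topology (\<lambda>_::nat. euclidean :: real topology) UNIV) f l F"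
    using assms by (simp add: limitin_componentwise)
  then show ?thesis
    by (simp add: euclidean_product_topology)
qed

text \<open>
  Passing from \<open>\<gamma> t0\<close> to \<open>\<gamma> t\<close> one coordinate at a time, each step is by the mean value theorem the
  increment of a coordinate times a partial derivative at a point that tends to \<open>\<gamma> t0\<close>.
\<close>

lemma partial_chain_rule:
  assumes cont: "\<And>j. j < n \<Longrightarrow> continuous_on (Rn n) (F' j)"
    and diff: "\<And>j x. j < n \<Longrightarrow> x \<in> Rn n \<Longrightarrow> ((\<lambda>t. F (x(j := t))) has_real_derivative F' j x) (at (x j))"
    and \<gamma>: "\<And>t. \<gamma> t \<in> Rn n"
    and \<gamma>': "\<And>j. j < n \<Longrightarrow> ((\<lambda>t. \<gamma> t j) has_real_derivative \<gamma>' j) (at t0)"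
  shows "((\<lambda>t. F (\<gamma> t)) has_real_derivative (\<Sum>j<n. F' j (\<gamma> t0) * \<gamma>' j)) (at t0)"
proof -
  \<comment> \<open>in \<open>H m t\<close> the coordinates below \<open>m\<close> have moved to \<open>\<gamma> t\<close>\<close>
  define H where "H = (\<lambda>m t j. if j < m then \<gamma> t j else \<gamma> t0 j)"
  have H_Rn: "H m t \<in> Rn n" for m t
    using \<gamma> by (auto simp: H_def Rn_def)
  have coord: "((\<lambda>t. \<gamma> t j) \<longlongrightarrow> \<gamma> t0 j) (at t0)" for j
  proof (cases "j < n")
    case True
    then show ?thesis
      using DERIV_isCont[OF \<gamma>'[OF True]] by (simp add: isCont_def)
  next
    case False
    then have "(\<lambda>t. \<gamma> t j) = (\<lambda>t. \<gamma> t0 j)"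
      using \<gamma> by (auto simp: Rn_def)
    then show ?thesis
      by (simp only: tendsto_const)
  qed
  have claim: "((\<lambda>t. F (H m t)) has_real_derivative (\<Sum>j<m. F' j (\<gamma> t0) * \<gamma>' j)) (at t0)" if "m \<le> n" for m
    using that
  proof (induction m)
    case 0
    then show ?case
      by (simp add: H_def)
  next
    case (Suc m)
    then have m: "m < n"
      by simp
    have step: "((\<lambda>s. F ((H m t)(m := s))) has_real_derivative F' m ((H m t)(m := s))) (at s)" for t s
      using diff[OF m Rn_upd[OF H_Rn m], of m t s] by simp
    have "\<exists>\<xi>. \<bar>\<xi> - \<gamma> t0 m\<bar> \<le> \<bar>\<gamma> t m - \<gamma> t0 m\<bar> \<and> F ((H m t)(m := \<gamma> t m)) - F ((H m t)(m := \<gamma> t0 m))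
        = (\<gamma> t m - \<gamma> t0 m) * F' m ((H m t)(m := \<xi>))" for t
      by (rule mean_value_unordered[OF step])
    then obtain \<xi> where \<xi>: "\<And>t. \<bar>\<xi> t - \<gamma> t0 m\<bar> \<le> \<bar>\<gamma> t m - \<gamma> t0 m\<bar>"
      and incr: "\<And>t. F ((H m t)(m := \<gamma> t m)) - F ((H m t)(m := \<gamma> t0 m))
        = (\<gamma> t m - \<gamma> t0 m) * F' m ((H m t)(m := \<xi> t))"
      by metis
    have "((\<lambda>t. \<gamma> t m - \<gamma> t0 m) \<longlongrightarrow> 0) (at t0)"
      using tendsto_diff[OF coord[of m] tendsto_const[of "\<gamma> t0 m"]] by simp
    then have "((\<lambda>t. \<bar>\<gamma> t m - \<gamma> t0 m\<bar>) \<longlongrightarrow> 0) (at t0)"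
      by (rule tendsto_rabs_zero)
    then have "((\<lambda>t. \<xi> t - \<gamma> t0 m) \<longlongrightarrow> 0) (at t0)"
      by (rule Lim_null_comparison[rotated]) (use \<xi> in simp)
    then have \<xi>_lim: "(\<xi> \<longlongrightarrow> \<gamma> t0 m) (at t0)"
      by (rule LIM_zero_cancel)
    have "((\<lambda>t. (H m t)(m := \<xi> t)) \<longlongrightarrow> \<gamma> t0) (at t0)"
    proof (rule tendsto_coordinatewise)
      show "((\<lambda>t. ((H m t)(m := \<xi> t)) j) \<longlongrightarrow> \<gamma> t0 j) (at t0)" for j
        using \<xi>_lim coord[of j] by (cases "j = m"; cases "j < m") (simp_all add: H_def)
    qed
    then have lim: "((\<lambda>t. F' m ((H m t)(m := \<xi> t))) \<longlongrightarrow> F' m (\<gamma> t0)) (at t0)"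
      by (rule continuous_on_tendsto_compose[OF cont[OF m] _ \<gamma>]) (simp add: Rn_upd[OF H_Rn m])
    have H_Suc: "H (Suc m) t = (H m t)(m := \<gamma> t m)" and H_m: "H m t = (H m t)(m := \<gamma> t0 m)" for t
      by (auto simp: H_def less_Suc_eq fun_eq_iff)
    have "((\<lambda>t. (\<gamma> t m - \<gamma> t0 m) / (t - t0) * F' m ((H m t)(m := \<xi> t))) \<longlongrightarrow> \<gamma>' m * F' m (\<gamma> t0)) (at t0)"
      using \<gamma>'[OF m] lim by (intro tendsto_mult) (simp_all add: has_field_derivative_iff)
    moreover have "F (H (Suc m) t) - F (H m t) = (\<gamma> t m - \<gamma> t0 m) * F' m ((H m t)(m := \<xi> t))" for t
      using incr[of t] H_Suc[of t] H_m[of t] by simp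
    moreover have "F (H (Suc m) t0) - F (H m t0) = 0"
      by (simp add: H_def cong: if_cong)
    ultimately have "((\<lambda>t. F (H (Suc m) t) - F (H m t)) has_real_derivative \<gamma>' m * F' m (\<gamma> t0)) (at t0)"
      by (simp add: has_field_derivative_iff)
    from DERIV_add[OF Suc.IH this] show ?case
      using Suc.prems by (simp add: mult.commute)
  qed
  have "H n = \<gamma>"
    using \<gamma> by (auto simp: H_def Rn_def fun_eq_iff)
  then show ?thesis
    using claim[of n] by simp
qed

text \<open>
  By the sum, product and chain rules this class is closed under partial derivatives. It is used
  with \<open>\<Phi>\<close> empty for sums and products, and with \<open>\<Phi>\<close> a singleton for composition.
\<close>

inductive generated :: "nat \<Rightarrow> ((nat \<Rightarrow> real) \<Rightarrow> nat \<Rightarrow> real) set \<Rightarrow> ((nat \<Rightarrow> real) \<Rightarrow> real) \<Rightarrow> bool"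
  for n \<Phi> where
  smooth: "smooth_on n (Rn n) f \<Longrightarrow> generated n \<Phi> f"
| compose: "smooth_on n (Rn n) f \<Longrightarrow> \<phi> \<in> \<Phi> \<Longrightarrow> generated n \<Phi> (\<lambda>x. f (\<phi> x))"
| add: "generated n \<Phi> f \<Longrightarrow> generated n \<Phi> g \<Longrightarrow> generated n \<Phi> (\<lambda>x. f x + g x)"
| mult: "generated n \<Phi> f \<Longrightarrow> generated n \<Phi> g \<Longrightarrow> generated n \<Phi> (\<lambda>x. f x * g x)"

lemma generated_sum:
  fixes m :: nat
  shows "(\<And>j. j < m \<Longrightarrow> generated n \<Phi> (f j)) \<Longrightarrow> generated n \<Phi> (\<lambda>x. \<Sum>j<m. f j x)"
proof (induction m)
  case 0
  show ?case
    using generated.smooth[OF smooth_on_const[of n 0]] by simp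
next
  case (Suc m)
  then show ?case
    using generated.add[of n \<Phi> "\<lambda>x. \<Sum>j<m. f j x" "f m"] by simp
qed

lemma generated_smooth:
  assumes f: "generated n \<Phi> f"
    and maps: "\<And>\<phi> x. \<phi> \<in> \<Phi> \<Longrightarrow> x \<in> Rn n \<Longrightarrow> \<phi> x \<in> Rn n"
    and comps: "\<And>\<phi> j. \<phi> \<in> \<Phi> \<Longrightarrow> j < n \<Longrightarrow> smooth_on n (Rn n) (\<lambda>x. \<phi> x j)"
  shows "smooth_on n (Rn n) f"
proof (rule smooth_on_coinduct[where A = "generated n \<Phi>", OF f])
  fix f assume "generated n \<Phi> f"
  then show "continuous_on (Rn n) f"
  proof induction
    case (compose f \<phi>)
    have "continuous_on (Rn n) (\<lambda>x. \<phi> x j)" for j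
    proof (cases "j < n")
      case True
      then show ?thesis
        using comps[OF compose(2)] smooth_on_continuous by blast
    next
      case False
      then have "\<phi> x j = 0" if "x \<in> Rn n" for x
        using maps[OF compose(2) that] by (simp add: Rn_def)
      then show ?thesis
        by (simp cong: continuous_on_cong)
    qed
    then have "continuous_on (Rn n) \<phi>"
      by (rule continuous_on_coordinatewise_then_product)
    then show ?case
      using continuous_on_compose2[OF smooth_on_continuous[OF compose(1)]] maps[OF compose(2)] by blast
  qed (auto intro: smooth_on_continuous continuous_intros)
next
  fix f i assume "generated n \<Phi> f" and i: "i < n"
  then show "\<exists>g. generated n \<Phi> g \<and>
      (\<forall>x\<in>Rn n. ((\<lambda>t. f (x(i := t))) has_real_derivative g x) (at (x i)))"
  proof induction
    case (smooth f)
    then show ?case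
      using smooth_on_has_part[OF _ i] generated.smooth[OF smooth_on_part[OF _ i]] by blast
  next
    case (compose f \<phi>)
    note \<phi> = comps[OF compose(2)]
    let ?g = "\<lambda>x. \<Sum>j<n. part j f (\<phi> x) * part i (\<lambda>x. \<phi> x j) x"
    have "generated n \<Phi> ?g"
      by (intro generated_sum generated.mult generated.compose generated.smooth smooth_on_part compose \<phi> i)
    moreover have "((\<lambda>t. f (\<phi> (x(i := t)))) has_real_derivative ?g x) (at (x i))" if x: "x \<in> Rn n" for x
      using partial_chain_rule[of n "\<lambda>j. part j f" f "\<lambda>t. \<phi> (x(i := t))" "\<lambda>j. part i (\<lambda>x. \<phi> x j) x" "x i"]
        smooth_on_continuous[OF smooth_on_part[OF compose(1)]] smooth_on_has_part[OF compose(1)]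
        maps[OF compose(2) Rn_upd[OF x i]] smooth_on_has_part[OF \<phi> i x] by simp
    ultimately show ?case
      by blast
  next
    case (add f g)
    then obtain f' g' where fg: "generated n \<Phi> f'" "generated n \<Phi> g'"
      "\<And>x. x \<in> Rn n \<Longrightarrow> ((\<lambda>t. f (x(i := t))) has_real_derivative f' x) (at (x i))"
      "\<And>x. x \<in> Rn n \<Longrightarrow> ((\<lambda>t. g (x(i := t))) has_real_derivative g' x) (at (x i))"
      by blast
    have "((\<lambda>t. f (x(i := t)) + g (x(i := t))) has_real_derivative f' x + g' x) (at (x i))"
      if "x \<in> Rn n" for x
      by (rule DERIV_add[OF fg(3)[OF that] fg(4)[OF that]])
    then show ?case
      using generated.add[OF fg(1,2)] by blast
  next
    case (mult f g)
    then obtain f' g' where fg: "generated n \<Phi> f'" "generated n \<Phi> g'"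
      "\<And>x. x \<in> Rn n \<Longrightarrow> ((\<lambda>t. f (x(i := t))) has_real_derivative f' x) (at (x i))"
      "\<And>x. x \<in> Rn n \<Longrightarrow> ((\<lambda>t. g (x(i := t))) has_real_derivative g' x) (at (x i))"
      by blast
    have "((\<lambda>t. f (x(i := t)) * g (x(i := t))) has_real_derivative f' x * g x + g' x * f x) (at (x i))"
      if "x \<in> Rn n" for x
      using DERIV_mult[OF fg(3)[OF that] fg(4)[OF that]] by simp
    then show ?case
      using generated.add[OF generated.mult[OF fg(1) mult.hyps(2)] generated.mult[OF fg(2) mult.hyps(1)]]
      by blast
  qed
qed

lemma smooth_on_add:
  "smooth_on n (Rn n) f \<Longrightarrow> smooth_on n (Rn n) g \<Longrightarrow> smooth_on n (Rn n) (\<lambda>x. f x + g x)"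
  by (rule generated_smooth[of n "{}"]) (auto intro: generated.intros)

lemma smooth_on_mult:
  "smooth_on n (Rn n) f \<Longrightarrow> smooth_on n (Rn n) g \<Longrightarrow> smooth_on n (Rn n) (\<lambda>x. f x * g x)"
  by (rule generated_smooth[of n "{}"]) (auto intro: generated.intros)

lemma smooth_on_compose:
  assumes "smooth_on n (Rn n) f" and "\<And>x. x \<in> Rn n \<Longrightarrow> \<phi> x \<in> Rn n"
    and "\<And>j. j < n \<Longrightarrow> smooth_on n (Rn n) (\<lambda>x. \<phi> x j)"
  shows "smooth_on n (Rn n) (\<lambda>x. f (\<phi> x))"
  by (rule generated_smooth[of n "{\<phi>}"]) (use assms in \<open>auto intro: generated.intros\<close>)

lemma smooth_on_sum:
  assumes "finite I" and "\<And>i. i \<in> I \<Longrightarrow> smooth_on n (Rn n) (f i)"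
  shows "smooth_on n (Rn n) (\<lambda>x. \<Sum>i\<in>I. f i x)"
  using assms
proof (induction I rule: finite_induct)
  case empty
  show ?case
    using smooth_on_const[of n 0] by simp
next
  case (insert i I)
  then show ?case
    using smooth_on_add[of n "f i" "\<lambda>x. \<Sum>i\<in>I. f i x"] by simp
qed


section \<open>Formal Cartesian spaces\<close>

lemma fun_alg_simps [simp]:
  "carrier (fun_alg (n, D)) = {f \<in> Rn n \<rightarrow>\<^sub>E carrier (weil D). \<forall>l. smooth_on n (Rn n) (\<lambda>x. f x l)}"
  "f \<otimes>\<^bsub>fun_alg (n, D)\<^esub> g = (\<lambda>x \<in> Rn n. f x \<otimes>\<^bsub>weil D\<^esub> g x)"
  "f \<oplus>\<^bsub>fun_alg (n, D)\<^esub> g = (\<lambda>x \<in> Rn n. f x \<oplus>\<^bsub>weil D\<^esub> g x)"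
  "\<one>\<^bsub>fun_alg (n, D)\<^esub> = (\<lambda>x \<in> Rn n. \<one>\<^bsub>weil D\<^esub>)"
  "\<zero>\<^bsub>fun_alg (n, D)\<^esub> = (\<lambda>x \<in> Rn n. \<zero>\<^bsub>weil D\<^esub>)"
  "r \<odot>\<^bsub>fun_alg (n, D)\<^esub> f = (\<lambda>x \<in> Rn n. r \<odot>\<^bsub>weil D\<^esub> f x)"
  by (simp_all add: fun_alg_def)

lemma weil_simps:
  "carrier (weil (k, c)) = {v. \<forall>l > k. v l = 0}"
  "v \<otimes>\<^bsub>weil (k, c)\<^esub> w = (\<lambda>l. if l = 0 then v 0 * w 0
      else if l \<le> k then v 0 * w l + v l * w 0 + (\<Sum>i = 1..k. \<Sum>j = 1..k. c i j l * v i * w j) else 0)"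
  "\<one>\<^bsub>weil (k, c)\<^esub> = (\<lambda>l. if l = 0 then 1 else 0)"
  "\<zero>\<^bsub>weil (k, c)\<^esub> = (\<lambda>l. 0)"
  "v \<oplus>\<^bsub>weil (k, c)\<^esub> w = (\<lambda>l. v l + w l)"
  "r \<odot>\<^bsub>weil (k, c)\<^esub> v = (\<lambda>l. r * v l)"
  by (simp_all add: weil_def)

lemma weil_mult_closed: "v \<in> carrier (weil D) \<Longrightarrow> w \<in> carrier (weil D) \<Longrightarrow> v \<otimes>\<^bsub>weil D\<^esub> w \<in> carrier (weil D)"
    and weil_add_closed: "v \<in> carrier (weil D) \<Longrightarrow> w \<in> carrier (weil D) \<Longrightarrow> v \<oplus>\<^bsub>weil D\<^esub> w \<in> carrier (weil D)"
    and weil_one_closed: "\<one>\<^bsub>weil D\<^esub> \<in> carrier (weil D)"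
    and weil_smult_closed: "v \<in> carrier (weil D) \<Longrightarrow> r \<odot>\<^bsub>weil D\<^esub> v \<in> carrier (weil D)"
  by (cases D; simp add: weil_simps)+

lemma restrict_in_fun_alg:
  assumes "\<And>x. x \<in> Rn n \<Longrightarrow> f x \<in> carrier (weil D)" and "\<And>l. smooth_on n (Rn n) (\<lambda>x. f x l)"
  shows "(\<lambda>x \<in> Rn n. f x) \<in> carrier (fun_alg (n, D))"
proof -
  have "smooth_on n (Rn n) (\<lambda>x. (\<lambda>x \<in> Rn n. f x) x l)" for l
    by (rule smooth_on_cong[OF _ assms(2)[of l]]) simp
  then show ?thesis
    using assms(1) by auto
qed

lemma fun_alg_mult_closed:
  assumes f: "f \<in> carrier (fun_alg (n, D))" and g: "g \<in> carrier (fun_alg (n, D))"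
  shows "f \<otimes>\<^bsub>fun_alg (n, D)\<^esub> g \<in> carrier (fun_alg (n, D))"
  unfolding fun_alg_simps(2)
proof (rule restrict_in_fun_alg)
  show "f x \<otimes>\<^bsub>weil D\<^esub> g x \<in> carrier (weil D)" if "x \<in> Rn n" for x
    using f g that by (auto intro!: weil_mult_closed)
  obtain k c where D: "D = (k, c)"
    by (cases D) auto
  have f': "smooth_on n (Rn n) (\<lambda>x. f x l)" and g': "smooth_on n (Rn n) (\<lambda>x. g x l)" for l
    using f g by auto
  show "smooth_on n (Rn n) (\<lambda>x. (f x \<otimes>\<^bsub>weil D\<^esub> g x) l)" for l
    unfolding D weil_simps
    by (cases "l = 0"; cases "l \<le> k")
      (auto intro!: smooth_on_mult smooth_on_add smooth_on_sum smooth_on_const f' g')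
qed

lemma fun_alg_add_closed:
  assumes f: "f \<in> carrier (fun_alg (n, D))" and g: "g \<in> carrier (fun_alg (n, D))"
  shows "f \<oplus>\<^bsub>fun_alg (n, D)\<^esub> g \<in> carrier (fun_alg (n, D))"
  unfolding fun_alg_simps(3)
proof (rule restrict_in_fun_alg)
  show "f x \<oplus>\<^bsub>weil D\<^esub> g x \<in> carrier (weil D)" if "x \<in> Rn n" for x
    using f g that by (auto intro!: weil_add_closed)
  show "smooth_on n (Rn n) (\<lambda>x. (f x \<oplus>\<^bsub>weil D\<^esub> g x) l)" for l
    using f g by (cases D) (auto simp: weil_simps(5) intro!: smooth_on_add)
qed

lemma fun_alg_one_closed: "\<one>\<^bsub>fun_alg (n, D)\<^esub> \<in> carrier (fun_alg (n, D))"
  unfolding fun_alg_simps(4) by (rule restrict_in_fun_alg) (auto intro: weil_one_closed smooth_on_const)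

lemma fun_alg_smult_closed:
  assumes f: "f \<in> carrier (fun_alg (n, D))"
  shows "r \<odot>\<^bsub>fun_alg (n, D)\<^esub> f \<in> carrier (fun_alg (n, D))"
  unfolding fun_alg_simps(6)
proof (rule restrict_in_fun_alg)
  show "r \<odot>\<^bsub>weil D\<^esub> f x \<in> carrier (weil D)" if "x \<in> Rn n" for x
    using f that by (auto intro!: weil_smult_closed)
  show "smooth_on n (Rn n) (\<lambda>x. (r \<odot>\<^bsub>weil D\<^esub> f x) l)" for l
    using f by (cases D) (auto simp: weil_simps(6) intro!: smooth_on_mult smooth_on_const)
qed

text \<open>
  The common form of \<open>\<phi> \<times> id\<close>, where \<open>\<theta>\<close> is the identity, and of the inclusion of the reduction
  and the projection to it, where \<open>\<psi>\<close> is the identity.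
\<close>

lemma pointwise_alg_hom:
  assumes \<psi>: "\<And>x. x \<in> Rn n \<Longrightarrow> \<psi> x \<in> Rn n"
    and \<theta>_ring: "\<theta> \<in> ring_hom (weil D) (weil D')"
    and \<theta>_smult: "\<And>r v. v \<in> carrier (weil D) \<Longrightarrow> \<theta> (r \<odot>\<^bsub>weil D\<^esub> v) = r \<odot>\<^bsub>weil D'\<^esub> \<theta> v"
    and smooth: "\<And>f l. f \<in> carrier (fun_alg (n, D)) \<Longrightarrow> smooth_on n (Rn n) (\<lambda>x. \<theta> (f (\<psi> x)) l)"
  shows "(\<lambda>f. if f \<in> carrier (fun_alg (n, D)) then Some (\<lambda>x \<in> Rn n. \<theta> (f (\<psi> x))) else None)
    \<in> alg_hom (fun_alg (n, D)) (fun_alg (n, D'))"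
proof -
  let ?A = "fun_alg (n, D)" and ?B = "fun_alg (n, D')"
  have val: "f (\<psi> x) \<in> carrier (weil D)" if "f \<in> carrier ?A" "x \<in> Rn n" for f x
    using that \<psi> by auto
  have maps: "(\<lambda>x \<in> Rn n. \<theta> (f (\<psi> x))) \<in> carrier ?B" if "f \<in> carrier ?A" for f
    by (rule restrict_in_fun_alg[OF ring_hom_closed[OF \<theta>_ring val[OF that]] smooth[OF that]])
  have mult: "(\<lambda>x \<in> Rn n. \<theta> ((f \<otimes>\<^bsub>?A\<^esub> g) (\<psi> x))) = (\<lambda>x \<in> Rn n. \<theta> (f (\<psi> x))) \<otimes>\<^bsub>?B\<^esub> (\<lambda>x \<in> Rn n. \<theta> (g (\<psi> x)))"
    and add: "(\<lambda>x \<in> Rn n. \<theta> ((f \<oplus>\<^bsub>?A\<^esub> g) (\<psi> x))) = (\<lambda>x \<in> Rn n. \<theta> (f (\<psi> x))) \<oplus>\<^bsub>?B\<^esub> (\<lambda>x \<in> Rn n. \<theta> (g (\<psi> x)))"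
    if "f \<in> carrier ?A" "g \<in> carrier ?A" for f g
    using ring_hom_mult[OF \<theta>_ring val[OF that(1)] val[OF that(2)]]
      ring_hom_add[OF \<theta>_ring val[OF that(1)] val[OF that(2)]] \<psi>
    unfolding fun_alg_simps by (auto simp: restrict_def fun_eq_iff)
  have one: "(\<lambda>x \<in> Rn n. \<theta> (\<one>\<^bsub>?A\<^esub> (\<psi> x))) = \<one>\<^bsub>?B\<^esub>"
    using ring_hom_one[OF \<theta>_ring] \<psi> unfolding fun_alg_simps by (auto simp: restrict_def fun_eq_iff)
  have smult: "(\<lambda>x \<in> Rn n. \<theta> ((r \<odot>\<^bsub>?A\<^esub> f) (\<psi> x))) = r \<odot>\<^bsub>?B\<^esub> (\<lambda>x \<in> Rn n. \<theta> (f (\<psi> x)))"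
    if "f \<in> carrier ?A" for f r
    using \<theta>_smult[OF val[OF that]] \<psi> unfolding fun_alg_simps by (auto simp: restrict_def fun_eq_iff)
  show ?thesis
    unfolding alg_hom_def
  proof (intro CollectI conjI ballI allI)
    show "dom (\<lambda>f. if f \<in> carrier ?A then Some (\<lambda>x \<in> Rn n. \<theta> (f (\<psi> x))) else None) = carrier ?A"
      by (auto simp: dom_def simp del: fun_alg_simps split: if_splits)
    show "(\<lambda>f. the (if f \<in> carrier ?A then Some (\<lambda>x \<in> Rn n. \<theta> (f (\<psi> x))) else None)) \<in> ring_hom ?A ?B"
      by (rule ring_hom_memI)
        (simp_all add: maps mult add one fun_alg_mult_closed fun_alg_add_closed fun_alg_one_closed
          del: fun_alg_simps)
    show "the (if r \<odot>\<^bsub>?A\<^esub> f \<in> carrier ?A then Some (\<lambda>x \<in> Rn n. \<theta> ((r \<odot>\<^bsub>?A\<^esub> f) (\<psi> x))) else None)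
        = r \<odot>\<^bsub>?B\<^esub> the (if f \<in> carrier ?A then Some (\<lambda>x \<in> Rn n. \<theta> (f (\<psi> x))) else None)"
      if "f \<in> carrier ?A" for r f
      using that by (simp add: smult fun_alg_smult_closed del: fun_alg_simps)
  qed
qed

lemma times_id_alg_hom:
  assumes \<phi>: "\<And>x. x \<in> Rn n \<Longrightarrow> \<phi> x \<in> Rn n"
    and smooth: "\<And>j. j < n \<Longrightarrow> smooth_on n (Rn n) (\<lambda>x. \<phi> x j)"
  shows "times_id (n, D) \<phi> \<in> alg_hom (fun_alg (n, D)) (fun_alg (n, D))"
proof -
  have "(\<lambda>v. v) \<in> ring_hom (weil D) (weil D)"
    by (auto simp: ring_hom_def)
  moreover have "smooth_on n (Rn n) (\<lambda>x. f (\<phi> x) l)" if "f \<in> carrier (fun_alg (n, D))" for f l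
    using smooth_on_compose[OF _ \<phi> smooth, of "\<lambda>x. f x l"] that by simp
  ultimately show ?thesis
    using pointwise_alg_hom[of n \<phi> "\<lambda>v. v" D D] \<phi> unfolding times_id_def fst_conv by blast
qed

lemma FormalCartSp_simps [simp]:
  "(n, D) \<in> Obj FormalCartSp \<longleftrightarrow> infinitesimal D"
  "Hom FormalCartSp a b = alg_hom (fun_alg b) (fun_alg a)"
  "Ide FormalCartSp a = Some |` carrier (fun_alg a)"
  "Cmp FormalCartSp g f = f \<circ>\<^sub>m g"
  by (simp_all add: FormalCartSp_def)

lemma formal_covers_by_arrows: "covers_by_arrows FormalCartSp formal_covers"
  unfolding covers_by_arrows_def
proof (intro ballI, clarify)
  fix n D R d h
  assume "(n, D) \<in> Obj FormalCartSp" and "R \<in> formal_covers (n, D)" and "(d, h) \<in> R"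
  then obtain \<Phi> \<phi> where cover: "good_open_cover n \<Phi>" and \<phi>: "\<phi> \<in> \<Phi>"
    and d: "d = (n, D)" and h: "h = times_id (n, D) \<phi>"
    by (auto simp: formal_covers_def)
  have "(\<Union>\<phi>\<in>\<Phi>. \<phi> ` Rn n) = Rn n"
    using cover by (simp add: good_open_cover_def)
  then have "\<phi> x \<in> Rn n" if "x \<in> Rn n" for x
    using \<phi> that by blast
  moreover have "diffeo_onto n (Rn n) (\<phi> ` Rn n) \<phi>"
    using cover \<phi> by (simp add: good_open_cover_def)
  then have "smooth_on n (Rn n) (\<lambda>x. \<phi> x j)" if "j < n" for j
    using that by (simp add: diffeo_onto_def)
  ultimately have "times_id (n, D) \<phi> \<in> alg_hom (fun_alg (n, D)) (fun_alg (n, D))"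
    by (rule times_id_alg_hom)
  then show "d \<in> Obj FormalCartSp \<and> h \<in> Hom FormalCartSp d (n, D)"
    using \<open>(n, D) \<in> Obj FormalCartSp\<close> by (simp add: d h del: fun_alg_simps)
qed


subsection \<open>Reduction\<close>

text \<open>
  The part of \<open>f\<close> in \<open>C\<^sup>\<infinity>(\<real>\<^sup>n)\<close>. It belongs to \<open>fun_alg (n, D)\<close> for every thickening \<open>D\<close>.
\<close>

definition reduce :: "nat \<Rightarrow> elt \<Rightarrow> elt" where
  "reduce n f = (\<lambda>x \<in> Rn n. \<lambda>l. if l = 0 then f x 0 else 0)"

lemma carrier_point: "carrier (weil point) = {v. \<forall>l > 0. v l = 0}"
  and mult_point: "v \<otimes>\<^bsub>weil point\<^esub> w = (\<lambda>l. if l = 0 then v 0 * w 0 else 0)"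
  and one_point: "\<one>\<^bsub>weil point\<^esub> = (\<lambda>l. if l = 0 then 1 else 0)"
  and zero_point: "\<zero>\<^bsub>weil point\<^esub> = (\<lambda>l. 0)"
  and add_point: "v \<oplus>\<^bsub>weil point\<^esub> w = (\<lambda>l. v l + w l)"
  and smult_point: "r \<odot>\<^bsub>weil point\<^esub> v = (\<lambda>l. r * v l)"
  by (auto simp: point_def weil_simps fun_eq_iff)

lemma infinitesimal_point: "infinitesimal point"
  unfolding infinitesimal_def
  \<comment> \<open>the ideal is zero, so products of length 1 vanish\<close>
proof (intro conjI exI[of _ 1] allI impI)
  show "cring (weil point)"
  proof (rule cringI)
    show "abelian_group (weil point)"
    proof (rule abelian_groupI)
      fix v assume v: "v \<in> carrier (weil point)"
      show "\<exists>w \<in> carrier (weil point). w \<oplus>\<^bsub>weil point\<^esub> v = \<zero>\<^bsub>weil point\<^esub>"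
        by (rule bexI[of _ "\<lambda>l. - v l"]) (use v in \<open>auto simp: carrier_point add_point zero_point\<close>)
    qed (auto simp: carrier_point add_point zero_point)
    show "comm_monoid (weil point)"
      by (rule comm_monoidI) (auto simp: carrier_point mult_point one_point fun_eq_iff)
  qed (auto simp: carrier_point mult_point add_point fun_eq_iff algebra_simps)
  fix vs :: "(nat \<Rightarrow> real) list"
  assume vs: "length vs = 1 \<and> set vs \<subseteq> {v \<in> carrier (weil point). v 0 = 0}"
  then obtain v where "vs = [v]" "v 0 = 0"
    by (cases vs) auto
  then show "foldr (mult (weil point)) vs \<one>\<^bsub>weil point\<^esub> = \<zero>\<^bsub>weil point\<^esub>"
    by (auto simp: mult_point zero_point)
qed

lemma red_Obj: "red a \<in> Obj FormalCartSp"
  by (simp add: red_def infinitesimal_point)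

lemma reduce_eq: "f \<in> carrier (fun_alg (n, point)) \<Longrightarrow> reduce n f = f"
  by (auto simp: reduce_def restrict_def fun_eq_iff carrier_point extensional_def PiE_def Pi_def)

lemma reduce_in_fun_alg:
  assumes "f \<in> carrier (fun_alg (n, D))"
  shows "reduce n f \<in> carrier (fun_alg (n, D'))"
  unfolding reduce_def
proof (rule restrict_in_fun_alg)
  show "(\<lambda>l. if l = 0 then f x 0 else 0) \<in> carrier (weil D')" for x
    by (cases D') (simp add: weil_simps(1))
  show "smooth_on n (Rn n) (\<lambda>x. if l = 0 then f x 0 else 0)" for l
    using assms by (cases "l = 0") (auto intro: smooth_on_const)
qed

lemma red_incl_eq: "red_incl (n, D) = (\<lambda>f. if f \<in> carrier (fun_alg (n, D)) then Some (reduce n f) else None)"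
  by (simp only: red_incl_def reduce_def fst_conv)

lemma red_incl_Hom: "red_incl a \<in> Hom FormalCartSp (red a) a"
proof -
  obtain n D where a: "a = (n, D)"
    by (cases a) auto
  have "(\<lambda>v l. if l = 0 then v 0 else 0) \<in> ring_hom (weil D) (weil point)"
    by (cases D, rule ring_hom_memI)
      (auto simp: weil_simps carrier_point mult_point add_point one_point fun_eq_iff)
  moreover have "(\<lambda>l. if l = 0 then (r \<odot>\<^bsub>weil D\<^esub> v) 0 else 0)
      = r \<odot>\<^bsub>weil point\<^esub> (\<lambda>l. if l = 0 then v 0 else 0)" for r v
    by (cases D) (auto simp: weil_simps smult_point fun_eq_iff)
  moreover have "smooth_on n (Rn n) (\<lambda>x. if l = 0 then f x 0 else 0)" if "f \<in> carrier (fun_alg (n, D))" for f l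
    using that by (cases "l = 0") (auto intro: smooth_on_const)
  ultimately show ?thesis
    using pointwise_alg_hom[of n "\<lambda>x. x" "\<lambda>v l. if l = 0 then v 0 else 0" D point]
    unfolding a red_def fst_conv FormalCartSp_simps red_incl_eq reduce_def by blast
qed

lemma red_proj_Hom: "red_proj a \<in> Hom FormalCartSp a (red a)"
proof -
  obtain n D where a: "a = (n, D)"
    by (cases a) auto
  have "(\<lambda>v. v) \<in> ring_hom (weil point) (weil D)"
    by (cases D, rule ring_hom_memI)
      (auto simp: weil_simps carrier_point mult_point add_point one_point fun_eq_iff)
  moreover have "r \<odot>\<^bsub>weil point\<^esub> v = r \<odot>\<^bsub>weil D\<^esub> v" for r v
    by (cases D) (simp add: weil_simps smult_point)
  ultimately have "(\<lambda>f. if f \<in> carrier (fun_alg (n, point)) then Some (\<lambda>x \<in> Rn n. f x) else None)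
      \<in> alg_hom (fun_alg (n, point)) (fun_alg (n, D))"
    by (intro pointwise_alg_hom[of n "\<lambda>x. x" "\<lambda>v. v" point D]) auto
  moreover have "(\<lambda>x \<in> Rn n. f x) = f" if "f \<in> carrier (fun_alg (n, point))" for f
    using that by (auto simp: PiE_def extensional_restrict)
  then have "(\<lambda>f. if f \<in> carrier (fun_alg (n, point)) then Some (\<lambda>x \<in> Rn n. f x) else None) = red_proj (n, D)"
    by (auto simp: red_proj_def red_def restrict_map_def fun_eq_iff simp del: fun_alg_simps)
  ultimately show ?thesis
    by (simp add: a red_def del: fun_alg_simps)
qed

lemma red_proj_red_incl: "red_proj a \<cdot>\<^bsub>FormalCartSp\<^esub> red_incl a = Ide FormalCartSp (red a)"
proof -
  obtain n D where a: "a = (n, D)"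
    by (cases a) auto
  have "(red_incl a \<circ>\<^sub>m red_proj a) f = (Some |` carrier (fun_alg (n, point))) f" for f
    using reduce_in_fun_alg[of f n point D] reduce_eq[of f n] red_proj_Hom[of a]
    by (auto simp: a red_proj_def red_def restrict_map_def map_comp_def red_incl_eq simp del: fun_alg_simps)
  then show ?thesis
    by (auto simp: a red_def fun_eq_iff simp del: fun_alg_simps)
qed

text \<open>
  The difference of \<open>g\<close> and its reduction is nilpotent, and so is its image under \<open>h\<close>. But a
  real-valued function some power of which vanishes is zero.
\<close>

lemma alg_hom_reduce:
  assumes D: "infinitesimal D" and h: "h \<in> alg_hom (fun_alg (n, D)) (fun_alg (m, point))"
    and g: "g \<in> carrier (fun_alg (n, D))"
  shows "h (reduce n g) = h g"
proof -
  let ?A = "fun_alg (n, D)" and ?B = "fun_alg (m, point)" and ?W = "weil D"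
  define H where "H = (\<lambda>a. the (h a))"
  have H: "H \<in> ring_hom ?A ?B" and h_dom: "dom h = carrier ?A"
    and H_smult: "\<And>r a. a \<in> carrier ?A \<Longrightarrow> H (r \<odot>\<^bsub>?A\<^esub> a) = r \<odot>\<^bsub>?B\<^esub> H a"
    using h by (auto simp: alg_hom_def H_def simp del: fun_alg_simps)
  define v where "v = (\<lambda>x \<in> Rn n. \<lambda>l. if l = 0 then 0 else g x l)"
  have v: "v \<in> carrier ?A"
    unfolding v_def
  proof (rule restrict_in_fun_alg)
    show "(\<lambda>l. if l = 0 then 0 else g x l) \<in> carrier ?W" if "x \<in> Rn n" for x
      using g that by (cases D) (auto simp: weil_simps(1))
    show "smooth_on n (Rn n) (\<lambda>x. if l = 0 then 0 else g x l)" for l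
      using g by (cases "l = 0") (auto intro: smooth_on_const)
  qed
  note g0 = reduce_in_fun_alg[OF g, of D]
  have split: "g = reduce n g \<oplus>\<^bsub>?A\<^esub> v"
    using g by (cases D) (auto simp: reduce_def v_def weil_simps(5) fun_eq_iff PiE_def extensional_def)
  obtain N where N: "\<And>vs. length vs = N \<Longrightarrow> set vs \<subseteq> {v \<in> carrier ?W. v 0 = 0} \<Longrightarrow>
      foldr (mult ?W) vs \<one>\<^bsub>?W\<^esub> = \<zero>\<^bsub>?W\<^esub>"
    using D unfolding infinitesimal_def by auto
  \<comment> \<open>the powers of \<open>v\<close>\<close>
  define P where "P = (\<lambda>k. foldr (mult ?A) (replicate k v) \<one>\<^bsub>?A\<^esub>)"
  have P: "P k \<in> carrier ?A" for k
    by (induction k) (simp_all add: P_def fun_alg_one_closed fun_alg_mult_closed v del: fun_alg_simps)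
  have HP: "H (P k) = foldr (mult ?B) (replicate k (H v)) \<one>\<^bsub>?B\<^esub>" for k
  proof (induction k)
    case 0
    show ?case
      using ring_hom_one[OF H] by (simp add: P_def del: fun_alg_simps)
  next
    case (Suc k)
    then show ?case
      using ring_hom_mult[OF H v P[of k]] by (simp add: P_def del: fun_alg_simps)
  qed
  have P_apply: "P k x = foldr (mult ?W) (replicate k (v x)) \<one>\<^bsub>?W\<^esub>" if "x \<in> Rn n" for k x
    using that by (induction k) (simp_all add: P_def)
  have "P N x = \<zero>\<^bsub>?W\<^esub>" if x: "x \<in> Rn n" for x
  proof -
    have "v x \<in> carrier ?W" "v x 0 = 0"
      using v x by (auto simp: v_def)
    then show ?thesis
      using P_apply[OF x] N[of "replicate N (v x)"] by (simp add: subset_iff)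
  qed
  \<comment> \<open>zero as a scalar multiple, since \<open>H\<close> is known to respect scalars, sums and products\<close>
  then have "P N = (0::real) \<odot>\<^bsub>?A\<^esub> \<one>\<^bsub>?A\<^esub>"
    using P[of N] by (cases D) (auto simp: weil_simps(3,4,6) fun_eq_iff PiE_def extensional_def)
  then have HPN: "H (P N) = (0::real) \<odot>\<^bsub>?B\<^esub> H \<one>\<^bsub>?A\<^esub>"
    using H_smult[OF fun_alg_one_closed] by simp
  have pow: "foldr (mult ?B) (replicate k (H v)) \<one>\<^bsub>?B\<^esub> y 0 = H v y 0 ^ k" if "y \<in> Rn m" for y k
    using that by (induction k) (simp_all add: one_point mult_point)
  have Hv: "H v \<in> carrier ?B"
    by (rule ring_hom_closed[OF H v])
  have "H v y l = 0" if y: "y \<in> Rn m" for y l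
  proof (cases "l = 0")
    case True
    have "H v y 0 ^ N = H (P N) y 0"
      unfolding HP by (rule pow[OF y, symmetric])
    also have "\<dots> = 0"
      using HPN y by (simp add: smult_point)
    finally show ?thesis
      using True by simp
  next
    case False
    then show ?thesis
      using Hv y by (auto simp: carrier_point)
  qed
  moreover have "H g = H (reduce n g) \<oplus>\<^bsub>?B\<^esub> H v"
    using ring_hom_add[OF H g0 v] split by simp
  ultimately have "H g = H (reduce n g)"
    using ring_hom_closed[OF H g0]
    by (auto simp: add_point fun_eq_iff PiE_def extensional_def)
  moreover have "h g = Some (H g)" "h (reduce n g) = Some (H (reduce n g))"
    using g g0 unfolding h_dom[symmetric] H_def by auto
  ultimately show ?thesis
    by simp
qed

lemma red_map_Hom:
  assumes S: "category FormalCartSp" and a: "a \<in> Obj FormalCartSp" and b: "b \<in> Obj FormalCartSp"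
    and f: "f \<in> Hom FormalCartSp a b"
  shows "red_map a b f \<in> Hom FormalCartSp (red a) (red b)"
proof -
  have "arrow FormalCartSp (red_incl a) (red a) a" "arrow FormalCartSp f a b"
    "arrow FormalCartSp (red_proj b) b (red b)"
    using red_incl_Hom[of a] red_proj_Hom[of b] red_Obj a b f
    by (simp_all add: arrow_def del: FormalCartSp_simps)
  then have "arrow FormalCartSp (red_map a b f) (red a) (red b)"
    unfolding red_map_def using arrow_Cmp[OF S] by blast
  then show ?thesis
    by (simp add: arrow_def)
qed

text \<open>
  Both sides are dual to homomorphisms into an algebra of real-valued functions, and the left one is
  the right one precomposed with \<open>reduce\<close>.
\<close>

lemma red_incl_natural:
  assumes S: "category FormalCartSp" and a: "a \<in> Obj FormalCartSp" and b: "b \<in> Obj FormalCartSp"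
    and f: "f \<in> Hom FormalCartSp a b"
  shows "red_incl b \<cdot>\<^bsub>FormalCartSp\<^esub> red_map a b f = f \<cdot>\<^bsub>FormalCartSp\<^esub> red_incl a"
proof -
  obtain n D where bD: "b = (n, D)"
    by (cases b) auto
  define h where "h = f \<cdot>\<^bsub>FormalCartSp\<^esub> red_incl a"
  have "arrow FormalCartSp h (red a) b"
    unfolding h_def using arrow_Cmp[OF S, of "red_incl a" "red a" a f b] red_incl_Hom[of a] red_Obj a b f
    by (simp add: arrow_def del: FormalCartSp_simps)
  then have h: "h \<in> alg_hom (fun_alg (n, D)) (fun_alg (fst a, point))"
    by (simp add: arrow_def bD red_def del: fun_alg_simps)
  have D: "infinitesimal D"
    using b bD by simp
  have "((h \<circ>\<^sub>m red_proj b) \<circ>\<^sub>m red_incl b) g = h g" for g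
  proof (cases "g \<in> carrier (fun_alg (n, D))")
    case True
    then show ?thesis
      using alg_hom_reduce[OF D h True] reduce_in_fun_alg[OF True, of point]
      by (simp add: bD red_incl_eq red_proj_def red_def del: fun_alg_simps)
  next
    case False
    then have "h g = None"
      using h by (auto simp: alg_hom_def simp del: fun_alg_simps)
    then show ?thesis
      using False by (simp add: bD red_incl_eq del: fun_alg_simps)
  qed
  then have "(h \<circ>\<^sub>m red_proj b) \<circ>\<^sub>m red_incl b = h"
    by blast
  then show ?thesis
    by (simp add: red_map_def h_def)
qed


section \<open>The unit of the infinitesimal shape modality\<close>

lemma category_if_category_op_cat:
  assumes S: "category (op_cat S)"
  shows "category S"
proof -
  have arrow_op: "arrow (op_cat S) f b a \<longleftrightarrow> a \<in> Obj S \<and> b \<in> Obj S \<and> f \<in> Hom S a b" for f a b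
    by (auto simp: arrow_def)
  show ?thesis
    unfolding category_def
  proof (intro conjI ballI)
    fix a assume a: "a \<in> Obj S"
    show "Ide S a \<in> Hom S a a"
      using arrow_Ide[OF S, of a] a by (simp add: arrow_op)
    fix b f assume f: "b \<in> Obj S" "f \<in> Hom S a b"
    show "f \<cdot>\<^bsub>S\<^esub> Ide S a = f" and "Ide S b \<cdot>\<^bsub>S\<^esub> f = f"
      using Ide_Cmp[OF S, of f b a] Cmp_Ide[OF S, of f b a] a f by (simp_all add: arrow_op)
    fix c g assume g: "c \<in> Obj S" "g \<in> Hom S b c"
    show "g \<cdot>\<^bsub>S\<^esub> f \<in> Hom S a c"
      using arrow_Cmp[OF S, of g c b f a] a f g by (simp add: arrow_op)
    fix d h assume "d \<in> Obj S" "h \<in> Hom S c d"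
    then show "h \<cdot>\<^bsub>S\<^esub> (g \<cdot>\<^bsub>S\<^esub> f) = (h \<cdot>\<^bsub>S\<^esub> g) \<cdot>\<^bsub>S\<^esub> f"
      using Cmp_assoc[OF S, of h d c g b f a] a f g by (simp add: arrow_op)
  qed
qed

lemma FormalSmoothSet_functor:
  "X \<in> Obj FormalSmoothSet \<Longrightarrow> is_functor (op_cat FormalCartSp) Sets X"
  by (simp add: FormalSmoothSet_def sheaf_functor)

lemma fo_Im_shape [simp]: "fo (\<Im> X) a = fo X (red a)"
  and fm_Im_shape [simp]: "fm (\<Im> X) a b f = fm X (red a) (red b) (red_map b a f)"
  by (simp_all add: Im_shape_def)

text \<open>
  Naturality of \<open>\<eta>\<close> is the restriction of \<open>X\<close> along the two sides of \<open>red_incl_natural\<close>.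
\<close>

lemma Im_unit_Hom:
  assumes X: "X \<in> Obj FormalSmoothSet"
  shows "\<eta> X \<in> Hom FormalSmoothSet X (\<Im> X)"
  unfolding FormalSmoothSet_def
proof (rule sheaf_mapI)
  show FX: "is_functor (op_cat FormalCartSp) Sets X"
    by (rule FormalSmoothSet_functor[OF X])
  then have S: "category FormalCartSp"
    using category_if_category_op_cat unfolding is_functor_def by blast
  note incl = red_incl_Hom
  show "dom (\<eta> X c) = fo X c" if c: "c \<in> Obj FormalCartSp" for c
    using functor_arrow[OF FX, of "red_incl c" c "red c"] c red_Obj incl[of c]
    by (simp add: Im_unit_def arrow_def del: FormalCartSp_simps)
  show "t \<in> fo (\<Im> X) c" if "c \<in> Obj FormalCartSp" "\<eta> X c s = Some t" for c s t
    using restriction_SomeD(2)[OF FX that(1) red_Obj incl] that by (simp add: Im_unit_def)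
  show "\<eta> X c = Map.empty" if "c \<notin> Obj FormalCartSp" for c
    using that by (simp add: Im_unit_def)
  fix c d h s t s'
  assume c: "c \<in> Obj FormalCartSp" and d: "d \<in> Obj FormalCartSp" and h: "h \<in> Hom FormalCartSp d c"
    and "\<eta> X c s = Some t" and s': "fm X c d h s = Some s'"
  then have t: "fm X c (red c) (red_incl c) s = Some t"
    by (simp add: Im_unit_def)
  have "fm X d (red d) (red_incl d) \<circ>\<^sub>m fm X c d h
      = fm X (red c) (red d) (red_map d c h) \<circ>\<^sub>m fm X c (red c) (red_incl c)"
    using restriction_Cmp[OF FX c d red_Obj h incl]
      restriction_Cmp[OF FX c red_Obj red_Obj incl red_map_Hom[OF S d c h]]
      red_incl_natural[OF S d c h] by metis
  from fun_cong[OF this, of s] show "fm (\<Im> X) c d h t = \<eta> X d s'"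
    using t s' d by (simp add: Im_unit_def)
qed

text \<open>
  Restriction along \<open>red_proj\<close> provides a preimage.
\<close>

lemma Im_unit_surj:
  assumes X: "X \<in> Obj FormalSmoothSet" and c: "c \<in> Obj FormalCartSp" and y: "y \<in> fo (\<Im> X) c"
  shows "\<exists>x. \<eta> X c x = Some y"
proof -
  note FX = FormalSmoothSet_functor[OF X]
  have y: "y \<in> fo X (red c)"
    using y by simp
  obtain x where x: "fm X (red c) c (red_proj c) y = Some x"
    using restriction_defined[OF FX red_Obj c red_proj_Hom y] by blast
  have "fm X c (red c) (red_incl c) \<circ>\<^sub>m fm X (red c) c (red_proj c) = Some |` fo X (red c)"
    using restriction_Cmp[OF FX red_Obj c red_Obj red_proj_Hom red_incl_Hom]
      restriction_Ide[OF FX red_Obj] unfolding red_proj_red_incl by simp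
  from fun_cong[OF this, of y] show ?thesis
    using x y c by (auto simp: Im_unit_def)
qed

theorem theorem3p60:
  fixes \<Sigma> :: "'u::set_universe fpsh"
    and R :: "'u bundle_functr"
    and u e :: "'u fbundle \<Rightarrow> 'u fpsh_map"
  assumes "\<Sigma> \<in> Obj FormalSmoothSet"
    and "adjunction (slice FormalSmoothSet (\<Im> \<Sigma>)) (slice FormalSmoothSet \<Sigma>) (eta_pull \<Sigma>) R u e"
  shows "is_equivalence (slice FormalSmoothSet (\<Im> \<Sigma>)) (EM_jet \<Sigma> R u e) (eta_pull_EM \<Sigma> R u) \<and>
         is_equivalence (slice FormalSmoothSet (\<Im> \<Sigma>)) (PDE \<Sigma> R u e)
           (functor_comp em_to_pde (eta_pull_EM \<Sigma> R u))"
proof -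
  let ?C = "slice FormalSmoothSet (\<Im> \<Sigma>)" and ?D = "slice FormalSmoothSet \<Sigma>"
  interpret adjoint_triple ?C ?D "eta_post \<Sigma>" "eta_pull \<Sigma>" R base_unit "base_counit (\<eta> \<Sigma>)" u e
  proof
    show "adjunction ?C ?D (eta_pull \<Sigma>) R u e"
      by (rule assms(2))
    then have pull: "is_functor ?C ?D (eta_pull \<Sigma>)"
      by (simp add: adjunction_def)
    then show "adjunction ?D ?C (eta_post \<Sigma>) (eta_pull \<Sigma>) base_unit (base_counit (\<eta> \<Sigma>))"
      using base_change_adjunction[OF Im_unit_Hom[OF assms(1), unfolded FormalSmoothSet_def]]
      unfolding FormalSmoothSet_def eta_post_def eta_pull_def by blast
    show "has_equalizers ?C"
      unfolding FormalSmoothSet_def by (rule slice_Sheaves_has_equalizers[OF formal_covers_by_arrows])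
    show "reflects_isos ?C ?D (eta_pull \<Sigma>)"
      unfolding FormalSmoothSet_def eta_pull_def
      by (rule base_pull_reflects_isos) (rule Im_unit_surj[OF assms(1)])
  qed
  have jet: "jet \<Sigma> R = functor_comp (eta_pull \<Sigma>) R"
    by (rule jet_def)
  have coproduct: "jet_coproduct \<Sigma> R u = coproduct (eta_pull \<Sigma>) R u"
    by (simp add: fun_eq_iff jet_coproduct_def coproduct_def jet_def)
  have adjunct: "jet_adjunct \<Sigma> R u = adjunct ?C ?D (eta_post \<Sigma>) (eta_pull \<Sigma>) R base_unit u"
    by (simp add: fun_eq_iff jet_adjunct_def adjunct_def disk_def)
  have K: "eta_pull_EM \<Sigma> R u = comparison (eta_pull \<Sigma>) R u"
    by (simp add: eta_pull_EM_def comparison_def)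
  show ?thesis
    unfolding EM_jet_def PDE_def jet coproduct adjunct K disk_def
    using comparison_equivalence pde_equivalence by blast
qed

end
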